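(* Let $n\ge 2$ and let $0<t_1<\cdots<t_n$ be real numbers. Let $Z^{H,q}=(Z^{H,q}_t)_{t\in\mathbb{R}}$ be the Hermite process of order $q\ge 1$ ($q$ an integer) and self-similarity index $H\in(\frac12,1)$. Then the law of the random vector $(Z^{H,q}_{t_1},\dots,Z^{H,q}_{t_n})$ admits a density with respect to Lebesgue measure on $\mathbb{R}^n$.
   Context: Let $B=\{B(t),\,t\in\mathbb{R}\}$ be a two-sided standard Brownian motion with $B(0)=0$ on a complete probability space $(\Omega,\mathcal{F},\mathbb{P})$. Let $\mathfrak{H}=L^2(\mathbb{R})$ (real-valued functions), and for $h\in\mathfrak{H}$ let $B(h)=\int_{\mathbb{R}}h(t)\,dB(t)$ be the Wiener integral, so that $\{B(h)\}$ is a centred Gaussian family with $\mathbb{E}[B(h)B(g)]=\langle h,g\rangle_{\mathfrak{H}}$. Hermite polynomials: $H_0(x)=1$, $H_1(x)=x$, $H_{q+1}(x)=xH_q(x)-qH_{q-1}(x)$. For $q\ge1$, the multiple Wiener--Itô integral $I_q$ of order $q$ is the linear map from the space $\mathfrak{H}^{\odot q}$ of symmetric functions in $L^2(\mathbb{R}^q)$ to $L^2(\Omega)$ determined by $I_q(h^{\otimes q})=H_q(B(h))$ for $\|h\|_{\mathfrak{H}}=1$, extended by linearity, polarization and density; it satisfies $\mathbb{E}[I_q(f)I_q(g)]=q!\,\langle f,g\rangle_{L^2(\mathbb{R}^q)}$. Hermite process: for an integer $q\ge1$ and $H\in(\frac12,1)$, the Hermite process of order $q$ and self-similarity parameter (index)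 $H$ is $Z_t^{H,q}=I_q(L_t^{H,q})$, $t\in\mathbb{R}$, where $$L_t^{H,q}(\xi_1,\dots,\xi_q)=c(H,q)\int_0^t\prod_{j=1}^q(s-\xi_j)_+^{H_0-\frac32}\,ds,\qquad H_0=1+\frac{H-1}{q},$$ $$c(H,q)=\sqrt{\frac{H(2H-1)}{q!\,\beta(H_0-\frac12,\,2-2H_0)^q}},$$ $\beta$ is the Beta function, $\theta_+^\alpha=\theta^\alpha$ if $\theta>0$ and $0$ otherwise, and $\int_0^t=-\int_t^0$ when $t<0$. *)

theory Defs
  imports "HOL-Probability.Probability"
begin

text \<open>
  Square-integrable functions are handled through representatives, so identities in
  \<open>L\<^sup>2\<close> are identities almost everywhere.  Both Lebesgue measure on \<open>\<real>\<^sup>d\<close> and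
  random vectors use the product type \<open>Pi\<^sub>M {1..d} (\<lambda>_. lborel)\<close>, since the dimensions
  are natural-number variables.
\<close>

abbreviation leb :: "nat \<Rightarrow> (nat \<Rightarrow> real) measure" where
  "leb d \<equiv> (\<Pi>\<^sub>M i\<in>{1..d}. lborel)"

definition L2 :: "'b measure \<Rightarrow> ('b \<Rightarrow> real) set" where
  "L2 N = {f \<in> borel_measurable N. integrable N (\<lambda>x. (f x)\<^sup>2)}"

text \<open>
  Membership in \<open>L2\<close> is part of the definition because the Bochner integral of a
  non-integrable function is \<open>0\<close>.
\<close>

definition L2_tendsto :: "'b measure \<Rightarrow> (nat \<Rightarrow> 'b \<Rightarrow> real) \<Rightarrow> ('b \<Rightarrow> real) \<Rightarrow> bool" where
  "L2_tendsto N F f \<longleftrightarrow> (\<forall>n. F n \<in> L2 N) \<and> f \<in> L2 N \<and>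
     (\<lambda>n. \<integral>x. (F n x - f x)\<^sup>2 \<partial>N) \<longlonglongrightarrow> 0"

text \<open>
  Extension by density.  The relation \<open>R\<close> is the graph of a linear map, continuous for the
  \<open>L\<^sup>2\<close> norms, from a class of elementary functions to random variables; the closure of this
  graph is the graph of the continuous extension, whose values are determined up to
  almost sure equality.
\<close>

definition L2_extension ::
  "'b measure \<Rightarrow> 'a measure \<Rightarrow> (('b \<Rightarrow> real) \<Rightarrow> ('a \<Rightarrow> real) \<Rightarrow> bool) \<Rightarrow>
   ('b \<Rightarrow> real) \<Rightarrow> ('a \<Rightarrow> real) \<Rightarrow> bool" where
  "L2_extension N M R f X \<longleftrightarrow>
     (\<exists>F Y. (\<forall>n. R (F n) (Y n)) \<and> L2_tendsto N F f \<and> L2_tendsto M Y X)"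

definition two_sided_brownian_motion :: "'a measure \<Rightarrow> (real \<Rightarrow> 'a \<Rightarrow> real) \<Rightarrow> bool" where
  "two_sided_brownian_motion M B \<longleftrightarrow>
     prob_space M \<and>
     (\<forall>t. B t \<in> borel_measurable M) \<and>
     (AE \<omega> in M. B 0 \<omega> = 0) \<and>
     (AE \<omega> in M. continuous_on UNIV (\<lambda>t. B t \<omega>)) \<and>
     (\<forall>s t. s < t \<longrightarrow>
        distributed M lborel (\<lambda>\<omega>. B t \<omega> - B s \<omega>) (normal_density 0 (sqrt (t - s)))) \<and>
     (\<forall>(m::nat) \<tau>. strict_mono_on {0..m} \<tau> \<longrightarrow>
        prob_space.indep_vars M (\<lambda>_. borel) (\<lambda>i \<omega>. B (\<tau> (Suc i)) \<omega> - B (\<tau> i) \<omega>) {0..<m})"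

definition step_integral ::
  "(real \<Rightarrow> 'a \<Rightarrow> real) \<Rightarrow> (real \<Rightarrow> real) \<Rightarrow> ('a \<Rightarrow> real) \<Rightarrow> bool" where
  "step_integral B h X \<longleftrightarrow>
     (\<exists>(m::nat) c u v. (\<forall>k<m. u k \<le> v k) \<and>
        h = (\<lambda>x. \<Sum>k<m. c k * indicator {u k<..v k} x) \<and>
        X = (\<lambda>\<omega>. \<Sum>k<m. c k * (B (v k) \<omega> - B (u k) \<omega>)))"

text \<open>\<open>wiener_integral M B h X\<close>: the random variable \<open>X\<close> is a version of \<open>\<integral>h dB\<close>.\<close>

definition wiener_integral ::
  "'a measure \<Rightarrow> (real \<Rightarrow> 'a \<Rightarrow> real) \<Rightarrow> (real \<Rightarrow> real) \<Rightarrow> ('a \<Rightarrow> real) \<Rightarrow> bool" where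
  "wiener_integral M B = L2_extension lborel M (step_integral B)"

fun hermite_poly :: "nat \<Rightarrow> real \<Rightarrow> real" where
  "hermite_poly 0 x = 1"
| "hermite_poly (Suc 0) x = x"
| "hermite_poly (Suc (Suc q)) x = x * hermite_poly (Suc q) x - real (Suc q) * hermite_poly q x"

text \<open>
  By polarization, the linear span of the powers \<open>h\<^sup>\<otimes>\<^sup>q\<close> with \<open>\<parallel>h\<parallel> = 1\<close> is dense in the symmetric
  functions, so no other elementary kernels are needed.
\<close>

definition elementary_multiple_integral ::
  "'a measure \<Rightarrow> (real \<Rightarrow> 'a \<Rightarrow> real) \<Rightarrow> nat \<Rightarrow> ((nat \<Rightarrow> real) \<Rightarrow> real) \<Rightarrow> ('a \<Rightarrow> real) \<Rightarrow> bool" where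
  "elementary_multiple_integral M B q f X \<longleftrightarrow>
     (\<exists>(m::nat) c h W.
        (\<forall>k<m. wiener_integral M B (h k) (W k) \<and> (\<integral>x. (h k x)\<^sup>2 \<partial>lborel) = 1) \<and>
        f = (\<lambda>\<xi>. \<Sum>k<m. c k * (\<Prod>j\<in>{1..q}. h k (\<xi> j))) \<and>
        X = (\<lambda>\<omega>. \<Sum>k<m. c k * hermite_poly q (W k \<omega>)))"

definition L2_sym :: "nat \<Rightarrow> ((nat \<Rightarrow> real) \<Rightarrow> real) set" where
  "L2_sym q = {f \<in> L2 (leb q). \<forall>p. p permutes {1..q} \<longrightarrow> (AE \<xi> in leb q. f (\<xi> \<circ> p) = f \<xi>)}"

text \<open>\<open>multiple_wiener_integral M B q f X\<close>: the random variable \<open>X\<close> is a version of \<open>I\<^sub>q(f)\<close>.\<close>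

definition multiple_wiener_integral ::
  "'a measure \<Rightarrow> (real \<Rightarrow> 'a \<Rightarrow> real) \<Rightarrow> nat \<Rightarrow> ((nat \<Rightarrow> real) \<Rightarrow> real) \<Rightarrow> ('a \<Rightarrow> real) \<Rightarrow> bool" where
  "multiple_wiener_integral M B q f X \<longleftrightarrow>
     f \<in> L2_sym q \<and> L2_extension (leb q) M (elementary_multiple_integral M B q) f X"

definition pos_powr :: "real \<Rightarrow> real \<Rightarrow> real" where
  "pos_powr \<theta> \<alpha> = (if \<theta> > 0 then \<theta> powr \<alpha> else 0)"

definition hermite_H0 :: "real \<Rightarrow> nat \<Rightarrow> real" where
  "hermite_H0 H q = 1 + (H - 1) / real q"

definition hermite_const :: "real \<Rightarrow> nat \<Rightarrow> real" where
  "hermite_const H q =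
     sqrt (H * (2 * H - 1) /
       (fact q * Beta (hermite_H0 H q - 1 / 2) (2 - 2 * hermite_H0 H q) ^ q))"

text \<open>
  The interval integral changes sign when its endpoints are exchanged, as required for \<open>t < 0\<close>.
  It diverges only for \<open>\<xi>\<close> in a null set, where it has the conventional value \<open>0\<close>.
\<close>

definition hermite_kernel :: "real \<Rightarrow> nat \<Rightarrow> real \<Rightarrow> (nat \<Rightarrow> real) \<Rightarrow> real" where
  "hermite_kernel H q t \<xi> =
     hermite_const H q *
       (LBINT s=ereal 0..ereal t. (\<Prod>j\<in>{1..q}. pos_powr (s - \<xi> j) (hermite_H0 H q - 3 / 2)))"

text \<open>Since \<open>I\<^sub>q\<close> takes values in \<open>L\<^sup>2(\<Omega>)\<close>, \<open>Z t\<close> may be any version of \<open>I\<^sub>q\<close> of the kernel.\<close>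

definition hermite_process ::
  "'a measure \<Rightarrow> (real \<Rightarrow> 'a \<Rightarrow> real) \<Rightarrow> real \<Rightarrow> nat \<Rightarrow> (real \<Rightarrow> 'a \<Rightarrow> real) \<Rightarrow> bool" where
  "hermite_process M B H q Z \<longleftrightarrow>
     (\<forall>t. multiple_wiener_integral M B q (hermite_kernel H q t) (Z t))"

end

theory Submission
  imports Defs
begin

text \<open>
  The proof perturbs the Brownian path on one time interval at a time.

  Let \<open>Z = I\<^sub>q(L)\<close> and \<open>e = 1\<^bsub>(u, v]\<^esub>\<close>, and translate the noise to \<open>dB + s e dt\<close>.  A step integral
  \<open>W = \<integral>h dB\<close> becomes \<open>W + s \<langle>h, e\<rangle>\<close>, so a polynomial of degree \<open>q\<close> in step integrals becomes a
  polynomial in \<open>s\<close> of degree at most \<open>q\<close>.  Approximating \<open>Z\<close> by such polynomials, the coefficients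
  converge (they are controlled in \<open>L\<^sup>2\<close> by the isometry), and \<open>Z\<close> becomes a random polynomial
  \<open>s \<mapsto> Z\<^sup>s\<close> with \<open>Z\<^sup>0 = Z\<close> almost surely.  Its coefficient of \<open>s\<^sup>q\<close> is the number
  \<open>\<langle>L, e \<otimes> \<dots> \<otimes> e\<rangle>\<close>, which is not random.  If \<open>L\<close> vanishes as soon as its first variable lies
  in \<open>(u, v]\<close>, then \<open>Z\<^sup>s = Z\<close>.  This is \<open>multiple_integral_shift\<close>.

  By the Cameron--Martin formula (\<open>cameron_martin\<close>) the translated path has, for every \<open>s\<close>, a law
  equivalent to that of the path itself; hence an event that is null for the translated functionals
  for a single \<open>s\<close> is null for the original ones.

  For the Hermite process take \<open>(u, v] = (t\<^sub>n, t\<^sub>n\<^sub>+\<^sub>1]\<close>.  The kernels of \<open>Z\<^bsub>t\<^sub>1\<^esub>, \<dots>, Z\<^bsub>t\<^sub>n\<^esub>\<close> vanish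
  there, so these variables do not move, whereas the kernel of \<open>Z\<^bsub>t\<^sub>n\<^sub>+\<^sub>1\<^esub>\<close> is nonnegative and
  positive on a box in \<open>(t\<^sub>n, t\<^sub>n\<^sub>+\<^sub>1]\<^sup>q\<close>, so its translate is a nonconstant polynomial in \<open>s\<close>.  Let \<open>N\<close>
  be a null set of \<open>\<real>\<^sup>n\<^sup>+\<^sup>1\<close> and suppose that the law of the first \<open>n\<close> variables is absolutely
  continuous.  Almost surely the section of \<open>N\<close> above \<open>(Z\<^bsub>t\<^sub>1\<^esub>, \<dots>, Z\<^bsub>t\<^sub>n\<^esub>)\<close> is null, and so is
  its preimage under the polynomial (\<open>null_sets_vimage_poly\<close>).  By Fubini's theorem the translated
  vector avoids \<open>N\<close> almost surely for almost every \<open>s\<close>, and Cameron--Martin gives the same for the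
  vector itself (\<open>absolutely_continuous_insert\<close>).  Induction on \<open>n\<close> and the Radon--Nikodym
  theorem give the density.
\<close>

section \<open>Hermite polynomials with a variance parameter\<close>

text \<open>
  This is \<open>v\<^bsup>q/2\<^esup> H\<^sub>q(x / \<surd>v) / q!\<close>, extended polynomially to \<open>v = 0\<close>.  With the variance as an
  argument the polynomials are compatible with sums of independent Gaussians and with scaling, and a
  step function need not be normalised; the division by \<open>q!\<close> removes all binomial coefficients
  from the addition formula.
\<close>
fun scaled_hermite :: "nat \<Rightarrow> real \<Rightarrow> real \<Rightarrow> real" where
  "scaled_hermite 0 x v = 1"
| "scaled_hermite (Suc 0) x v = x"
| "scaled_hermite (Suc (Suc q)) x v =
     (x * scaled_hermite (Suc q) x v - v * scaled_hermite q x v) / real (q + 2)"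

lemma hermite_poly_eq_scaled: "hermite_poly q x = fact q * scaled_hermite q x 1"
proof (induction q x rule: hermite_poly.induct)
  case (3 q x)
  have "real (Suc (Suc q)) \<noteq> 0" by linarith
  with 3 show ?case by (simp add: field_simps del: of_nat_Suc)
qed auto

lemma scaled_hermite_0_var: "scaled_hermite q x 0 = x ^ q / fact q"
proof (induction q rule: induct_nat_012)
  case (ge2 n)
  then show ?case by (simp add: field_simps)
qed auto

lemma scaled_hermite_scale: "scaled_hermite q (a * x) (a\<^sup>2 * v) = a ^ q * scaled_hermite q x v"
proof (induction q rule: induct_nat_012)
  case (ge2 n)
  then show ?case by (simp add: field_simps power2_eq_square)
qed auto

lemma tendsto_scaled_hermite [tendsto_intros]:
  "(X \<longlongrightarrow> x) F \<Longrightarrow> (V \<longlongrightarrow> v) F \<Longrightarrow> ((\<lambda>n. scaled_hermite q (X n) (V n)) \<longlongrightarrow> scaled_hermite q x v) F"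
proof (induction q rule: induct_nat_012)
  case (ge2 n)
  then show ?case by (auto intro!: tendsto_intros)
qed (auto intro!: tendsto_intros)

lemma borel_measurable_scaled_hermite [measurable (raw)]:
  "f \<in> borel_measurable M \<Longrightarrow> (\<lambda>x. scaled_hermite q (f x) v) \<in> borel_measurable M"
proof (induction q rule: induct_nat_012)
  case (ge2 n)
  then show ?case by simp
qed auto

text \<open>
  The generating function \<open>exp (x z - v z\<^sup>2 / 2)\<close>.  Its functional equation is the addition
  formula for the polynomials; instead of composing exponentials, both sides are identified as
  solutions of one linear differential equation.
\<close>
definition hermite_fps :: "real \<Rightarrow> real \<Rightarrow> real fps" where
  "hermite_fps x v = Abs_fps (\<lambda>q. scaled_hermite q x v)"

lemma fps_deriv_hermite_fps:
  "fps_deriv (hermite_fps x v) = (fps_const x - fps_const v * fps_X) * hermite_fps x v"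
proof (rule fps_ext)
  fix n
  have "fps_nth (fps_const v * fps_X * hermite_fps x v) n = v * fps_nth (fps_X * hermite_fps x v) n"
    by (metis fps_mult_left_const_nth mult.assoc)
  then show "fps_nth (fps_deriv (hermite_fps x v)) n = fps_nth ((fps_const x - fps_const v * fps_X) * hermite_fps x v) n"
    by (cases n) (auto simp: hermite_fps_def left_diff_distrib field_simps)
qed

lemma fps_linear_ode_unique:
  fixes F G p :: "real fps"
  assumes F: "fps_deriv F = p * F" and G: "fps_deriv G = p * G" and 0: "fps_nth F 0 = fps_nth G 0"
  shows "F = G"
proof (rule fps_ext)
  fix n show "fps_nth F n = fps_nth G n"
  proof (induction n rule: less_induct)
    case (less n)
    show ?case
    proof (cases n)
      case (Suc m)
      have "fps_nth (p * F) m = fps_nth (p * G) m"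
        unfolding fps_mult_nth using less Suc by (intro sum.cong) auto
      then have "fps_nth (fps_deriv F) m = fps_nth (fps_deriv G) m" by (simp add: F G)
      then show ?thesis by (simp add: Suc)
    qed (simp add: 0)
  qed
qed

lemma hermite_fps_add: "hermite_fps (x + y) (v + w) = hermite_fps x v * hermite_fps y w"
proof (rule fps_linear_ode_unique)
  let ?p = "fps_const (x + y) - fps_const (v + w) * fps_X"
  show "fps_deriv (hermite_fps (x + y) (v + w)) = ?p * hermite_fps (x + y) (v + w)"
    by (rule fps_deriv_hermite_fps)
  show "fps_deriv (hermite_fps x v * hermite_fps y w) = ?p * (hermite_fps x v * hermite_fps y w)"
    unfolding fps_deriv_mult fps_deriv_hermite_fps
    by (simp add: algebra_simps flip: fps_const_add)
  show "fps_nth (hermite_fps (x + y) (v + w)) 0 = fps_nth (hermite_fps x v * hermite_fps y w) 0"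
    by (simp add: hermite_fps_def)
qed

lemma scaled_hermite_add:
  "scaled_hermite q (x + y) (v + w) = (\<Sum>k\<le>q. scaled_hermite k x v * scaled_hermite (q - k) y w)"
  using arg_cong[OF hermite_fps_add, of "\<lambda>f. fps_nth f q"]
  by (simp add: hermite_fps_def fps_mult_nth atMost_atLeast0)

text \<open>
  Translating the argument is the addition formula with a deterministic (variance \<open>0\<close>) second
  summand.  This is where the polynomial dependence on the translation parameter comes from.
\<close>
lemma scaled_hermite_shift:
  "scaled_hermite q (x + y) v = (\<Sum>j\<le>q. y ^ j / fact j * scaled_hermite (q - j) x v)"
  using scaled_hermite_add[of q y x 0 v] by (simp add: scaled_hermite_0_var add.commute)



text \<open>
  The same polynomials in \<open>x\<close> as formal objects, so that they can be differentiated: the normalised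
  Hermite polynomials form an Appell sequence.
\<close>
fun hermite_pol :: "nat \<Rightarrow> real \<Rightarrow> real poly" where
  "hermite_pol 0 v = 1"
| "hermite_pol (Suc 0) v = [:0, 1:]"
| "hermite_pol (Suc (Suc q)) v =
     smult (1 / real (q + 2)) (pCons 0 (hermite_pol (Suc q) v) - smult v (hermite_pol q v))"

lemma poly_hermite_pol: "poly (hermite_pol q v) x = scaled_hermite q x v"
proof (induction q rule: induct_nat_012)
  case (ge2 n)
  then show ?case by (simp add: field_simps)
qed auto

lemma pderiv_hermite_pol: "pderiv (hermite_pol (Suc q) v) = hermite_pol q v"
proof (induction q rule: induct_nat_012)
  case 0
  then show ?case by (simp add: pderiv_pCons)
next
  case 1
  then show ?case by (simp add: pderiv_pCons pderiv_smult pderiv_diff)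
next
  case (ge2 n)
  let ?D = "pCons 0 (hermite_pol (Suc n) v) - smult v (hermite_pol n v)"
  have "pderiv (hermite_pol (Suc (Suc (Suc n))) v)
      = smult (1 / real (Suc n + 2)) (hermite_pol (Suc (Suc n)) v + pCons 0 (hermite_pol (Suc n) v) - smult v (hermite_pol n v))"
    unfolding hermite_pol.simps(3)[of "Suc n"] pderiv_smult pderiv_diff pderiv_pCons ge2 ..
  also have "\<dots> = smult (1 / real (Suc n + 2)) (smult (1 / real (n + 2)) ?D + ?D)"
    by (simp add: algebra_simps)
  also have "\<dots> = smult (1 / real (Suc n + 2) * (1 / real (n + 2) + 1)) ?D"
    by (simp only: smult_add_left smult_smult[symmetric] smult_1_left)
  also have "1 / real (Suc n + 2) * (1 / real (n + 2) + 1) = 1 / real (n + 2)"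
    by (simp add: field_simps)
  also have "smult (1 / real (n + 2)) ?D = hermite_pol (Suc (Suc n)) v" by simp
  finally show ?case .
qed

section \<open>Orthogonality under Gaussian measures\<close>

lemma integrable_normal_density_poly:
  assumes "0 < \<sigma>"
  shows "integrable lborel (\<lambda>x. normal_density 0 \<sigma> x * poly p x)"
proof -
  have "integrable lborel (\<lambda>x. \<Sum>i\<le>degree p. coeff p i * (normal_density 0 \<sigma> x * x ^ i))"
    using integrable_normal_moment[OF assms, of 0] by (intro Bochner_Integration.integrable_sum) auto
  then show ?thesis by (simp add: poly_altdef sum_distrib_left ac_simps)
qed

text \<open>
  The truncated subtraction is harmless: for \<open>k = 0\<close> the right-hand side is multiplied by \<open>0\<close>.
\<close>
lemma normal_moment_recurrence:
  assumes "0 < \<sigma>"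
  shows "(\<integral>x. normal_density 0 \<sigma> x * x ^ Suc k \<partial>lborel)
       = \<sigma>\<^sup>2 * (real k * (\<integral>x. normal_density 0 \<sigma> x * x ^ (k - 1) \<partial>lborel))"
proof (cases "even k")
  case True
  then obtain j where k: "k = 2 * j" by (elim evenE)
  show ?thesis
  proof (cases j)
    case 0
    then show ?thesis using integral_normal_moment_odd[OF assms, of 0 0] k by simp
  next
    case (Suc i)
    then show ?thesis
      using integral_normal_moment_odd[OF assms, of 0 j] integral_normal_moment_odd[OF assms, of 0 i] k by simp
  qed
next
  case False
  then obtain j where k: "k = 2 * j + 1" by (elim oddE)
  have "fact (2 * Suc j) / ((2 / \<sigma>\<^sup>2) ^ Suc j * fact (Suc j))
      = \<sigma>\<^sup>2 * (real (2 * j + 1) * (fact (2 * j) / ((2 / \<sigma>\<^sup>2) ^ j * fact j)))"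
    using assms by (simp add: divide_simps)
  then have "(\<integral>x. normal_density 0 \<sigma> x * x ^ (2 * Suc j) \<partial>lborel)
      = \<sigma>\<^sup>2 * (real (2 * j + 1) * (fact (2 * j) / ((2 / \<sigma>\<^sup>2) ^ j * fact j)))"
    using integral_normal_moment_even[OF assms, of 0 "Suc j"] by simp
  moreover have "(\<integral>x. normal_density 0 \<sigma> x * x ^ (2 * j) \<partial>lborel)
      = fact (2 * j) / ((2 / \<sigma>\<^sup>2) ^ j * fact j)"
    using integral_normal_moment_even[OF assms, of 0 j] by simp
  ultimately show ?thesis using k by simp
qed

text \<open>
  Gaussian integration by parts.  On monomials it is the recurrence of the moments.
\<close>
lemma normal_Stein_poly:
  assumes "0 < \<sigma>"
  shows "(\<integral>x. normal_density 0 \<sigma> x * (x * poly p x) \<partial>lborel)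
       = \<sigma>\<^sup>2 * (\<integral>x. normal_density 0 \<sigma> x * poly (pderiv p) x \<partial>lborel)"
proof -
  let ?E = "\<lambda>f. (\<integral>x. normal_density 0 \<sigma> x * f x \<partial>lborel)"
  have int: "integrable lborel (\<lambda>x. normal_density 0 \<sigma> x * x ^ i)" for i
    using integrable_normal_moment[OF assms, of 0] by simp
  have "?E (\<lambda>x. x * poly p x) = (\<integral>x. (\<Sum>i\<le>degree p. coeff p i * (normal_density 0 \<sigma> x * x ^ Suc i)) \<partial>lborel)"
    by (simp add: poly_altdef sum_distrib_left ac_simps)
  also have "\<dots> = (\<Sum>i\<le>degree p. coeff p i * ?E (\<lambda>x. x ^ Suc i))"
    by (subst Bochner_Integration.integral_sum) (auto intro!: int simp del: power_Suc)
  also have "\<dots> = \<sigma>\<^sup>2 * (\<Sum>i\<le>degree p. coeff p i * (real i * ?E (\<lambda>x. x ^ (i - 1))))"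
    unfolding normal_moment_recurrence[OF assms] by (simp add: sum_distrib_left ac_simps)
  also have "(\<Sum>i\<le>degree p. coeff p i * (real i * ?E (\<lambda>x. x ^ (i - 1))))
      = (\<integral>x. (\<Sum>i\<le>degree p. coeff p i * (real i * (normal_density 0 \<sigma> x * x ^ (i - 1)))) \<partial>lborel)"
    by (subst Bochner_Integration.integral_sum) (auto intro!: int)
  also have "\<dots> = ?E (poly (pderiv p))"
  proof (rule Bochner_Integration.integral_cong[OF refl])
    fix x :: real
    have "poly (pderiv p) x = poly (pderiv (\<Sum>i\<le>degree p. monom (coeff p i) i)) x"
      by (simp add: poly_as_sum_of_monoms)
    also have "\<dots> = (\<Sum>i\<le>degree p. real i * coeff p i * x ^ (i - 1))"
      unfolding higher_pderiv_sum[of 1, simplified] pderiv_monom poly_sum poly_monom by simp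
    finally show "(\<Sum>i\<le>degree p. coeff p i * (real i * (normal_density 0 \<sigma> x * x ^ (i - 1))))
        = normal_density 0 \<sigma> x * poly (pderiv p) x"
      by (simp add: sum_distrib_left ac_simps)
  qed
  finally show ?thesis .
qed

text \<open>
  Integration by parts moves one factor \<open>x\<close> of the recurrence for \<open>H\<^sub>p\<^sub>+\<^sub>1\<close> to a derivative; since
  differentiation lowers the degree, the pairing of degrees \<open>p + 1\<close> and \<open>n + 1\<close> reduces to that of
  \<open>p\<close> and \<open>n\<close>.
\<close>
lemma normal_scaled_hermite_orthogonal:
  assumes "0 < \<sigma>"
  shows "(\<integral>x. normal_density 0 \<sigma> x * (scaled_hermite p x (\<sigma>\<^sup>2) * scaled_hermite q x (\<sigma>\<^sup>2)) \<partial>lborel)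
       = (if p = q then (\<sigma>\<^sup>2) ^ p / fact p else 0)"
proof -
  let ?h = "\<lambda>p. hermite_pol p (\<sigma>\<^sup>2)"
  define E where "E = (\<lambda>f. (\<integral>x. normal_density 0 \<sigma> x * poly f x \<partial>lborel))"
  have int: "integrable lborel (\<lambda>x. normal_density 0 \<sigma> x * poly f x)" for f
    by (rule integrable_normal_density_poly[OF assms])
  have E_add: "E (f + g) = E f + E g" and E_smult: "E (smult c f) = c * E f"
    and E_X: "E (pCons 0 f) = \<sigma>\<^sup>2 * E (pderiv f)" for f g c
    using int[of f] int[of g] normal_Stein_poly[OF assms, of f]
    by (auto simp: E_def distrib_left mult.left_commute[of _ c])
  have E_1: "E 1 = 1" using assms by (simp add: E_def)
  have E_rec: "real (Suc p) * E (?h (Suc p) * g) = \<sigma>\<^sup>2 * E (?h p * pderiv g)" for p g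
  proof (cases p)
    case 0
    then show ?thesis using E_X[of g] by simp
  next
    case (Suc n)
    have "smult (real (Suc p)) (?h (Suc p) * g) + smult (\<sigma>\<^sup>2) (?h n * g) = pCons 0 (?h p * g)"
      using Suc by (simp add: mult_pCons_left left_diff_distrib) 
    then have "real (Suc p) * E (?h (Suc p) * g) + \<sigma>\<^sup>2 * E (?h n * g) = E (pCons 0 (?h p * g))"
      by (metis E_add E_smult)
    also have "\<dots> = \<sigma>\<^sup>2 * (E (?h n * g) + E (?h p * pderiv g))"
      unfolding E_X pderiv_mult Suc pderiv_hermite_pol E_add by (simp add: mult.commute)
    finally show ?thesis by (simp add: algebra_simps)
  qed
  have E0: "E (?h (Suc p)) = 0" for p
    using E_rec[of p 1] by (simp add: E_def)
  have "E (?h p * ?h q) = (if p = q then (\<sigma>\<^sup>2) ^ p / fact p else 0)"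
  proof (induction p arbitrary: q)
    case 0
    then show ?case using E0 by (cases q) (auto simp: E_1)
  next
    case (Suc p)
    show ?case
    proof (cases q)
      case 0
      then show ?thesis using E0 by simp
    next
      case (Suc n)
      have "real (Suc p) * E (?h (Suc p) * ?h q) = \<sigma>\<^sup>2 * (if p = n then (\<sigma>\<^sup>2) ^ p / fact p else 0)"
        unfolding E_rec Suc pderiv_hermite_pol Suc.IH ..
      moreover have "real (Suc p) \<noteq> 0" by simp
      ultimately have "E (?h (Suc p) * ?h q) = \<sigma>\<^sup>2 * (if p = n then (\<sigma>\<^sup>2) ^ p / fact p else 0) / real (Suc p)"
        by (metis nonzero_mult_div_cancel_left)
      then show ?thesis using Suc by simp
    qed
  qed
  then show ?thesis by (simp add: E_def poly_hermite_pol)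
qed

lemma (in prob_space) expectation_scaled_hermite_normal:
  assumes N: "distributed M lborel N (normal_density 0 (sqrt l))" and l: "0 < l"
  shows "integrable M (\<lambda>\<omega>. scaled_hermite p (a * N \<omega>) (a\<^sup>2 * l) * scaled_hermite q (b * N \<omega>) (b\<^sup>2 * l))"
    and "(\<integral>\<omega>. scaled_hermite p (a * N \<omega>) (a\<^sup>2 * l) * scaled_hermite q (b * N \<omega>) (b\<^sup>2 * l) \<partial>M)
       = (if p = q then (a * b * l) ^ p / fact p else 0)"
proof -
  let ?f = "\<lambda>x. scaled_hermite p x l * scaled_hermite q x l"
  have "integrable lborel (\<lambda>x. normal_density 0 (sqrt l) x * ?f x)"
    using integrable_normal_density_poly[of "sqrt l" "hermite_pol p l * hermite_pol q l"] l
    by (simp add: poly_hermite_pol)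
  then have 1: "integrable M (\<lambda>\<omega>. ?f (N \<omega>))"
    by (subst (asm) distributed_integrable[OF N]) auto
  have 2: "(\<integral>\<omega>. ?f (N \<omega>) \<partial>M) = (if p = q then l ^ p / fact p else 0)"
    using l normal_scaled_hermite_orthogonal[of "sqrt l" p q]
    by (subst distributed_integral[OF N, symmetric]) auto
  have *: "(\<lambda>\<omega>. scaled_hermite p (a * N \<omega>) (a\<^sup>2 * l) * scaled_hermite q (b * N \<omega>) (b\<^sup>2 * l))
      = (\<lambda>\<omega>. a ^ p * b ^ q * ?f (N \<omega>))"
    by (simp add: scaled_hermite_scale fun_eq_iff)
  show "integrable M (\<lambda>\<omega>. scaled_hermite p (a * N \<omega>) (a\<^sup>2 * l) * scaled_hermite q (b * N \<omega>) (b\<^sup>2 * l))"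
    unfolding * using 1 by simp
  show "(\<integral>\<omega>. scaled_hermite p (a * N \<omega>) (a\<^sup>2 * l) * scaled_hermite q (b * N \<omega>) (b\<^sup>2 * l) \<partial>M)
       = (if p = q then (a * b * l) ^ p / fact p else 0)"
    unfolding * using 2 by (simp add: power_mult_distrib)
qed

text \<open>
  Two linear combinations of the same independent Gaussians: add one Gaussian at a time.  The addition
  formula splits off the new summand, independence factors the expectation, and orthogonality of the
  single Gaussian leaves the binomial expansion of the power of the covariance.
\<close>
lemma (in prob_space) scaled_hermite_isometry:
  fixes N :: "nat \<Rightarrow> 'a \<Rightarrow> real" and l :: "nat \<Rightarrow> real"
  assumes ind: "indep_vars (\<lambda>_. borel) N {0..<m}"
    and N: "\<And>k. k < m \<Longrightarrow> distributed M lborel (N k) (normal_density 0 (sqrt (l k)))"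
    and l: "\<And>k. k < m \<Longrightarrow> 0 < l k"
  shows "integrable M (\<lambda>\<omega>. scaled_hermite p (\<Sum>k<m. a k * N k \<omega>) (\<Sum>k<m. (a k)\<^sup>2 * l k)
           * scaled_hermite q (\<Sum>k<m. b k * N k \<omega>) (\<Sum>k<m. (b k)\<^sup>2 * l k))
       \<and> (\<integral>\<omega>. scaled_hermite p (\<Sum>k<m. a k * N k \<omega>) (\<Sum>k<m. (a k)\<^sup>2 * l k)
           * scaled_hermite q (\<Sum>k<m. b k * N k \<omega>) (\<Sum>k<m. (b k)\<^sup>2 * l k) \<partial>M)
         = (if p = q then (\<Sum>k<m. a k * b k * l k) ^ p / fact p else 0)"
  using assms
proof (induction m arbitrary: p q)
  case 0
  have "scaled_hermite p 0 0 * scaled_hermite q 0 0 = (if p = q then 0 ^ p / fact p else (0::real))"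
    by (cases p; cases q) (auto simp: scaled_hermite_0_var)
  then show ?case by (simp add: prob_space)
next
  case (Suc m)
  let ?A = "\<lambda>p q \<omega>. scaled_hermite p (\<Sum>k<m. a k * N k \<omega>) (\<Sum>k<m. (a k)\<^sup>2 * l k)
           * scaled_hermite q (\<Sum>k<m. b k * N k \<omega>) (\<Sum>k<m. (b k)\<^sup>2 * l k)"
  let ?C = "\<lambda>p q \<omega>. scaled_hermite p (a m * N m \<omega>) ((a m)\<^sup>2 * l m) * scaled_hermite q (b m * N m \<omega>) ((b m)\<^sup>2 * l m)"
  have "indep_vars (\<lambda>_. borel) N {0..<m}"
    using Suc.prems(1) by (rule indep_vars_subset) auto
  with Suc have IH: "integrable M (?A p q)" 
     "(\<integral>\<omega>. ?A p q \<omega> \<partial>M) = (if p = q then (\<Sum>k<m. a k * b k * l k) ^ p / fact p else 0)" for p q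
    by auto
  have C: "integrable M (?C p q)" "(\<integral>\<omega>. ?C p q \<omega> \<partial>M) = (if p = q then (a m * b m * l m) ^ p / fact p else 0)" for p q
    using expectation_scaled_hermite_normal[of "N m" "l m" p "a m" q "b m"] Suc.prems by auto
  have ind: "indep_var borel (?A p q) borel (?C p' q')" for p q p' q'
  proof -
    have "indep_var (PiM {0..<m} (\<lambda>_. borel)) (\<lambda>\<omega>. restrict (\<lambda>i. N i \<omega>) {0..<m})
            (PiM {m} (\<lambda>_. borel)) (\<lambda>\<omega>. restrict (\<lambda>i. N i \<omega>) {m})"
      using Suc.prems(1) by (rule indep_var_restrict) auto
    from indep_var_compose[OF this,
        of "\<lambda>x. scaled_hermite p (\<Sum>k<m. a k * x k) (\<Sum>k<m. (a k)\<^sup>2 * l k)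
           * scaled_hermite q (\<Sum>k<m. b k * x k) (\<Sum>k<m. (b k)\<^sup>2 * l k)" borel
           "\<lambda>x. scaled_hermite p' (a m * x m) ((a m)\<^sup>2 * l m) * scaled_hermite q' (b m * x m) ((b m)\<^sup>2 * l m)" borel]
    have "indep_var borel ((\<lambda>x. scaled_hermite p (\<Sum>k<m. a k * x k) (\<Sum>k<m. (a k)\<^sup>2 * l k)
           * scaled_hermite q (\<Sum>k<m. b k * x k) (\<Sum>k<m. (b k)\<^sup>2 * l k)) \<circ> (\<lambda>\<omega>. restrict (\<lambda>i. N i \<omega>) {0..<m}))
          borel ((\<lambda>x. scaled_hermite p' (a m * x m) ((a m)\<^sup>2 * l m) * scaled_hermite q' (b m * x m) ((b m)\<^sup>2 * l m))
           \<circ> (\<lambda>\<omega>. restrict (\<lambda>i. N i \<omega>) {m}))"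
      by measurable
    then show ?thesis by (simp add: comp_def)
  qed
  have prod: "integrable M (\<lambda>\<omega>. ?A p q \<omega> * ?C p' q' \<omega>)"
    "(\<integral>\<omega>. ?A p q \<omega> * ?C p' q' \<omega> \<partial>M) = (\<integral>\<omega>. ?A p q \<omega> \<partial>M) * (\<integral>\<omega>. ?C p' q' \<omega> \<partial>M)" for p q p' q'
    using indep_var_integrable[OF ind IH(1) C(1)] indep_var_lebesgue_integral[OF ind IH(1) C(1)] by auto
  have expand: "scaled_hermite p (\<Sum>k<Suc m. a k * N k \<omega>) (\<Sum>k<Suc m. (a k)\<^sup>2 * l k)
           * scaled_hermite q (\<Sum>k<Suc m. b k * N k \<omega>) (\<Sum>k<Suc m. (b k)\<^sup>2 * l k)
        = (\<Sum>i\<le>p. \<Sum>j\<le>q. ?A i j \<omega> * ?C (p - i) (q - j) \<omega>)" for \<omega>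
    unfolding sum.lessThan_Suc scaled_hermite_add sum_product by (simp add: ac_simps)
  have "(\<Sum>i\<le>p. \<Sum>j\<le>q. (\<integral>\<omega>. ?A i j \<omega> \<partial>M) * (\<integral>\<omega>. ?C (p - i) (q - j) \<omega> \<partial>M))
      = (if p = q then (\<Sum>k<Suc m. a k * b k * l k) ^ p / fact p else 0)" (is "?l = ?r")
  proof -
    have "?l = (\<Sum>i\<le>p. \<Sum>j\<le>q. if j = i \<and> p = q then (\<Sum>k<m. a k * b k * l k) ^ i / fact i * ((a m * b m * l m) ^ (p - i) / fact (p - i)) else 0)"
      unfolding IH C by (intro sum.cong refl) (auto split: if_splits)
    also have "\<dots> = (if p = q then \<Sum>i\<le>p. (\<Sum>k<m. a k * b k * l k) ^ i / fact i * ((a m * b m * l m) ^ (p - i) / fact (p - i)) else 0)"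
      by (auto simp: sum.delta intro!: sum.cong)
    also have "(\<Sum>i\<le>p. (\<Sum>k<m. a k * b k * l k) ^ i / fact i * ((a m * b m * l m) ^ (p - i) / fact (p - i)))
        = ((\<Sum>k<m. a k * b k * l k) + a m * b m * l m) ^ p / fact p"
      unfolding binomial_ring sum_divide_distrib
      by (intro sum.cong refl) (simp add: binomial_fact field_simps)
    finally show ?thesis by simp
  qed
  then show ?case
    unfolding expand using prod by (simp add: Bochner_Integration.integral_sum)
qed

section \<open>Translation of independent Gaussian variables\<close>

text \<open>
  Completing the square in the exponent: the exponential factor turns the centred Gaussian density into
  the one with mean \<open>d l\<close>.
\<close>
lemma (in prob_space) gaussian_shift_1:
  assumes N: "distributed M lborel N (normal_density 0 (sqrt l))" and l: "0 < l" and A: "A \<in> sets borel"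
  shows "(\<integral>\<^sup>+\<omega>. ennreal (exp (d * N \<omega> - d\<^sup>2 * l / 2) * indicator A (N \<omega>)) \<partial>M)
       = (\<integral>\<^sup>+\<omega>. ennreal (indicator A (N \<omega> + d * l)) \<partial>M)"
proof -
  have [measurable]: "A \<in> sets borel" by fact
  have dens: "normal_density 0 (sqrt l) (x + d * l) * exp (d * (x + d * l) - d\<^sup>2 * l / 2) = normal_density 0 (sqrt l) x" for x
    using l by (simp add: normal_density_def mult_exp_exp divide_simps) (simp add: power2_eq_square algebra_simps)
  have "(\<integral>\<^sup>+\<omega>. ennreal (exp (d * N \<omega> - d\<^sup>2 * l / 2) * indicator A (N \<omega>)) \<partial>M)
      = (\<integral>\<^sup>+x. ennreal (normal_density 0 (sqrt l) x) * ennreal (exp (d * x - d\<^sup>2 * l / 2) * indicator A x) \<partial>lborel)"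
    by (subst distributed_nn_integral[OF N]) auto
  also have "\<dots> = (\<integral>\<^sup>+x. ennreal (normal_density 0 (sqrt l) (d * l + x))
      * ennreal (exp (d * (d * l + x) - d\<^sup>2 * l / 2) * indicator A (d * l + x)) \<partial>lborel)"
    by (subst nn_integral_real_affine[where c = 1 and t = "d * l"]) auto
  also have "\<dots> = (\<integral>\<^sup>+x. ennreal (normal_density 0 (sqrt l) x) * ennreal (indicator A (x + d * l)) \<partial>lborel)"
    by (intro nn_integral_cong, subst (2) dens[symmetric])
       (simp add: ennreal_mult[symmetric] add.commute[of "d * l"] mult.assoc)
  also have "\<dots> = (\<integral>\<^sup>+\<omega>. ennreal (indicator A (N \<omega> + d * l)) \<partial>M)"
    by (subst distributed_nn_integral[OF N]) auto
  finally show ?thesis .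
qed

text \<open>
  Both measures factorise over the coordinates on boxes, so the one-dimensional case suffices.
\<close>
lemma (in prob_space) gaussian_shift:
  fixes N :: "nat \<Rightarrow> 'a \<Rightarrow> real" and l d :: "nat \<Rightarrow> real"
  assumes ind: "indep_vars (\<lambda>_. borel) N {0..<m}"
    and N: "\<And>k. k < m \<Longrightarrow> distributed M lborel (N k) (normal_density 0 (sqrt (l k)))"
    and l: "\<And>k. k < m \<Longrightarrow> 0 < l k"
  shows "distr (density M (\<lambda>\<omega>. ennreal (\<Prod>k<m. exp (d k * N k \<omega> - (d k)\<^sup>2 * l k / 2))))
           (PiM {0..<m} (\<lambda>_. borel)) (\<lambda>\<omega>. \<lambda>k\<in>{0..<m}. N k \<omega>)
       = distr M (PiM {0..<m} (\<lambda>_. borel)) (\<lambda>\<omega>. \<lambda>k\<in>{0..<m}. N k \<omega> + d k * l k)"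
    (is "?P = ?Q")
proof (rule sym, rule measure_eqI_PiM_finite[where I = "{0..<m}" and M = "\<lambda>_. borel"])
  have N_meas: "N k \<in> borel_measurable M" if "k < m" for k
    using ind that by (auto simp: indep_vars_def)
  have [measurable]: "(\<lambda>\<omega>. \<lambda>k\<in>{0..<m}. N k \<omega>) \<in> measurable M (PiM {0..<m} (\<lambda>_. borel))"
    "(\<lambda>\<omega>. \<lambda>k\<in>{0..<m}. N k \<omega> + d k * l k) \<in> measurable M (PiM {0..<m} (\<lambda>_. borel))"
    "(\<lambda>\<omega>. \<Prod>k<m. exp (d k * N k \<omega> - (d k)\<^sup>2 * l k / 2)) \<in> borel_measurable M"
    using N_meas by (auto intro!: measurable_restrict borel_measurable_prod)
  fix A assume A: "\<And>i. i \<in> {0..<m} \<Longrightarrow> A i \<in> sets (borel :: real measure)"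
  have box: "Pi\<^sub>E {0..<m} A \<in> sets (PiM {0..<m} (\<lambda>_. borel))"
    using A by (intro sets_PiM_I_finite) auto
  have prod_indicator: "(\<Prod>k\<in>{0..<m}. indicator (A k) (f k)) = (indicator (Pi\<^sub>E {0..<m} A) (\<lambda>k\<in>{0..<m}. f k) :: real)" for f
  proof (cases "\<forall>k\<in>{0..<m}. f k \<in> A k")
    case False
    then have "(\<Prod>k\<in>{0..<m}. indicator (A k) (f k)) = (0 :: real)"
      by (intro prod_zero) (auto simp: indicator_def)
    with False show ?thesis by (auto simp: indicator_def PiE_def Pi_def)
  qed (auto simp: indicator_def)
  have ind1: "indep_vars (\<lambda>_. borel) (\<lambda>k \<omega>. ennreal (indicator (A k) (N k \<omega> + d k * l k))) {0..<m}"
    using A by (intro indep_vars_compose2[OF ind, of "\<lambda>k x. ennreal (indicator (A k) (x + d k * l k))"]) auto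
  have ind2: "indep_vars (\<lambda>_. borel) (\<lambda>k \<omega>. ennreal (exp (d k * N k \<omega> - (d k)\<^sup>2 * l k / 2) * indicator (A k) (N k \<omega>))) {0..<m}"
    using A by (intro indep_vars_compose2[OF ind, of "\<lambda>k x. ennreal (exp (d k * x - (d k)\<^sup>2 * l k / 2) * indicator (A k) x)"]) auto
  have "emeasure ?Q (Pi\<^sub>E {0..<m} A) = (\<integral>\<^sup>+\<omega>. indicator (Pi\<^sub>E {0..<m} A) (\<lambda>k\<in>{0..<m}. N k \<omega> + d k * l k) \<partial>M)"
    using box by (simp add: nn_integral_distr flip: nn_integral_indicator)
  also have "\<dots> = (\<integral>\<^sup>+\<omega>. ennreal (\<Prod>k\<in>{0..<m}. indicator (A k) (N k \<omega> + d k * l k)) \<partial>M)"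
    unfolding prod_indicator by (intro nn_integral_cong) (simp split: split_indicator)
  also have "\<dots> = (\<Prod>k\<in>{0..<m}. \<integral>\<^sup>+\<omega>. ennreal (indicator (A k) (N k \<omega> + d k * l k)) \<partial>M)"
    using indep_vars_nn_integral[OF _ ind1] by (simp add: prod_ennreal)
  also have "\<dots> = (\<Prod>k\<in>{0..<m}. \<integral>\<^sup>+\<omega>. ennreal (exp (d k * N k \<omega> - (d k)\<^sup>2 * l k / 2) * indicator (A k) (N k \<omega>)) \<partial>M)"
    using A by (intro prod.cong refl gaussian_shift_1[symmetric] N l) auto
  also have "\<dots> = (\<integral>\<^sup>+\<omega>. ennreal (\<Prod>k\<in>{0..<m}. exp (d k * N k \<omega> - (d k)\<^sup>2 * l k / 2) * indicator (A k) (N k \<omega>)) \<partial>M)"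
    using indep_vars_nn_integral[OF _ ind2] by (simp add: prod_ennreal)
  also have "\<dots> = (\<integral>\<^sup>+\<omega>. ennreal (\<Prod>k<m. exp (d k * N k \<omega> - (d k)\<^sup>2 * l k / 2))
      * indicator (Pi\<^sub>E {0..<m} A) (\<lambda>k\<in>{0..<m}. N k \<omega>) \<partial>M)"
    unfolding prod.distrib prod_indicator
    by (intro nn_integral_cong) (simp add: lessThan_atLeast0 split: split_indicator)
  also have "\<dots> = emeasure ?P (Pi\<^sub>E {0..<m} A)"
    using box by (simp add: nn_integral_distr nn_integral_density flip: nn_integral_indicator)
  finally show "emeasure ?Q (Pi\<^sub>E {0..<m} A) = emeasure ?P (Pi\<^sub>E {0..<m} A)" .
next
  have N_meas: "N k \<in> borel_measurable M" if "k < m" for k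
    using ind that by (auto simp: indep_vars_def)
  have [measurable]: "(\<lambda>\<omega>. \<lambda>k\<in>{0..<m}. N k \<omega> + d k * l k) \<in> measurable M (PiM {0..<m} (\<lambda>_. borel))"
    using N_meas by (auto intro!: measurable_restrict)
  interpret Q: prob_space ?Q by (rule prob_space_distr) measurable
  show "range (\<lambda>_::nat. Pi\<^sub>E {0..<m} (\<lambda>_. UNIV)) \<subseteq> prod_algebra {0..<m} (\<lambda>_. borel :: real measure)"
    by (auto intro!: prod_algebraI_finite)
  show "(\<Union>i::nat. Pi\<^sub>E {0..<m} (\<lambda>_. UNIV)) = space (Pi\<^sub>M {0..<m} (\<lambda>_. borel :: real measure))"
    by (auto simp: space_PiM)
  show "emeasure ?Q (Pi\<^sub>E {0..<m} (\<lambda>_. UNIV)) \<noteq> \<infinity>" by simp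
qed auto

section \<open>Step integrals on a grid\<close>

definition L2_inner :: "'b measure \<Rightarrow> ('b \<Rightarrow> real) \<Rightarrow> ('b \<Rightarrow> real) \<Rightarrow> real" where
  "L2_inner N f g = (\<integral>x. f x * g x \<partial>N)"

text \<open>
  A grid is an increasing enumeration \<open>p 0 < \<dots> < p m\<close>, the form in which independence of the
  increments of Brownian motion is stated.
\<close>
lemma strict_mono_on_grid_exists:
  assumes "finite (P :: real set)"
  shows "\<exists>m p. strict_mono_on {0..m} p \<and> P \<subseteq> p ` {0..m::nat}"
proof -
  let ?xs = "sorted_list_of_set (insert 0 P)"
  have "length ?xs > 0"
    using assms by (metis finite_insert insert_not_empty length_greater_0_conv set_empty set_sorted_list_of_set)
  then have "strict_mono_on {0..length ?xs - 1} (\<lambda>k. ?xs ! k)"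
    using strict_sorted_list_of_set[of "insert 0 P"]
    by (intro strict_mono_onI) (auto simp: sorted_wrt_iff_nth_less)
  moreover have "P \<subseteq> (\<lambda>k. ?xs ! k) ` {0..length ?xs - 1}"
  proof
    fix x assume "x \<in> P"
    then have "x \<in> set ?xs" using assms by (metis finite_insert insertCI set_sorted_list_of_set)
    then obtain k where "k < length ?xs" "?xs ! k = x" by (auto simp: in_set_conv_nth)
    then show "x \<in> (\<lambda>k. ?xs ! k) ` {0..length ?xs - 1}" by (intro image_eqI[of _ _ k]) auto
  qed
  ultimately show ?thesis by blast
qed

lemma grid_mono:
  fixes p :: "nat \<Rightarrow> real"
  assumes "strict_mono_on {0..m} p"
  shows "a < b \<Longrightarrow> b \<le> m \<Longrightarrow> p a < p b" and "a \<le> b \<Longrightarrow> b \<le> m \<Longrightarrow> p a \<le> p b"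
proof -
  show *: "p a < p b" if "a < b" "b \<le> m" for a b
    using assms that by (auto simp: strict_mono_on_def)
  show "p a \<le> p b" if "a \<le> b" "b \<le> m"
    using *[of a b] that by (cases "a = b") auto
qed

lemma grid_indicator:
  fixes p :: "nat \<Rightarrow> real"
  assumes p: "strict_mono_on {0..m} p" and "a \<le> b" "b \<le> m"
  shows "indicator {p a<..p b} x = (\<Sum>k\<in>{a..<b}. indicator {p k<..p (Suc k)} x :: real)"
  using \<open>a \<le> b\<close> \<open>b \<le> m\<close>
proof (induction b rule: dec_induct)
  case (step b)
  have "p a \<le> p b" "p b < p (Suc b)"
    using grid_mono[OF p] step by auto
  then have "indicator {p a<..p (Suc b)} x = (indicator {p a<..p b} x + indicator {p b<..p (Suc b)} x :: real)"
    by (auto simp: indicator_def)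
  with step show ?case by simp
qed simp

lemma grid_cells_disjoint:
  fixes p :: "nat \<Rightarrow> real"
  assumes p: "strict_mono_on {0..m} p" and "k < m" "i < m"
  shows "indicator {p k<..p (Suc k)} x * indicator {p i<..p (Suc i)} x
       = (if i = k then indicator {p k<..p (Suc k)} x else (0::real))"
proof -
  note le = grid_mono(2)[OF p]
  have "p (Suc k) \<le> p i \<or> p (Suc i) \<le> p k" if "i \<noteq> k"
    using le[of "Suc k" i] le[of "Suc i" k] assms that by (cases "k < i") auto
  then show ?thesis by (auto simp: indicator_def)
qed

lemma L2_inner_grid:
  fixes p :: "nat \<Rightarrow> real"
  assumes p: "strict_mono_on {0..m} p"
  shows "L2_inner lborel (\<lambda>x. \<Sum>k<m. a k * indicator {p k<..p (Suc k)} x)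
                          (\<lambda>x. \<Sum>k<m. b k * indicator {p k<..p (Suc k)} x)
       = (\<Sum>k<m. a k * b k * (p (Suc k) - p k))"
proof -
  have "(\<Sum>k<m. a k * indicator {p k<..p (Suc k)} x) * (\<Sum>k<m. b k * indicator {p k<..p (Suc k)} x)
      = (\<Sum>k<m. a k * b k * indicator {p k<..p (Suc k)} x :: real)" for x
  proof -
    have "(\<Sum>k<m. a k * indicator {p k<..p (Suc k)} x) * (\<Sum>k<m. b k * indicator {p k<..p (Suc k)} x)
      = (\<Sum>k<m. \<Sum>i<m. a k * b i * (indicator {p k<..p (Suc k)} x * indicator {p i<..p (Suc i)} x))"
      unfolding sum_product by (intro sum.cong refl) (simp only: ac_simps)
    also have "\<dots> = (\<Sum>k<m. \<Sum>i<m. if i = k then a k * b k * indicator {p k<..p (Suc k)} x else 0)"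
      using grid_cells_disjoint[OF p] by (intro sum.cong refl) auto
    finally show ?thesis by simp
  qed
  then have "L2_inner lborel (\<lambda>x. \<Sum>k<m. a k * indicator {p k<..p (Suc k)} x)
        (\<lambda>x. \<Sum>k<m. b k * indicator {p k<..p (Suc k)} x)
      = (\<integral>x. (\<Sum>k<m. a k * b k * indicator {p k<..p (Suc k)} x) \<partial>lborel)"
    unfolding L2_inner_def by (rule Bochner_Integration.integral_cong[OF refl])
  also have "\<dots> = (\<Sum>k<m. \<integral>x. a k * b k * indicator {p k<..p (Suc k)} x \<partial>lborel)"
    using grid_mono(2)[OF p] by (intro Bochner_Integration.integral_sum integrable_mult_right) (simp add: integrable_indicator_iff)
  also have "\<dots> = (\<Sum>k<m. a k * b k * (p (Suc k) - p k))"
    using grid_mono(2)[OF p] by (intro sum.cong refl) simp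
  finally show ?thesis .
qed

text \<open>
  Step functions come with arbitrary overlapping intervals.  On any grid containing their endpoints
  they have constant values on the cells, and their integrals are the corresponding combinations
  of the grid increments, which are independent.  Finitely many step functions share such a grid.
\<close>
lemma step_integral_on_grid:
  assumes "step_integral B h W"
  obtains P where "finite P"
    "\<And>m p. strict_mono_on {0..m} p \<Longrightarrow> P \<subseteq> p ` {0..m} \<Longrightarrow>
       \<exists>a. h = (\<lambda>x. \<Sum>k<m. a k * indicator {p k<..p (Suc k)} x) \<and>
           W = (\<lambda>\<omega>. \<Sum>k<m. a k * (B (p (Suc k)) \<omega> - B (p k) \<omega>))"
proof -
  from assms obtain n c u v where uv: "\<And>j. j < (n::nat) \<Longrightarrow> u j \<le> v j"
    and h: "h = (\<lambda>x. \<Sum>j<n. c j * indicator {u j<..v j} x)"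
    and W: "W = (\<lambda>\<omega>. \<Sum>j<n. c j * (B (v j) \<omega> - B (u j) \<omega>))"
    unfolding step_integral_def by auto
  show ?thesis
  proof (rule that[of "u ` {..<n} \<union> v ` {..<n}"])
    fix m :: nat and p :: "nat \<Rightarrow> real" assume p: "strict_mono_on {0..m} p" and P: "u ` {..<n} \<union> v ` {..<n} \<subseteq> p ` {0..m}"
    have "\<exists>a b. j < n \<longrightarrow> a \<le> b \<and> b \<le> m \<and> u j = p a \<and> v j = p b" for j
    proof (cases "j < n")
      case True
      then have "u j \<in> p ` {0..m}" "v j \<in> p ` {0..m}" using P by auto
      then obtain a b where ab: "a \<le> m" "b \<le> m" "u j = p a" "v j = p b" by auto
      have "a \<le> b"
      proof (rule ccontr)
        assume "\<not> a \<le> b"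
        then have "p b < p a" using grid_mono(1)[OF p, of b a] ab by simp
        with uv[OF True] ab show False by simp
      qed
      with ab show ?thesis by blast
    qed simp
    then obtain \<alpha> \<beta> where ab: "\<And>j. j < n \<Longrightarrow> \<alpha> j \<le> \<beta> j \<and> \<beta> j \<le> m \<and> u j = p (\<alpha> j) \<and> v j = p (\<beta> j)"
      by metis
    define a where "a = (\<lambda>k. \<Sum>j<n. if k \<in> {\<alpha> j..<\<beta> j} then c j else 0)"
    have regroup: "(\<Sum>j<n. c j * (\<Sum>k\<in>{\<alpha> j..<\<beta> j}. g k)) = (\<Sum>k<m. a k * g k)" for g :: "nat \<Rightarrow> real"
    proof -
      have "(\<Sum>j<n. c j * (\<Sum>k\<in>{\<alpha> j..<\<beta> j}. g k)) = (\<Sum>j<n. \<Sum>k<m. if k \<in> {\<alpha> j..<\<beta> j} then c j * g k else 0)"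
      proof (intro sum.cong refl)
        fix j assume "j \<in> {..<n}"
        then have "{\<alpha> j..<\<beta> j} = {k \<in> {..<m}. k \<in> {\<alpha> j..<\<beta> j}}" using ab[of j] by auto
        then have "(\<Sum>k\<in>{\<alpha> j..<\<beta> j}. g k) = (\<Sum>k | k \<in> {..<m} \<and> k \<in> {\<alpha> j..<\<beta> j}. g k)" by simp
        also have "\<dots> = (\<Sum>k<m. if k \<in> {\<alpha> j..<\<beta> j} then g k else 0)"
          by (subst sum.inter_filter) auto
        finally have *: "(\<Sum>k\<in>{\<alpha> j..<\<beta> j}. g k) = (\<Sum>k<m. if k \<in> {\<alpha> j..<\<beta> j} then g k else 0)" .
        show "c j * (\<Sum>k\<in>{\<alpha> j..<\<beta> j}. g k) = (\<Sum>k<m. if k \<in> {\<alpha> j..<\<beta> j} then c j * g k else 0)"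
          unfolding * sum_distrib_left by (intro sum.cong) auto
      qed
      also have "\<dots> = (\<Sum>k<m. a k * g k)"
        unfolding a_def sum_distrib_right by (subst sum.swap) (intro sum.cong refl, auto)
      finally show ?thesis .
    qed
    have "h = (\<lambda>x. \<Sum>k<m. a k * indicator {p k<..p (Suc k)} x)"
      unfolding h regroup[symmetric] using ab grid_indicator[OF p] by (intro ext sum.cong refl) auto
    moreover have "B (v j) \<omega> - B (u j) \<omega> = (\<Sum>k\<in>{\<alpha> j..<\<beta> j}. B (p (Suc k)) \<omega> - B (p k) \<omega>)" if "j < n" for j \<omega>
      using ab[OF that] sum_Suc_diff'[of "\<alpha> j" "\<beta> j" "\<lambda>k. B (p k) \<omega>"] by simp
    then have "W = (\<lambda>\<omega>. \<Sum>k<m. a k * (B (p (Suc k)) \<omega> - B (p k) \<omega>))"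
      unfolding W regroup[symmetric] by (intro ext sum.cong refl) auto
    ultimately show "\<exists>a. h = (\<lambda>x. \<Sum>k<m. a k * indicator {p k<..p (Suc k)} x) \<and>
           W = (\<lambda>\<omega>. \<Sum>k<m. a k * (B (p (Suc k)) \<omega> - B (p k) \<omega>))" by blast
  qed simp
qed

locale brownian = prob_space M for M :: "'a measure" +
  fixes B :: "real \<Rightarrow> 'a \<Rightarrow> real"
  assumes brownian_motion: "two_sided_brownian_motion M B"
begin

lemma B_measurable [measurable]: "B t \<in> borel_measurable M"
  using brownian_motion by (simp add: two_sided_brownian_motion_def)

lemma step_integral_measurable:
  "step_integral B h W \<Longrightarrow> W \<in> borel_measurable M"
  by (auto simp: step_integral_def)

lemma grid_increments:
  assumes p: "strict_mono_on {0..m} p"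
  shows "indep_vars (\<lambda>_. borel) (\<lambda>k \<omega>. B (p (Suc k)) \<omega> - B (p k) \<omega>) {0..<m}"
    and "k < m \<Longrightarrow> 0 < p (Suc k) - p k"
    and "k < m \<Longrightarrow> distributed M lborel (\<lambda>\<omega>. B (p (Suc k)) \<omega> - B (p k) \<omega>) (normal_density 0 (sqrt (p (Suc k) - p k)))"
proof -
  show "indep_vars (\<lambda>_. borel) (\<lambda>k \<omega>. B (p (Suc k)) \<omega> - B (p k) \<omega>) {0..<m}"
    using brownian_motion p by (simp add: two_sided_brownian_motion_def)
  show *: "0 < p (Suc k) - p k" if "k < m" for k using p that by (auto simp: strict_mono_on_def)
  show "k < m \<Longrightarrow> distributed M lborel (\<lambda>\<omega>. B (p (Suc k)) \<omega> - B (p k) \<omega>) (normal_density 0 (sqrt (p (Suc k) - p k)))"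
    using brownian_motion *[of k] by (simp add: two_sided_brownian_motion_def)
qed

text \<open>
  On a common grid both integrals are combinations of the same independent increments.  For the
  multiple integrals divided by the factorials of their orders this is the Wiener--Ito isometry.
\<close>
lemma step_integral_isometry:
  assumes W: "step_integral B h W" and W': "step_integral B h' W'"
  shows "integrable M (\<lambda>\<omega>. scaled_hermite p (W \<omega>) (L2_inner lborel h h) * scaled_hermite q (W' \<omega>) (L2_inner lborel h' h'))"
    and "(\<integral>\<omega>. scaled_hermite p (W \<omega>) (L2_inner lborel h h) * scaled_hermite q (W' \<omega>) (L2_inner lborel h' h') \<partial>M)
       = (if p = q then L2_inner lborel h h' ^ p / fact p else 0)"
proof -
  obtain P where P: "finite P" and 1: "\<And>m p. strict_mono_on {0..m} p \<Longrightarrow> P \<subseteq> p ` {0..m} \<Longrightarrow>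
       \<exists>a. h = (\<lambda>x. \<Sum>k<m. a k * indicator {p k<..p (Suc k)} x) \<and>
           W = (\<lambda>\<omega>. \<Sum>k<m. a k * (B (p (Suc k)) \<omega> - B (p k) \<omega>))"
    using step_integral_on_grid[OF W] by blast
  obtain P' where P': "finite P'" and 2: "\<And>m p. strict_mono_on {0..m} p \<Longrightarrow> P' \<subseteq> p ` {0..m} \<Longrightarrow>
       \<exists>a. h' = (\<lambda>x. \<Sum>k<m. a k * indicator {p k<..p (Suc k)} x) \<and>
           W' = (\<lambda>\<omega>. \<Sum>k<m. a k * (B (p (Suc k)) \<omega> - B (p k) \<omega>))"
    using step_integral_on_grid[OF W'] by blast
  obtain m g where g: "strict_mono_on {0..m} g" "P \<union> P' \<subseteq> g ` {0..m::nat}"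
    using strict_mono_on_grid_exists[of "P \<union> P'"] P P' by auto
  obtain a where a: "h = (\<lambda>x. \<Sum>k<m. a k * indicator {g k<..g (Suc k)} x)"
           "W = (\<lambda>\<omega>. \<Sum>k<m. a k * (B (g (Suc k)) \<omega> - B (g k) \<omega>))" using 1[of m g] g by auto
  obtain b where b: "h' = (\<lambda>x. \<Sum>k<m. b k * indicator {g k<..g (Suc k)} x)"
           "W' = (\<lambda>\<omega>. \<Sum>k<m. b k * (B (g (Suc k)) \<omega> - B (g k) \<omega>))" using 2[of m g] g by auto
  show "integrable M (\<lambda>\<omega>. scaled_hermite p (W \<omega>) (L2_inner lborel h h) * scaled_hermite q (W' \<omega>) (L2_inner lborel h' h'))"
    "(\<integral>\<omega>. scaled_hermite p (W \<omega>) (L2_inner lborel h h) * scaled_hermite q (W' \<omega>) (L2_inner lborel h' h') \<partial>M)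
       = (if p = q then L2_inner lborel h h' ^ p / fact p else 0)"
    unfolding a b L2_inner_grid[OF g(1)]
    using scaled_hermite_isometry[OF grid_increments(1)[OF g(1)] grid_increments(3)[OF g(1)] grid_increments(2)[OF g(1)], of p a q b]
    by (auto simp: power2_eq_square)
qed

end

section \<open>The Cameron--Martin formula on path space\<close>

text \<open>
  Up to a constant, \<open>clip u v\<close> is the primitive of the indicator of \<open>(u, v]\<close>.  It is made to vanish at
  \<open>0\<close> below, like the Brownian path, so that it is the direction in the Cameron--Martin space that
  corresponds to that indicator.
\<close>
definition clip :: "real \<Rightarrow> real \<Rightarrow> real \<Rightarrow> real" where
  "clip u v t = max u (min v t)"

definition clip_path :: "real \<Rightarrow> real \<Rightarrow> real \<Rightarrow> real" where
  "clip_path u v t = clip u v t - clip u v 0"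

lemma mem_prod_emb_UNIV:
  "x \<in> prod_emb UNIV (\<lambda>_. borel) J (Pi\<^sub>E J A) \<longleftrightarrow> (\<forall>t\<in>J. x t \<in> A t)"
  by (auto simp: prod_emb_def PiE_def Pi_def)

context brownian
begin

text \<open>
  Subtracting the value at \<open>0\<close>, which is \<open>0\<close> only almost surely, makes every value of the path a
  combination of increments for every \<open>\<omega>\<close>.
\<close>
definition brownian_path :: "'a \<Rightarrow> real \<Rightarrow> real" where
  "brownian_path \<omega> t = B t \<omega> - B 0 \<omega>"

definition cameron_martin_density :: "real \<Rightarrow> real \<Rightarrow> real \<Rightarrow> 'a \<Rightarrow> real" where
  "cameron_martin_density u v s \<omega> = exp (s * (B v \<omega> - B u \<omega>) - s\<^sup>2 * (v - u) / 2)"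

lemma measurable_brownian_path_shift:
  "(\<lambda>\<omega> t. brownian_path \<omega> t + g t) \<in> measurable M (PiM UNIV (\<lambda>_. borel))"
  unfolding brownian_path_def by (intro measurable_PiM_single') auto

lemma measurable_brownian_path [measurable]: "brownian_path \<in> measurable M (PiM UNIV (\<lambda>_. borel))"
  using measurable_brownian_path_shift[of "\<lambda>_. 0"] by simp

lemma measurable_cameron_martin_density [measurable]: "cameron_martin_density u v s \<in> borel_measurable M"
  unfolding cameron_martin_density_def by measurable

text \<open>
  The law of a process on the product space is determined by its finite-dimensional projections.
  On a grid containing their time points as well as \<open>0\<close>, \<open>u\<close> and \<open>v\<close>, the claim is the translation of
  finitely many independent Gaussian increments: those in \<open>(u, v]\<close> are translated by \<open>s\<close> times their
  variance, and the product of the exponential factors telescopes to a function of \<open>B v - B u\<close>, so it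
  depends neither on the grid nor on the time points.
\<close>
theorem cameron_martin:
  assumes "u < v"
  shows "distr (density M (\<lambda>\<omega>. ennreal (cameron_martin_density u v s \<omega>))) (PiM UNIV (\<lambda>_. borel)) brownian_path
       = distr M (PiM UNIV (\<lambda>_. borel)) (\<lambda>\<omega> t. brownian_path \<omega> t + s * clip_path u v t)"
    (is "?P = ?Q")
proof (rule sym, rule measure_eqI_PiM_infinite[where I = UNIV and M = "\<lambda>_. borel"])
  have shift [measurable]: "(\<lambda>\<omega> t. brownian_path \<omega> t + s * clip_path u v t) \<in> measurable M (PiM UNIV (\<lambda>_. borel))"
    by (rule measurable_brownian_path_shift)
  show "finite_measure ?Q"
    by (intro prob_space.finite_measure prob_space_distr) measurable
  fix A :: "real \<Rightarrow> real set" and J :: "real set"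
  assume J: "finite J" and A: "\<And>i. i \<in> J \<Longrightarrow> A i \<in> sets borel"
  obtain m p where p: "strict_mono_on {0..m} p" and P: "insert 0 (insert u (insert v J)) \<subseteq> p ` {0..m::nat}"
    using strict_mono_on_grid_exists[of "insert 0 (insert u (insert v J))"] J by auto
  have "\<forall>t\<in>insert 0 (insert u (insert v J)). \<exists>k. k \<le> m \<and> p k = t" using P by fastforce
  then obtain \<alpha> where \<alpha>: "\<And>t. t \<in> insert 0 (insert u (insert v J)) \<Longrightarrow> \<alpha> t \<le> m \<and> p (\<alpha> t) = t" by metis
  define N where "N = (\<lambda>k \<omega>. B (p (Suc k)) \<omega> - B (p k) \<omega>)"
  define l where "l = (\<lambda>k. p (Suc k) - p k)"
  \<comment> \<open>Since \<open>u\<close> and \<open>v\<close> are grid points, the drift is constant on every cell.\<close>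
  define d where "d = (\<lambda>k. if k \<in> {\<alpha> u..<\<alpha> v} then s else 0)"
  define G where "G = (\<lambda>x t. (\<Sum>k<\<alpha> t. x k) - (\<Sum>k<\<alpha> 0. x k :: real))"
  define C where "C = {x \<in> space (PiM {0..<m} (\<lambda>_. borel :: real measure)). \<forall>t\<in>J. G x t \<in> A t}"
  note p_mono = grid_mono[OF p]
  have N_sum: "(\<Sum>k<b. N k \<omega>) = B (p b) \<omega> - B (p 0) \<omega>" for b \<omega>
    unfolding N_def lessThan_atLeast0 by (subst sum_Suc_diff'[of 0 b "\<lambda>k. B (p k) \<omega>"]) auto
  have uv: "\<alpha> u < \<alpha> v"
  proof (rule ccontr)
    assume "\<not> \<alpha> u < \<alpha> v"
    then have "p (\<alpha> v) \<le> p (\<alpha> u)" using \<alpha>[of u] p_mono(2)[of "\<alpha> v" "\<alpha> u"] by auto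
    with \<open>u < v\<close> \<alpha>[of u] \<alpha>[of v] show False by simp
  qed
  have cell: "d k * l k = s * (clip u v (p (Suc k)) - clip u v (p k))" if "k < m" for k
  proof -
    consider "Suc k \<le> \<alpha> u" | "k \<in> {\<alpha> u..<\<alpha> v}" | "\<alpha> v \<le> k" by fastforce
    then show ?thesis
    proof cases
      case 1
      then have "p (Suc k) \<le> u" "p k \<le> u" using p_mono(2)[of "Suc k" "\<alpha> u"] p_mono(2)[of "k" "\<alpha> u"] \<alpha>[of u] by auto
      with 1 \<open>u < v\<close> show ?thesis by (simp add: d_def clip_def)
    next
      case 2
      then have "p k \<le> p (Suc k)" "u \<le> p k" "p (Suc k) \<le> v"
        using p_mono(2)[of k "Suc k"] p_mono(2)[of "\<alpha> u" k] p_mono(2)[of "Suc k" "\<alpha> v"] \<alpha>[of u] \<alpha>[of v] that by auto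
      with 2 \<open>u < v\<close> show ?thesis by (simp add: d_def l_def clip_def)
    next
      case 3
      then have "v \<le> p (Suc k)" "v \<le> p k" using p_mono(2)[of "\<alpha> v" "Suc k"] p_mono(2)[of "\<alpha> v" k] \<alpha>[of v] that by auto
      with 3 \<open>u < v\<close> show ?thesis by (simp add: d_def clip_def)
    qed
  qed
  have dl_sum: "(\<Sum>k<b. d k * l k) = s * (clip u v (p b) - clip u v (p 0))" if "b \<le> m" for b
  proof -
    have "(\<Sum>k<b. d k * l k) = (\<Sum>k\<in>{0..<b}. s * clip u v (p (Suc k)) - s * clip u v (p k))"
      using that cell by (auto simp: lessThan_atLeast0 right_diff_distrib intro!: sum.cong)
    also have "\<dots> = s * clip u v (p b) - s * clip u v (p 0)"
      by (subst sum_Suc_diff'[of 0 b "\<lambda>k. s * clip u v (p k)"]) auto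
    finally show ?thesis by (simp add: right_diff_distrib)
  qed
  have "(\<Sum>k<b. (\<lambda>k\<in>{0..<m}. x k) k) = (\<Sum>k<b. x k :: real)" if "b \<le> m" for x b
    using that by (intro sum.cong) auto
  then have G_cong: "G (\<lambda>k\<in>{0..<m}. x k) t = G x t" if "t \<in> J" for x t
    using \<alpha>[of t] \<alpha>[of 0] that by (simp add: G_def del: restrict_apply)
  have G_path: "G (\<lambda>k. N k \<omega>) t = brownian_path \<omega> t" 
    and G_shift: "G (\<lambda>k. N k \<omega> + d k * l k) t = brownian_path \<omega> t + s * clip_path u v t" if "t \<in> J" for t \<omega>
    using \<alpha>[of t] \<alpha>[of 0] that
    by (auto simp: G_def sum.distrib N_sum dl_sum brownian_path_def clip_path_def algebra_simps)
  have G_meas: "(\<lambda>x. G x t) \<in> borel_measurable (PiM {0..<m} (\<lambda>_. borel))" if "t \<in> J" for t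
    using \<alpha>[of t] \<alpha>[of 0] that unfolding G_def
    by (intro borel_measurable_diff borel_measurable_sum measurable_component_singleton) auto
  have "{x \<in> space (PiM {0..<m} (\<lambda>_. borel :: real measure)). G x t \<in> A t} \<in> sets (PiM {0..<m} (\<lambda>_. borel))"
    if "t \<in> J" for t
    using measurable_sets[OF G_meas[OF that] A[OF that]] by (simp add: vimage_def Int_def conj_commute)
  then have C: "C \<in> sets (PiM {0..<m} (\<lambda>_. borel))"
    unfolding C_def using J by (intro sets.sets_Collect_finite_All)
  have emb: "prod_emb UNIV (\<lambda>_. borel) J (Pi\<^sub>E J A) \<in> sets (PiM UNIV (\<lambda>_. borel :: real measure))"
    using J A by (intro sets_PiM_I) auto
  have mem: "brownian_path \<omega> \<in> prod_emb UNIV (\<lambda>_. borel) J (Pi\<^sub>E J A) \<longleftrightarrow> (\<lambda>k\<in>{0..<m}. N k \<omega>) \<in> C"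
    and mem_shift: "(\<lambda>t. brownian_path \<omega> t + s * clip_path u v t) \<in> prod_emb UNIV (\<lambda>_. borel) J (Pi\<^sub>E J A)
        \<longleftrightarrow> (\<lambda>k\<in>{0..<m}. N k \<omega> + d k * l k) \<in> C" for \<omega>
    using G_cong G_path G_shift by (auto simp: mem_prod_emb_UNIV C_def space_PiM)
  have [measurable]: "N k \<in> borel_measurable M" for k unfolding N_def by measurable
  have dens: "(\<Prod>k<m. exp (d k * N k \<omega> - (d k)\<^sup>2 * l k / 2)) = cameron_martin_density u v s \<omega>" for \<omega>
  proof -
    have "(\<Sum>k<m. d k * N k \<omega> - (d k)\<^sup>2 * l k / 2)
        = (\<Sum>k<m. if k \<in> {\<alpha> u..<\<alpha> v} then s * N k \<omega> - s\<^sup>2 * l k / 2 else 0)"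
      by (intro sum.cong refl) (simp add: d_def)
    also have "\<dots> = (\<Sum>k\<in>{k\<in>{..<m}. k \<in> {\<alpha> u..<\<alpha> v}}. s * N k \<omega> - s\<^sup>2 * l k / 2)"
      by (rule sum.inter_filter[symmetric]) simp
    also have "{k\<in>{..<m}. k \<in> {\<alpha> u..<\<alpha> v}} = {\<alpha> u..<\<alpha> v}" using \<alpha>[of v] by auto
    also have "(\<Sum>k\<in>{\<alpha> u..<\<alpha> v}. s * N k \<omega> - s\<^sup>2 * l k / 2)
        = (\<Sum>k\<in>{\<alpha> u..<\<alpha> v}. (s * B (p (Suc k)) \<omega> - s\<^sup>2 * p (Suc k) / 2) - (s * B (p k) \<omega> - s\<^sup>2 * p k / 2))"
      by (intro sum.cong refl) (simp add: N_def l_def field_simps)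
    also have "\<dots> = (s * B v \<omega> - s\<^sup>2 * v / 2) - (s * B u \<omega> - s\<^sup>2 * u / 2)"
      using uv \<alpha>[of u] \<alpha>[of v] by (subst sum_Suc_diff'[of _ _ "\<lambda>k. s * B (p k) \<omega> - s\<^sup>2 * p k / 2"]) auto
    finally show ?thesis by (simp add: exp_sum[symmetric] cameron_martin_density_def field_simps)
  qed
  have fin_shift: "distr (density M (\<lambda>\<omega>. ennreal (\<Prod>k<m. exp (d k * N k \<omega> - (d k)\<^sup>2 * l k / 2))))
      (PiM {0..<m} (\<lambda>_. borel)) (\<lambda>\<omega>. \<lambda>k\<in>{0..<m}. N k \<omega>)
    = distr M (PiM {0..<m} (\<lambda>_. borel)) (\<lambda>\<omega>. \<lambda>k\<in>{0..<m}. N k \<omega> + d k * l k)"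
    unfolding N_def l_def by (intro gaussian_shift grid_increments[OF p])
  have "emeasure ?Q (prod_emb UNIV (\<lambda>_. borel) J (Pi\<^sub>E J A))
      = emeasure (distr M (PiM {0..<m} (\<lambda>_. borel)) (\<lambda>\<omega>. \<lambda>k\<in>{0..<m}. N k \<omega> + d k * l k)) C"
    using emb C mem_shift by (simp add: emeasure_distr vimage_def)
  also have "\<dots> = emeasure (distr (density M (\<lambda>\<omega>. ennreal (cameron_martin_density u v s \<omega>)))
      (PiM {0..<m} (\<lambda>_. borel)) (\<lambda>\<omega>. \<lambda>k\<in>{0..<m}. N k \<omega>)) C"
    using fin_shift unfolding dens by simp
  also have "\<dots> = emeasure ?P (prod_emb UNIV (\<lambda>_. borel) J (Pi\<^sub>E J A))"
    using emb C mem by (simp add: emeasure_distr vimage_def)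
  finally show "emeasure ?Q (prod_emb UNIV (\<lambda>_. borel) J (Pi\<^sub>E J A)) = emeasure ?P (prod_emb UNIV (\<lambda>_. borel) J (Pi\<^sub>E J A))" .
qed auto

end

section \<open>Tensor powers and the isometry of multiple integrals\<close>

lemma L2_borel_measurable: "f \<in> L2 N \<Longrightarrow> f \<in> borel_measurable N"
  and L2_integrable_square: "f \<in> L2 N \<Longrightarrow> integrable N (\<lambda>x. (f x)\<^sup>2)"
  by (auto simp: L2_def)

lemma L2_integrable_mult:
  assumes "f \<in> L2 N" "g \<in> L2 N"
  shows "integrable N (\<lambda>x. f x * g x)"
proof (rule Bochner_Integration.integrable_bound)
  show "integrable N (\<lambda>x. (f x)\<^sup>2 + (g x)\<^sup>2)" using assms by (auto simp: L2_def)
  show "(\<lambda>x. f x * g x) \<in> borel_measurable N" using assms by (auto simp: L2_def)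
  have "\<bar>a * b\<bar> \<le> a\<^sup>2 + b\<^sup>2" for a b :: real
    using sum_squares_bound[of "\<bar>a\<bar>" "\<bar>b\<bar>"] mult_nonneg_nonneg[of "\<bar>a\<bar>" "\<bar>b\<bar>"]
    by (simp only: abs_mult power2_abs) linarith
  then show "AE x in N. norm (f x * g x) \<le> norm ((f x)\<^sup>2 + (g x)\<^sup>2)" by simp
qed

lemma L2_cmult: "f \<in> L2 N \<Longrightarrow> (\<lambda>x. c * f x) \<in> L2 N"
  by (auto simp: L2_def power_mult_distrib)

lemma L2_add:
  assumes "f \<in> L2 N" "g \<in> L2 N"
  shows "(\<lambda>x. f x + g x) \<in> L2 N"
proof -
  have "integrable N (\<lambda>x. (f x)\<^sup>2 + (g x)\<^sup>2 + 2 * (f x * g x))"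
    using assms L2_integrable_mult[OF assms] by (auto simp: L2_def)
  moreover have "(\<lambda>x. f x + g x) \<in> borel_measurable N"
    using assms by (intro borel_measurable_add L2_borel_measurable)
  ultimately show ?thesis by (simp add: L2_def power2_sum mult.assoc)
qed

lemma L2_diff: "f \<in> L2 N \<Longrightarrow> g \<in> L2 N \<Longrightarrow> (\<lambda>x. f x - g x) \<in> L2 N"
  using L2_add[of f N "\<lambda>x. - 1 * g x"] L2_cmult[of g N "-1"] by simp

lemma L2_sum: "(\<And>i. i \<in> I \<Longrightarrow> f i \<in> L2 N) \<Longrightarrow> (\<lambda>x. \<Sum>i\<in>I. f i x) \<in> L2 N"
proof (induction I rule: infinite_finite_induct)
  case (insert i I)
  then show ?case using L2_add[of "f i" N "\<lambda>x. \<Sum>i\<in>I. f i x"] by simp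
qed (auto simp: L2_def)

lemma L2_inner_self: "L2_inner N f f = (\<integral>x. (f x)\<^sup>2 \<partial>N)"
  by (simp add: L2_inner_def power2_eq_square)

lemma L2_inner_sum_left:
  assumes "\<And>i. i \<in> I \<Longrightarrow> f i \<in> L2 N" "g \<in> L2 N"
  shows "L2_inner N (\<lambda>x. \<Sum>i\<in>I. c i * f i x) g = (\<Sum>i\<in>I. c i * L2_inner N (f i) g)"
proof -
  have "L2_inner N (\<lambda>x. \<Sum>i\<in>I. c i * f i x) g = (\<integral>x. (\<Sum>i\<in>I. c i * (f i x * g x)) \<partial>N)"
    by (simp add: L2_inner_def sum_distrib_right mult.assoc)
  also have "\<dots> = (\<Sum>i\<in>I. c i * L2_inner N (f i) g)"
    using assms by (subst Bochner_Integration.integral_sum) (auto simp: L2_inner_def intro!: L2_integrable_mult)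
  finally show ?thesis .
qed

lemma L2_inner_commute: "L2_inner N f g = L2_inner N g f"
  by (simp add: L2_inner_def mult.commute)

lemma L2_inner_double_sum:
  assumes "\<And>i. i \<in> I \<Longrightarrow> f i \<in> L2 N" "\<And>i. i \<in> J \<Longrightarrow> g i \<in> L2 N"
  shows "L2_inner N (\<lambda>x. \<Sum>i\<in>I. c i * f i x) (\<lambda>x. \<Sum>i\<in>J. d i * g i x)
       = (\<Sum>i\<in>I. \<Sum>j\<in>J. c i * d j * L2_inner N (f i) (g j))"
proof -
  have "L2_inner N (f i) (\<lambda>x. \<Sum>i\<in>J. d i * g i x) = (\<Sum>j\<in>J. d j * L2_inner N (f i) (g j))" if "i \<in> I" for i
    unfolding L2_inner_commute[of N "f i"] using assms that by (intro L2_inner_sum_left) auto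
  then show ?thesis using assms
    by (subst L2_inner_sum_left) (auto intro!: L2_sum L2_cmult sum.cong simp: sum_distrib_left mult.assoc)
qed

lemma L2_norm_lincomb:
  assumes "f \<in> L2 N" "g \<in> L2 N"
  shows "(\<integral>x. (a * f x - b * g x)\<^sup>2 \<partial>N)
       = a\<^sup>2 * L2_inner N f f - 2 * a * b * L2_inner N f g + b\<^sup>2 * L2_inner N g g"
proof -
  have "(\<lambda>x. (a * f x - b * g x)\<^sup>2) = (\<lambda>x. a\<^sup>2 * (f x * f x) - 2 * a * b * (f x * g x) + b\<^sup>2 * (g x * g x))"
    by (simp add: fun_eq_iff power2_eq_square algebra_simps)
  then show ?thesis
    using L2_integrable_mult[OF assms(1) assms(1)] L2_integrable_mult[OF assms] L2_integrable_mult[OF assms(2) assms(2)]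
    by (simp add: L2_inner_def)
qed

lemma L2_Cauchy_Schwarz:
  assumes "f \<in> L2 N" "g \<in> L2 N"
  shows "(L2_inner N f g)\<^sup>2 \<le> L2_inner N f f * L2_inner N g g"
proof (cases "L2_inner N g g = 0")
  case True
  then have "AE x in N. g x = 0"
    using integral_nonneg_eq_0_iff_AE[OF L2_integrable_square[OF assms(2)]] by (simp add: L2_inner_self)
  then have "L2_inner N f g = 0"
    unfolding L2_inner_def by (intro integral_eq_zero_AE) auto
  with True show ?thesis by simp
next
  case False
  have "0 \<le> L2_inner N g g" by (simp add: L2_inner_self)
  with False have pos: "0 < L2_inner N g g" by simp
  let ?c = "L2_inner N g g" and ?b = "L2_inner N f g"
  have "0 \<le> (\<integral>x. (?c * f x - ?b * g x)\<^sup>2 \<partial>N)" by simp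
  also have "\<dots> = ?c * (?c * L2_inner N f f - ?b\<^sup>2)"
    unfolding L2_norm_lincomb[OF assms(1,2)] by (simp add: power2_eq_square algebra_simps)
  finally show ?thesis using pos by (simp add: zero_le_mult_iff mult.commute)
qed

definition tensor :: "nat \<Rightarrow> (nat \<Rightarrow> real \<Rightarrow> real) \<Rightarrow> (nat \<Rightarrow> real) \<Rightarrow> real" where
  "tensor q f \<xi> = (\<Prod>j\<in>{1..q}. f j (\<xi> j))"

lemma tensor_L2:
  assumes "\<And>j. f j \<in> L2 lborel"
  shows "tensor q f \<in> L2 (leb q)"
proof -
  interpret product_sigma_finite "\<lambda>_::nat. lborel :: real measure" ..
  have f: "f j \<in> borel_measurable borel" for j using L2_borel_measurable[OF assms] by simp
  have "tensor q f \<in> borel_measurable (leb q)"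
    unfolding tensor_def
    by (intro borel_measurable_prod measurable_compose[OF measurable_component_singleton]) (use f in auto)
  moreover have "integrable (leb q) (\<lambda>\<xi>. \<Prod>j\<in>{1..q}. (f j (\<xi> j))\<^sup>2)"
    using L2_integrable_square[OF assms] by (intro product_integrable_prod) auto
  ultimately show ?thesis by (simp add: L2_def tensor_def prod_power_distrib)
qed

lemma L2_inner_tensor:
  assumes "\<And>j. f j \<in> L2 lborel" "\<And>j. g j \<in> L2 lborel"
  shows "L2_inner (leb q) (tensor q f) (tensor q g) = (\<Prod>j\<in>{1..q}. L2_inner lborel (f j) (g j))"
proof -
  interpret product_sigma_finite "\<lambda>_::nat. lborel :: real measure" ..
  have "(\<integral>\<xi>. (\<Prod>j\<in>{1..q}. f j (\<xi> j) * g j (\<xi> j)) \<partial>leb q) = (\<Prod>j\<in>{1..q}. L2_inner lborel (f j) (g j))"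
    using L2_integrable_mult[OF assms] unfolding L2_inner_def by (intro product_integral_prod) auto
  then show ?thesis by (simp add: L2_inner_def tensor_def prod.distrib)
qed

lemma prod_if_le:
  assumes "j \<le> q"
  shows "(\<Prod>r\<in>{1..q}. if r \<le> j then a r else b r) = (\<Prod>r\<in>{1..j}. a r) * (\<Prod>r\<in>{Suc j..q}. b r :: real)"
proof -
  have "{1..q} = {1..j} \<union> {Suc j..q}" using assms by auto
  then have split: "(\<Prod>r\<in>{1..q}. if r \<le> j then a r else b r)
      = (\<Prod>r\<in>{1..j}. if r \<le> j then a r else b r) * (\<Prod>r\<in>{Suc j..q}. if r \<le> j then a r else b r)"
    by (simp add: prod.union_disjoint)
  note split
  also have "(\<Prod>r\<in>{1..j}. if r \<le> j then a r else b r) = (\<Prod>r\<in>{1..j}. a r)"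
    by (rule prod.cong) auto
  also have "(\<Prod>r\<in>{Suc j..q}. if r \<le> j then a r else b r) = (\<Prod>r\<in>{Suc j..q}. b r)"
    by (rule prod.cong) auto
  finally show ?thesis .
qed

lemma step_integral_L2: "step_integral B h W \<Longrightarrow> h \<in> L2 lborel"
proof -
  assume "step_integral B h W"
  then obtain m c u v where uv: "\<And>k. k < (m::nat) \<Longrightarrow> u k \<le> v k" and h: "h = (\<lambda>x. \<Sum>k<m. c k * indicator {u k<..v k} x)"
    by (auto simp: step_integral_def)
  have "(\<lambda>x. indicator {u k<..v k} x) \<in> L2 lborel" if "k < m" for k
    using uv[OF that] by (auto simp: L2_def integrable_indicator_iff simp flip: indicator_inter_arith simp: power2_eq_square)
  then show ?thesis unfolding h by (intro L2_sum L2_cmult) auto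
qed

text \<open>
  \<open>chaos_kernel\<close> is a finite combination \<open>F\<close> of tensor powers, and \<open>q! * chaos_coefficient q e 0\<close> is its
  multiple integral when the \<open>W i\<close> are the Wiener integrals of the \<open>h i\<close>.  In general
  \<open>chaos_coefficient q e j\<close> is, up to a factorial, the integral of order \<open>q - j\<close> of the contraction of
  \<open>F\<close> with \<open>e\<close> in \<open>j\<close> variables.  The index type is arbitrary so that two combinations can be
  subtracted by using the disjoint sum of their index sets.
\<close>
definition chaos_kernel :: "nat \<Rightarrow> 'i set \<Rightarrow> ('i \<Rightarrow> real) \<Rightarrow> ('i \<Rightarrow> real \<Rightarrow> real) \<Rightarrow> (nat \<Rightarrow> real) \<Rightarrow> real" where
  "chaos_kernel q I c h \<xi> = (\<Sum>i\<in>I. c i * tensor q (\<lambda>_. h i) \<xi>)"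

definition chaos_coefficient :: "nat \<Rightarrow> (real \<Rightarrow> real) \<Rightarrow> nat \<Rightarrow> 'i set \<Rightarrow> ('i \<Rightarrow> real) \<Rightarrow> ('i \<Rightarrow> real \<Rightarrow> real)
    \<Rightarrow> ('i \<Rightarrow> 'a \<Rightarrow> real) \<Rightarrow> 'a \<Rightarrow> real" where
  "chaos_coefficient q e j I c h W \<omega> =
     (\<Sum>i\<in>I. c i * L2_inner lborel (h i) e ^ j * scaled_hermite (q - j) (W i \<omega>) (L2_inner lborel (h i) (h i)))"

context brownian
begin

text \<open>
  Contraction is continuous, even modulo kernels \<open>L\<close> that \<open>e\<close> does not see.  Let \<open>S\<close> be the
  tensor product of \<open>j\<close> copies of \<open>e\<close> with the contraction of \<open>F\<close>, and let \<open>Q\<close> be the squared norm of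
  that contraction.  Then \<open>\<langle>F, S\<rangle> = Q\<close>, \<open>\<langle>L, S\<rangle> = 0\<close> and \<open>\<parallel>S\<parallel>\<^sup>2 = \<parallel>e\<parallel>\<^sup>2\<^sup>j Q\<close>, so that
  \<open>\<parallel> \<parallel>e\<parallel>\<^sup>2\<^sup>j (F - L) - S \<parallel>\<^sup>2 \<ge> 0\<close> bounds \<open>Q\<close>.  By the isometry \<open>Q\<close> dominates the left-hand side.  The
  cases that matter are \<open>L = 0\<close>, which gives convergence of the coefficients, and a kernel \<open>L\<close>
  that vanishes on the support of \<open>e\<close>, which makes the coefficients with \<open>j \<ge> 1\<close> tend to \<open>0\<close>.
\<close>
lemma chaos_coefficient_bound:
  fixes I :: "'i set"
  assumes step: "\<And>i. i \<in> I \<Longrightarrow> step_integral B (h i) (W i)"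
    and e: "e \<in> L2 lborel" "0 < L2_inner lborel e e" and j: "j \<le> q"
    and L: "L \<in> L2 (leb q)" "\<And>\<xi>. L \<xi> * (\<Prod>r\<in>{1..j}. e (\<xi> r)) = 0"
  shows "integrable M (\<lambda>\<omega>. (chaos_coefficient q e j I c h W \<omega>)\<^sup>2)"
    and "(\<integral>\<omega>. (chaos_coefficient q e j I c h W \<omega>)\<^sup>2 \<partial>M)
       \<le> L2_inner lborel e e ^ j * (\<integral>\<xi>. (chaos_kernel q I c h \<xi> - L \<xi>)\<^sup>2 \<partial>leb q)"
proof -
  let ?ip = "L2_inner lborel"
  define a where "a = (\<lambda>i. c i * ?ip (h i) e ^ j)"
  define X where "X = (\<lambda>i \<omega>. scaled_hermite (q - j) (W i \<omega>) (?ip (h i) (h i)))"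
  define Q where "Q = (\<Sum>i\<in>I. \<Sum>i'\<in>I. a i * a i' * ?ip (h i) (h i') ^ (q - j))"
  define \<kappa> where "\<kappa> = ?ip e e ^ j"
  define F where "F = (\<lambda>\<xi>. \<Sum>i\<in>I. c i * tensor q (\<lambda>_. h i) \<xi>)"
  define T where "T = (\<lambda>i. tensor q (\<lambda>r. if r \<le> j then e else h i))"
  define S where "S = (\<lambda>\<xi>. \<Sum>i\<in>I. a i * T i \<xi>)"
  define G where "G = (\<lambda>\<xi>. F \<xi> - L \<xi>)"
  have h: "h i \<in> L2 lborel" if "i \<in> I" for i using step_integral_L2[OF step[OF that]] .
  have T: "T i \<in> L2 (leb q)" and h_tensor: "tensor q (\<lambda>_. h i) \<in> L2 (leb q)" if "i \<in> I" for i
    unfolding T_def by (rule tensor_L2; use h[OF that] e in simp)+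
  have F: "F \<in> L2 (leb q)" and S: "S \<in> L2 (leb q)"
    unfolding F_def S_def using h_tensor T by (auto intro!: L2_sum L2_cmult)
  have G: "G \<in> L2 (leb q)" unfolding G_def by (rule L2_diff[OF F L(1)])
  have X_meas: "X i \<in> borel_measurable M" if "i \<in> I" for i
    unfolding X_def using step_integral_measurable[OF step[OF that]] by measurable
  have iso: "integrable M (\<lambda>\<omega>. X i \<omega> * X i' \<omega>)" "(\<integral>\<omega>. X i \<omega> * X i' \<omega> \<partial>M) = ?ip (h i) (h i') ^ (q - j) / fact (q - j)"
    if "i \<in> I" "i' \<in> I" for i i'
    unfolding X_def using step_integral_isometry[OF step[OF that(1)] step[OF that(2)], of "q - j" "q - j"] by auto
  have X: "X i \<in> L2 M" if "i \<in> I" for i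
    using X_meas[OF that] iso(1)[OF that that] by (simp add: L2_def power2_eq_square)
  have "(\<lambda>\<omega>. \<Sum>i\<in>I. a i * X i \<omega>) \<in> L2 M" by (intro L2_sum L2_cmult X)
  then show "integrable M (\<lambda>\<omega>. (chaos_coefficient q e j I c h W \<omega>)\<^sup>2)"
    unfolding a_def X_def chaos_coefficient_def by (rule L2_integrable_square)
  have "(\<integral>\<omega>. (\<Sum>i\<in>I. a i * X i \<omega>)\<^sup>2 \<partial>M) = (\<Sum>i\<in>I. \<Sum>i'\<in>I. a i * a i' * L2_inner M (X i) (X i'))"
    unfolding L2_inner_self[symmetric] by (rule L2_inner_double_sum[OF X X])
  also have "\<dots> = Q / fact (q - j)"
    unfolding Q_def sum_divide_distrib using iso(2) by (intro sum.cong refl) (simp add: L2_inner_def)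
  finally have norm: "(\<integral>\<omega>. (\<Sum>i\<in>I. a i * X i \<omega>)\<^sup>2 \<partial>M) = Q / fact (q - j)" .
  have "0 \<le> Q / fact (q - j)" unfolding norm[symmetric] by simp
  then have "Q / fact (q - j) \<le> Q" using fact_ge_1[where 'a = real, of "q - j"] by (simp add: divide_le_eq zero_le_divide_iff mult_le_cancel_left1)
  have FS: "L2_inner (leb q) F S = Q"
  proof -
    have "L2_inner (leb q) (tensor q (\<lambda>_. h i)) (T i') = ?ip (h i) e ^ j * ?ip (h i) (h i') ^ (q - j)" if "i \<in> I" "i' \<in> I" for i i'
    proof -
      have "L2_inner (leb q) (tensor q (\<lambda>_. h i)) (T i') = (\<Prod>r\<in>{1..q}. if r \<le> j then ?ip (h i) e else ?ip (h i) (h i'))"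
        unfolding T_def using h that e by (subst L2_inner_tensor) (auto intro!: prod.cong)
      then show ?thesis unfolding prod_if_le[OF j] by simp
    qed
    then show ?thesis
      unfolding F_def S_def Q_def using h_tensor T
      by (subst L2_inner_double_sum) (auto intro!: sum.cong simp: a_def)
  qed
  have SS: "L2_inner (leb q) S S = \<kappa> * Q"
  proof -
    have "L2_inner (leb q) (T i) (T i') = \<kappa> * ?ip (h i) (h i') ^ (q - j)" if "i \<in> I" "i' \<in> I" for i i'
    proof -
      have "L2_inner (leb q) (T i) (T i') = (\<Prod>r\<in>{1..q}. if r \<le> j then ?ip e e else ?ip (h i) (h i'))"
        unfolding T_def using h that e by (subst L2_inner_tensor) (auto intro!: prod.cong)
      then show ?thesis unfolding prod_if_le[OF j] \<kappa>_def by simp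
    qed
    then show ?thesis
      unfolding S_def Q_def sum_distrib_left using T
      by (subst L2_inner_double_sum) (auto intro!: sum.cong)
  qed
  have "L \<xi> * S \<xi> = 0" for \<xi>
  proof -
    have "T i \<xi> = (\<Prod>r\<in>{1..j}. e (\<xi> r)) * (\<Prod>r\<in>{Suc j..q}. h i (\<xi> r))" for i
      unfolding T_def tensor_def prod_if_le[OF j, symmetric] by (intro prod.cong) auto
    then have "L \<xi> * S \<xi> = (L \<xi> * (\<Prod>r\<in>{1..j}. e (\<xi> r))) * (\<Sum>i\<in>I. a i * (\<Prod>r\<in>{Suc j..q}. h i (\<xi> r)))"
      unfolding S_def by (simp add: sum_distrib_left mult_ac)
    then show ?thesis unfolding L(2) by simp
  qed
  then have LS: "L2_inner (leb q) L S = 0" unfolding L2_inner_def by (simp only: Bochner_Integration.integral_zero)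
  have GS: "L2_inner (leb q) G S = Q"
    using FS LS L2_integrable_mult[OF F S] L2_integrable_mult[OF L(1) S]
    by (simp add: G_def L2_inner_def left_diff_distrib)
  \<comment> \<open>With these weights the cross term is \<open>-2 \<kappa> Q\<close> and the norm of \<open>S\<close> contributes \<open>\<kappa> Q\<close>.\<close>
  have "0 \<le> (\<integral>\<xi>. (\<kappa> * G \<xi> - 1 * S \<xi>)\<^sup>2 \<partial>leb q)" by simp
  also have "\<dots> = \<kappa> * (\<kappa> * L2_inner (leb q) G G - Q)"
    unfolding L2_norm_lincomb[OF G S] GS SS by (simp add: power2_eq_square algebra_simps)
  finally have "0 \<le> \<kappa> * (\<kappa> * L2_inner (leb q) G G - Q)" .
  moreover have "0 < \<kappa>" unfolding \<kappa>_def using e(2) by (rule zero_less_power)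
  ultimately have "Q \<le> \<kappa> * L2_inner (leb q) G G"
    using zero_le_mult_iff[of \<kappa> "\<kappa> * L2_inner (leb q) G G - Q"] by linarith
  with \<open>Q / fact (q - j) \<le> Q\<close>
  show "(\<integral>\<omega>. (chaos_coefficient q e j I c h W \<omega>)\<^sup>2 \<partial>M)
       \<le> ?ip e e ^ j * (\<integral>\<xi>. (chaos_kernel q I c h \<xi> - L \<xi>)\<^sup>2 \<partial>leb q)"
    using norm unfolding L2_inner_self a_def X_def \<kappa>_def G_def F_def chaos_coefficient_def chaos_kernel_def by simp
qed

end

section \<open>Approximation by polynomials in finitely many increments\<close>

lemma LIMSEQ_zero_squeeze:
  fixes a b :: "nat \<Rightarrow> real"
  assumes "b \<longlonglongrightarrow> 0" "\<And>n. a n \<le> b n" "\<And>n. 0 \<le> a n"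
  shows "a \<longlonglongrightarrow> 0"
  by (rule tendsto_sandwich[OF _ _ tendsto_const assms(1)]) (simp_all add: assms)

lemma L2_tendsto_AE_subseq:
  assumes "L2_tendsto N F f"
  obtains r :: "nat \<Rightarrow> nat" where "strict_mono r" "AE x in N. (\<lambda>n. F (r n) x) \<longlonglongrightarrow> f x"
proof -
  have F: "F n \<in> L2 N" "f \<in> L2 N" "(\<lambda>n. \<integral>x. (F n x - f x)\<^sup>2 \<partial>N) \<longlonglongrightarrow> 0" for n
    using assms by (auto simp: L2_tendsto_def)
  obtain r where r: "strict_mono r" "AE x in N. (\<lambda>n. (F (r n) x - f x)\<^sup>2) \<longlonglongrightarrow> 0"
    using tendsto_L1_AE_subseq[of N "\<lambda>n x. (F n x - f x)\<^sup>2"] L2_integrable_square[OF L2_diff[OF F(1,2)]] F(3)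
    unfolding real_norm_def abs_power2 by blast
  show ?thesis
  proof (rule that[OF r(1)])
    show "AE x in N. (\<lambda>n. F (r n) x) \<longlonglongrightarrow> f x"
      using r(2)
    proof eventually_elim
      case (elim x)
      then have "(\<lambda>n. sqrt ((F (r n) x - f x)\<^sup>2)) \<longlonglongrightarrow> sqrt 0" by (intro tendsto_real_sqrt)
      then show ?case by (simp add: tendsto_rabs_zero_iff LIM_zero_iff)
    qed
  qed
qed

lemma L2_tendsto_subseq: "L2_tendsto N F f \<Longrightarrow> strict_mono r \<Longrightarrow> L2_tendsto N (\<lambda>n. F (r n)) f"
  using LIMSEQ_subseq_LIMSEQ[of "\<lambda>n. \<integral>x. (F n x - f x)\<^sup>2 \<partial>N" 0 r]
  by (auto simp: L2_tendsto_def comp_def)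

lemma L2_norm_add_le:
  assumes "f \<in> L2 N" "g \<in> L2 N"
  shows "(\<integral>x. (f x + g x)\<^sup>2 \<partial>N) \<le> 2 * (\<integral>x. (f x)\<^sup>2 \<partial>N) + 2 * (\<integral>x. (g x)\<^sup>2 \<partial>N)"
proof -
  have "(\<integral>x. (f x + g x)\<^sup>2 \<partial>N) \<le> (\<integral>x. 2 * (f x)\<^sup>2 + 2 * (g x)\<^sup>2 \<partial>N)"
  proof (rule integral_mono)
    show "integrable N (\<lambda>x. (f x + g x)\<^sup>2)" using L2_integrable_square[OF L2_add[OF assms]] .
    show "integrable N (\<lambda>x. 2 * (f x)\<^sup>2 + 2 * (g x)\<^sup>2)" using assms by (auto simp: L2_def)
    have "(a + b)\<^sup>2 \<le> 2 * a\<^sup>2 + 2 * b\<^sup>2" for a b :: real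
      using zero_le_power2[of "a - b"] by (simp add: power2_eq_square algebra_simps)
    then show "(f x + g x)\<^sup>2 \<le> 2 * (f x)\<^sup>2 + 2 * (g x)\<^sup>2" for x .
  qed
  also have "\<dots> = 2 * (\<integral>x. (f x)\<^sup>2 \<partial>N) + 2 * (\<integral>x. (g x)\<^sup>2 \<partial>N)"
    using assms by (simp add: L2_def)
  finally show ?thesis .
qed

lemma L2_norm_triangle_le:
  assumes "f \<in> L2 N" "g \<in> L2 N" "h \<in> L2 N"
  shows "(\<integral>x. (f x - h x)\<^sup>2 \<partial>N) \<le> 2 * (\<integral>x. (f x - g x)\<^sup>2 \<partial>N) + 2 * (\<integral>x. (g x - h x)\<^sup>2 \<partial>N)"
  using L2_norm_add_le[OF L2_diff[OF assms(1,2)] L2_diff[OF assms(2,3)]] by simp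

lemma L2_tendsto_sum:
  assumes "\<And>i. i \<in> I \<Longrightarrow> L2_tendsto N (F i) (f i)"
  shows "L2_tendsto N (\<lambda>n x. \<Sum>i\<in>I. c i * F i n x) (\<lambda>x. \<Sum>i\<in>I. c i * f i x)"
  using assms
proof (induction I rule: infinite_finite_induct)
  case (insert i I)
  let ?F = "\<lambda>n x. \<Sum>i\<in>I. c i * F i n x" and ?f = "\<lambda>x. \<Sum>i\<in>I. c i * f i x"
  have IH: "L2_tendsto N ?F ?f" using insert by simp
  have Fi: "L2_tendsto N (F i) (f i)" using insert.prems by simp
  have mem: "?F n \<in> L2 N" "?f \<in> L2 N" "F i n \<in> L2 N" "f i \<in> L2 N" for n
    using IH Fi unfolding L2_tendsto_def by blast+
  have lim: "(\<lambda>n. \<integral>x. (F i n x - f i x)\<^sup>2 \<partial>N) \<longlonglongrightarrow> 0" "(\<lambda>n. \<integral>x. (?F n x - ?f x)\<^sup>2 \<partial>N) \<longlonglongrightarrow> 0"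
    using IH Fi unfolding L2_tendsto_def by blast+
  let ?r = "\<lambda>n. 2 * ((c i)\<^sup>2 * (\<integral>x. (F i n x - f i x)\<^sup>2 \<partial>N)) + 2 * (\<integral>x. (?F n x - ?f x)\<^sup>2 \<partial>N)"
  have "?r \<longlonglongrightarrow> 2 * ((c i)\<^sup>2 * 0) + 2 * 0"
    by (intro tendsto_intros lim)
  then have "?r \<longlonglongrightarrow> 0" by simp
  moreover have "(\<integral>x. ((c i * F i n x + ?F n x) - (c i * f i x + ?f x))\<^sup>2 \<partial>N) \<le> ?r n" for n
  proof -
    have "(\<integral>x. ((c i * F i n x + ?F n x) - (c i * f i x + ?f x))\<^sup>2 \<partial>N)
        = (\<integral>x. (c i * (F i n x - f i x) + (?F n x - ?f x))\<^sup>2 \<partial>N)"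
      by (simp add: algebra_simps)
    also have "\<dots> \<le> 2 * (\<integral>x. (c i * (F i n x - f i x))\<^sup>2 \<partial>N) + 2 * (\<integral>x. (?F n x - ?f x)\<^sup>2 \<partial>N)"
      using mem by (intro L2_norm_add_le L2_cmult L2_diff)
    finally show ?thesis by (simp add: power_mult_distrib)
  qed
  ultimately have "(\<lambda>n. \<integral>x. ((c i * F i n x + ?F n x) - (c i * f i x + ?f x))\<^sup>2 \<partial>N) \<longlonglongrightarrow> 0"
    by (rule LIMSEQ_zero_squeeze[where b = ?r]) simp_all
  moreover have "(\<lambda>x. c i * F i n x + ?F n x) \<in> L2 N" "(\<lambda>x. c i * f i x + ?f x) \<in> L2 N" for n
    by (intro L2_add L2_cmult mem)+
  ultimately show ?case
    using insert.hyps by (simp add: L2_tendsto_def)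
qed (auto simp: L2_tendsto_def L2_def)

lemma L2_inner_tendsto:
  assumes "L2_tendsto N F f" "g \<in> L2 N"
  shows "(\<lambda>n. L2_inner N (F n) g) \<longlonglongrightarrow> L2_inner N f g"
proof -
  have F: "F n \<in> L2 N" "f \<in> L2 N" and lim: "(\<lambda>n. \<integral>x. (F n x - f x)\<^sup>2 \<partial>N) \<longlonglongrightarrow> 0" for n
    using assms unfolding L2_tendsto_def by blast+
  have eq: "L2_inner N (F n) g - L2_inner N f g = L2_inner N (\<lambda>x. F n x - f x) g" for n
    using L2_integrable_mult[OF F(1) assms(2)] L2_integrable_mult[OF F(2) assms(2)]
    by (simp add: L2_inner_def left_diff_distrib)
  have "(\<lambda>n. (\<integral>x. (F n x - f x)\<^sup>2 \<partial>N) * L2_inner N g g) \<longlonglongrightarrow> 0"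
    by (rule tendsto_mult_left_zero[OF lim])
  moreover have "(L2_inner N (F n) g - L2_inner N f g)\<^sup>2 \<le> (\<integral>x. (F n x - f x)\<^sup>2 \<partial>N) * L2_inner N g g" for n
    unfolding eq L2_inner_self[of N "\<lambda>x. F n x - f x", symmetric] by (intro L2_Cauchy_Schwarz L2_diff F assms)
  ultimately have "(\<lambda>n. (L2_inner N (F n) g - L2_inner N f g)\<^sup>2) \<longlonglongrightarrow> 0"
    by (rule LIMSEQ_zero_squeeze[where b = "\<lambda>n. (\<integral>x. (F n x - f x)\<^sup>2 \<partial>N) * L2_inner N g g"]) simp_all
  then have "(\<lambda>n. sqrt ((L2_inner N (F n) g - L2_inner N f g)\<^sup>2)) \<longlonglongrightarrow> sqrt 0" by (intro tendsto_real_sqrt)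
  then show ?thesis by (simp add: tendsto_rabs_zero_iff LIM_zero_iff)
qed

lemma L2_norm_tendsto:
  assumes "L2_tendsto N F f"
  shows "(\<lambda>n. L2_inner N (F n) (F n)) \<longlonglongrightarrow> L2_inner N f f"
proof -
  have F: "F n \<in> L2 N" "f \<in> L2 N" and lim: "(\<lambda>n. \<integral>x. (F n x - f x)\<^sup>2 \<partial>N) \<longlonglongrightarrow> 0" for n
    using assms unfolding L2_tendsto_def by blast+
  have "L2_inner N (F n) (F n) = (\<integral>x. (F n x - f x)\<^sup>2 \<partial>N) + 2 * L2_inner N (F n) f - L2_inner N f f" for n
    using L2_norm_lincomb[OF F, of 1 n 1] by simp
  moreover have "(\<lambda>n. (\<integral>x. (F n x - f x)\<^sup>2 \<partial>N) + 2 * L2_inner N (F n) f - L2_inner N f f)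
      \<longlonglongrightarrow> 0 + 2 * L2_inner N f f - L2_inner N f f"
    by (intro tendsto_intros L2_inner_tendsto lim assms F)
  ultimately show ?thesis by simp
qed

lemma L2_tendsto_tensor_power:
  assumes "L2_tendsto lborel g h"
  shows "L2_tendsto (leb q) (\<lambda>n. tensor q (\<lambda>_. g n)) (tensor q (\<lambda>_. h))"
proof -
  have g: "g n \<in> L2 lborel" "h \<in> L2 lborel" for n using assms by (auto simp: L2_tendsto_def)
  have T: "tensor q (\<lambda>_. g n) \<in> L2 (leb q)" "tensor q (\<lambda>_. h) \<in> L2 (leb q)" for n
    by (intro tensor_L2 g)+
  have "(\<integral>\<xi>. (tensor q (\<lambda>_. g n) \<xi> - tensor q (\<lambda>_. h) \<xi>)\<^sup>2 \<partial>leb q)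
      = L2_inner lborel (g n) (g n) ^ q - 2 * L2_inner lborel (g n) h ^ q + L2_inner lborel h h ^ q" for n
    using L2_norm_lincomb[OF T, of 1 n 1]
    unfolding L2_inner_tensor[OF g(1) g(1)] L2_inner_tensor[OF g(1) g(2)] L2_inner_tensor[OF g(2) g(2)] by simp
  moreover have "(\<lambda>n. L2_inner lborel (g n) (g n) ^ q - 2 * L2_inner lborel (g n) h ^ q + L2_inner lborel h h ^ q)
      \<longlonglongrightarrow> L2_inner lborel h h ^ q - 2 * L2_inner lborel h h ^ q + L2_inner lborel h h ^ q"
    by (intro tendsto_intros L2_norm_tendsto[OF assms] L2_inner_tendsto[OF assms g(2)])
  ultimately show ?thesis using T by (simp add: L2_tendsto_def)
qed

text \<open>
  The expectation of \<open>min 1 \<bar>Y - X\<bar>\<close> metrises convergence in probability, the mode in which the random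
  variables are approximated below; \<open>L\<^sup>2\<close> bounds enter through the kernels and the isometry.
\<close>
lemma (in prob_space) tendsto_min_1_of_AE:
  assumes "\<And>n. Y n \<in> borel_measurable M" "X \<in> borel_measurable M" "AE \<omega> in M. (\<lambda>n. Y n \<omega>) \<longlonglongrightarrow> (X \<omega> :: real)"
  shows "(\<lambda>n. \<integral>\<omega>. min 1 \<bar>Y n \<omega> - X \<omega>\<bar> \<partial>M) \<longlonglongrightarrow> 0"
proof -
  have "(\<lambda>n. \<integral>\<omega>. min 1 \<bar>Y n \<omega> - X \<omega>\<bar> \<partial>M) \<longlonglongrightarrow> (\<integral>\<omega>. 0 \<partial>M)"
  proof (rule integral_dominated_convergence[where w = "\<lambda>_. 1"])
    show "AE \<omega> in M. (\<lambda>n. min 1 \<bar>Y n \<omega> - X \<omega>\<bar>) \<longlonglongrightarrow> 0"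
      using assms(3)
    proof eventually_elim
      case (elim \<omega>)
      then have "(\<lambda>n. min 1 \<bar>Y n \<omega> - X \<omega>\<bar>) \<longlonglongrightarrow> min 1 \<bar>X \<omega> - X \<omega>\<bar>" by (intro tendsto_intros)
      then show ?case by simp
    qed
  qed (use assms in auto)
  then show ?thesis by simp
qed

text \<open>
  The sum of the absolute values has finite expectation.  For \<open>L\<^sup>1\<close> norms that decay geometrically this
  gives almost sure convergence along the whole sequence, which avoids a separate subsequence for every
  coefficient of the polynomials considered below.
\<close>
lemma AE_summable_of_summable_integrals:
  fixes f :: "nat \<Rightarrow> 'a \<Rightarrow> real"
  assumes int: "\<And>k. integrable M (f k)" and le: "\<And>k. (\<integral>\<omega>. \<bar>f k \<omega>\<bar> \<partial>M) \<le> b k" and "summable b"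
  shows "AE \<omega> in M. summable (\<lambda>k. \<bar>f k \<omega>\<bar>)"
proof -
  have b: "0 \<le> b k" for k
    by (rule order_trans[OF Bochner_Integration.integral_nonneg le]) simp
  have meas: "f k \<in> borel_measurable M" for k using int by auto
  have "(\<integral>\<^sup>+\<omega>. (\<Sum>k. ennreal \<bar>f k \<omega>\<bar>) \<partial>M) = (\<Sum>k. \<integral>\<^sup>+\<omega>. ennreal \<bar>f k \<omega>\<bar> \<partial>M)"
    using meas by (intro nn_integral_suminf) auto
  also have "\<dots> \<le> (\<Sum>k. ennreal (b k))"
    using le int by (intro suminf_le) (auto simp: nn_integral_eq_integral ennreal_leI)
  also have "\<dots> < \<infinity>" using b \<open>summable b\<close> by (simp add: suminf_ennreal_eq[OF _ summable_sums])
  finally have "(\<integral>\<^sup>+\<omega>. (\<Sum>k. ennreal \<bar>f k \<omega>\<bar>) \<partial>M) \<noteq> \<infinity>" by simp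
  then have "AE \<omega> in M. (\<Sum>k. ennreal \<bar>f k \<omega>\<bar>) \<noteq> \<infinity>"
    using meas by (intro nn_integral_PInf_AE) auto
  then show ?thesis
    by eventually_elim (auto intro!: summable_suminf_not_top)
qed

context brownian
begin

lemma wiener_integral_approximation:
  assumes "wiener_integral M B h W"
  obtains g V where "\<And>n::nat. step_integral B (g n) (V n)" "L2_tendsto lborel g h"
    "AE \<omega> in M. (\<lambda>n. V n \<omega>) \<longlonglongrightarrow> W \<omega>"
proof -
  obtain F Y where FY: "\<And>n. step_integral B (F n) (Y n)" "L2_tendsto lborel F h" "L2_tendsto M Y W"
    using assms by (auto simp: wiener_integral_def L2_extension_def)
  obtain r :: "nat \<Rightarrow> nat" where r: "strict_mono r" "AE \<omega> in M. (\<lambda>n. Y (r n) \<omega>) \<longlonglongrightarrow> W \<omega>"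
    using L2_tendsto_AE_subseq[OF FY(3)] .
  show ?thesis
    by (rule that[of "\<lambda>n. F (r n)" "\<lambda>n. Y (r n)"]) (use FY r in \<open>auto intro: L2_tendsto_subseq\<close>)
qed

lemma chaos_coefficient_measurable:
  assumes "\<And>i. i \<in> I \<Longrightarrow> step_integral B (h i) (W i)"
  shows "chaos_coefficient q e j I c h W \<in> borel_measurable M"
  unfolding chaos_coefficient_def[abs_def]
  using step_integral_measurable[OF assms] by (intro borel_measurable_sum) measurable

lemma chaos_kernel_L2:
  assumes "\<And>i. i \<in> I \<Longrightarrow> step_integral B (h i) (W i)"
  shows "chaos_kernel q I c h \<in> L2 (leb q)"
  unfolding chaos_kernel_def[abs_def]
  by (intro L2_sum L2_cmult tensor_L2 step_integral_L2[OF assms])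

text \<open>
  Replace every Wiener integral by a step integral.  The norms of the step functions only tend to
  \<open>1\<close>, which is taken up by the variance parameter of the Hermite polynomials.  The contraction in
  \<open>0\<close> variables has the factor \<open>\<langle>h, e\<rangle>\<^sup>0 = 1\<close>, so \<open>e = 0\<close> gives the multiple integral itself.
\<close>
lemma elementary_integral_approximation:
  assumes "elementary_multiple_integral M B q f X" "0 < \<epsilon>" "X \<in> borel_measurable M"
  shows "\<exists>m c h W. (\<forall>k<m. step_integral B (h k) (W k))
      \<and> (\<integral>\<xi>. (chaos_kernel q {..<m} c h \<xi> - f \<xi>)\<^sup>2 \<partial>leb q) < \<epsilon>
      \<and> (\<integral>\<omega>. min 1 \<bar>fact q * chaos_coefficient q (\<lambda>_. 0) 0 {..<m::nat} c h W \<omega> - X \<omega>\<bar> \<partial>M) < \<epsilon>"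
proof -
  obtain m c h W where W: "\<And>k. k < (m::nat) \<Longrightarrow> wiener_integral M B (h k) (W k)"
    and norm: "\<And>k. k < m \<Longrightarrow> L2_inner lborel (h k) (h k) = 1"
    and f: "f = (\<lambda>\<xi>. \<Sum>k<m. c k * tensor q (\<lambda>_. h k) \<xi>)"
    and X: "X = (\<lambda>\<omega>. \<Sum>k<m. c k * hermite_poly q (W k \<omega>))"
    using assms(1) unfolding elementary_multiple_integral_def tensor_def L2_inner_self by blast
  define approx where "approx = (\<lambda>k gV. (\<forall>n::nat. step_integral B (fst gV n) (snd gV n))
      \<and> L2_tendsto lborel (fst gV) (h k) \<and> (AE \<omega> in M. (\<lambda>n. snd gV n \<omega>) \<longlonglongrightarrow> W k \<omega>))"
  have "\<exists>gV. k < m \<longrightarrow> approx k gV" for k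
  proof (cases "k < m")
    case True
    show ?thesis
    proof (rule wiener_integral_approximation[OF W[OF True]])
      fix g V assume "\<And>n::nat. step_integral B (g n) (V n)"
        "L2_tendsto lborel g (h k)" "AE \<omega> in M. (\<lambda>n. V n \<omega>) \<longlonglongrightarrow> W k \<omega>"
      then have "approx k (g, V)" by (simp add: approx_def)
      then show "\<exists>gV. k < m \<longrightarrow> approx k gV" by blast
    qed
  qed simp
  then obtain gV where gV: "\<And>k. k < m \<Longrightarrow> approx k (gV k)" by metis
  define g V where "g = (\<lambda>k. fst (gV k))" and "V = (\<lambda>k. snd (gV k))"
  have step: "\<And>k n. k < m \<Longrightarrow> step_integral B (g k n) (V k n)"
    and g: "\<And>k. k < m \<Longrightarrow> L2_tendsto lborel (g k) (h k)"
    and V: "\<And>k. k < m \<Longrightarrow> AE \<omega> in M. (\<lambda>n. V k n \<omega>) \<longlonglongrightarrow> W k \<omega>"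
    using gV by (simp_all add: g_def V_def approx_def)
  have "L2_tendsto (leb q) (\<lambda>n. chaos_kernel q {..<m} c (\<lambda>k. g k n)) f"
    unfolding chaos_kernel_def[abs_def] f using g by (intro L2_tendsto_sum L2_tendsto_tensor_power) auto
  then have "(\<lambda>n. \<integral>\<xi>. (chaos_kernel q {..<m} c (\<lambda>k. g k n) \<xi> - f \<xi>)\<^sup>2 \<partial>leb q) \<longlonglongrightarrow> 0"
    by (simp add: L2_tendsto_def)
  then have 1: "\<forall>\<^sub>F n in sequentially. (\<integral>\<xi>. (chaos_kernel q {..<m} c (\<lambda>k. g k n) \<xi> - f \<xi>)\<^sup>2 \<partial>leb q) < \<epsilon>"
    using \<open>0 < \<epsilon>\<close> by (rule order_tendstoD)
  let ?U = "\<lambda>n \<omega>. fact q * chaos_coefficient q (\<lambda>_. 0) 0 {..<m} c (\<lambda>k. g k n) (\<lambda>k. V k n) \<omega>"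
  have "AE \<omega> in M. \<forall>k\<in>{..<m}. (\<lambda>n. V k n \<omega>) \<longlonglongrightarrow> W k \<omega>"
    using V by (intro AE_finite_allI) auto
  then have "AE \<omega> in M. (\<lambda>n. ?U n \<omega>) \<longlonglongrightarrow> X \<omega>"
  proof eventually_elim
    case (elim \<omega>)
    have "(\<lambda>n. L2_inner lborel (g k n) (g k n)) \<longlonglongrightarrow> 1" if "k < m" for k
      using L2_norm_tendsto[OF g[OF that]] norm[OF that] by simp
    with elim have "(\<lambda>n. ?U n \<omega>) \<longlonglongrightarrow> fact q * (\<Sum>k<m. c k * 1 * scaled_hermite q (W k \<omega>) 1)"
      unfolding chaos_coefficient_def by (auto intro!: tendsto_intros)
    then show ?case by (simp add: X hermite_poly_eq_scaled sum_distrib_left mult_ac)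
  qed
  moreover have "?U n \<in> borel_measurable M" for n
    using chaos_coefficient_measurable[of "{..<m}" "\<lambda>k. g k n" "\<lambda>k. V k n"] step by auto
  ultimately have "(\<lambda>n. \<integral>\<omega>. min 1 \<bar>?U n \<omega> - X \<omega>\<bar> \<partial>M) \<longlonglongrightarrow> 0"
    using assms(3) by (intro tendsto_min_1_of_AE)
  then have 2: "\<forall>\<^sub>F n in sequentially. (\<integral>\<omega>. min 1 \<bar>?U n \<omega> - X \<omega>\<bar> \<partial>M) < \<epsilon>"
    using \<open>0 < \<epsilon>\<close> by (rule order_tendstoD)
  obtain n where "(\<integral>\<xi>. (chaos_kernel q {..<m} c (\<lambda>k. g k n) \<xi> - f \<xi>)\<^sup>2 \<partial>leb q) < \<epsilon>"
      "(\<integral>\<omega>. min 1 \<bar>?U n \<omega> - X \<omega>\<bar> \<partial>M) < \<epsilon>"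
    using eventually_happens'[OF _ eventually_conj[OF 1 2]] by auto
  then show ?thesis
    using step by (intro exI[of _ m] exI[of _ c] exI[of _ "\<lambda>k. g k n"] exI[of _ "\<lambda>k. V k n"]) simp
qed

text \<open>
  The definition of the integral closes the graph of the elementary integrals in \<open>L\<^sup>2\<close>; passing to an
  almost surely convergent subsequence and then to step integrals, with the triangle inequality,
  gives one approximation for both the kernel and the variable.
\<close>
lemma multiple_integral_approximation:
  assumes "multiple_wiener_integral M B q f X" "0 < \<epsilon>"
  shows "\<exists>m c h W. (\<forall>k<m. step_integral B (h k) (W k))
      \<and> (\<integral>\<xi>. (chaos_kernel q {..<m} c h \<xi> - f \<xi>)\<^sup>2 \<partial>leb q) < \<epsilon>
      \<and> (\<integral>\<omega>. min 1 \<bar>fact q * chaos_coefficient q (\<lambda>_. 0) 0 {..<m::nat} c h W \<omega> - X \<omega>\<bar> \<partial>M) < \<epsilon>"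
proof -
  obtain F Y where FY: "\<And>n. elementary_multiple_integral M B q (F n) (Y n)"
     "L2_tendsto (leb q) F f" "L2_tendsto M Y X"
    using assms by (auto simp: multiple_wiener_integral_def L2_extension_def)
  obtain r :: "nat \<Rightarrow> nat" where r: "strict_mono r" "AE \<omega> in M. (\<lambda>n. Y (r n) \<omega>) \<longlonglongrightarrow> X \<omega>"
    using L2_tendsto_AE_subseq[OF FY(3)] .
  have [measurable]: "Y n \<in> borel_measurable M" "X \<in> borel_measurable M" for n
    using FY(3) by (auto simp: L2_tendsto_def L2_def)
  have mem: "F n \<in> L2 (leb q)" "f \<in> L2 (leb q)" for n using FY(2) by (auto simp: L2_tendsto_def)
  have "\<epsilon> / 4 > 0" using \<open>0 < \<epsilon>\<close> by simp
  have "(\<lambda>n. \<integral>\<omega>. min 1 \<bar>Y (r n) \<omega> - X \<omega>\<bar> \<partial>M) \<longlonglongrightarrow> 0"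
    using r(2) by (intro tendsto_min_1_of_AE) auto
  then have 1: "\<forall>\<^sub>F n in sequentially. (\<integral>\<omega>. min 1 \<bar>Y (r n) \<omega> - X \<omega>\<bar> \<partial>M) < \<epsilon> / 4"
    using \<open>\<epsilon> / 4 > 0\<close> by (rule order_tendstoD)
  have "(\<lambda>n. \<integral>\<xi>. (F (r n) \<xi> - f \<xi>)\<^sup>2 \<partial>leb q) \<longlonglongrightarrow> 0"
    using L2_tendsto_subseq[OF FY(2) r(1)] by (simp add: L2_tendsto_def)
  then have 2: "\<forall>\<^sub>F n in sequentially. (\<integral>\<xi>. (F (r n) \<xi> - f \<xi>)\<^sup>2 \<partial>leb q) < \<epsilon> / 4"
    using \<open>\<epsilon> / 4 > 0\<close> by (rule order_tendstoD)
  obtain n where n: "(\<integral>\<omega>. min 1 \<bar>Y (r n) \<omega> - X \<omega>\<bar> \<partial>M) < \<epsilon> / 4" "(\<integral>\<xi>. (F (r n) \<xi> - f \<xi>)\<^sup>2 \<partial>leb q) < \<epsilon> / 4"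
    using eventually_happens'[OF _ eventually_conj[OF 1 2]] by auto
  obtain m c h W where step: "\<And>k. k < (m::nat) \<Longrightarrow> step_integral B (h k) (W k)"
    and ker: "(\<integral>\<xi>. (chaos_kernel q {..<m} c h \<xi> - F (r n) \<xi>)\<^sup>2 \<partial>leb q) < \<epsilon> / 4"
    and var: "(\<integral>\<omega>. min 1 \<bar>fact q * chaos_coefficient q (\<lambda>_. 0) 0 {..<m} c h W \<omega> - Y (r n) \<omega>\<bar> \<partial>M) < \<epsilon> / 4"
    using elementary_integral_approximation[OF FY(1) \<open>\<epsilon> / 4 > 0\<close>, of "r n"] by auto
  let ?F = "chaos_kernel q {..<m} c h" and ?U = "\<lambda>\<omega>. fact q * chaos_coefficient q (\<lambda>_. 0) 0 {..<m} c h W \<omega>"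
  have F: "?F \<in> L2 (leb q)" using step by (intro chaos_kernel_L2) auto
  have [measurable]: "chaos_coefficient q (\<lambda>_. 0) 0 {..<m} c h W \<in> borel_measurable M"
    using step by (intro chaos_coefficient_measurable) auto
  have "(\<integral>\<xi>. (?F \<xi> - f \<xi>)\<^sup>2 \<partial>leb q) < \<epsilon>"
    using L2_norm_triangle_le[OF F mem(1) mem(2), of "r n"] ker n(2) by linarith
  moreover have "(\<integral>\<omega>. min 1 \<bar>?U \<omega> - X \<omega>\<bar> \<partial>M) \<le> (\<integral>\<omega>. min 1 \<bar>?U \<omega> - Y (r n) \<omega>\<bar> + min 1 \<bar>Y (r n) \<omega> - X \<omega>\<bar> \<partial>M)"
    by (intro integral_mono Bochner_Integration.integrable_add integrable_const_bound[where B = 1]) auto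
  moreover have "\<dots> = (\<integral>\<omega>. min 1 \<bar>?U \<omega> - Y (r n) \<omega>\<bar> \<partial>M) + (\<integral>\<omega>. min 1 \<bar>Y (r n) \<omega> - X \<omega>\<bar> \<partial>M)"
    by (intro Bochner_Integration.integral_add integrable_const_bound[where B = 1]) auto
  ultimately show ?thesis
    using step var n(1) \<open>0 < \<epsilon>\<close>
    by (intro exI[of _ m] exI[of _ c] exI[of _ h] exI[of _ W]) auto
qed

end

section \<open>Multiple integrals along a translated path\<close>

lemma L2_indicator_Ioc: "indicator {u<..v} \<in> L2 lborel" for u v :: real
proof -
  have "integrable lborel (indicator {u<..v} :: real \<Rightarrow> real)"
    by (cases "u \<le> v") (auto simp: integrable_indicator_iff)
  then show ?thesis by (auto simp: L2_def power2_eq_square simp flip: indicator_inter_arith)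
qed

lemma L2_inner_indicator_Ioc:
  assumes "a \<le> b" "u \<le> v"
  shows "L2_inner lborel (indicator {a<..b}) (indicator {u<..v}) = clip u v b - clip u v a"
proof -
  have measure_Ioc: "measure lborel {x<..y} = (if x \<le> y then y - x else 0)" for x y :: real
    by (cases "x \<le> y") auto
  have "{a<..b} \<inter> {u<..v} = {max a u<..min b v}" by auto
  then have "L2_inner lborel (indicator {a<..b}) (indicator {u<..v}) = measure lborel {max a u<..min b v}"
    by (simp add: L2_inner_def flip: indicator_inter_arith)
  also have "\<dots> = (if max a u \<le> min b v then min b v - max a u else 0)"
    by (rule measure_Ioc)
  also have "\<dots> = clip u v b - clip u v a" using assms by (auto simp: clip_def)
  finally show ?thesis .
qed

lemma (in prob_space) expectation_abs_le_sqrt: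
  assumes "X \<in> L2 M"
  shows "integrable M X" "(\<integral>\<omega>. \<bar>X \<omega>\<bar> \<partial>M) \<le> sqrt (\<integral>\<omega>. (X \<omega>)\<^sup>2 \<partial>M)"
proof -
  have 1: "(\<lambda>_. 1) \<in> L2 M" by (simp add: L2_def)
  have X: "(\<lambda>\<omega>. \<bar>X \<omega>\<bar>) \<in> L2 M" using assms by (auto simp: L2_def)
  show "integrable M X" using L2_integrable_mult[OF assms 1] by simp
  have "(\<integral>\<omega>. \<bar>X \<omega>\<bar> \<partial>M)\<^sup>2 \<le> (\<integral>\<omega>. (X \<omega>)\<^sup>2 \<partial>M)"
    using L2_Cauchy_Schwarz[OF X 1] by (simp add: L2_inner_def prob_space power2_eq_square)
  then show "(\<integral>\<omega>. \<bar>X \<omega>\<bar> \<partial>M) \<le> sqrt (\<integral>\<omega>. (X \<omega>)\<^sup>2 \<partial>M)" by (rule real_le_rsqrt)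
qed

context brownian
begin

lemma step_integral_path_functional:
  assumes "step_integral B h W" "u \<le> v"
  shows "\<exists>w \<in> borel_measurable (PiM UNIV (\<lambda>_. borel)). \<forall>\<omega> s.
      w (\<lambda>t. brownian_path \<omega> t + s * clip_path u v t) = W \<omega> + s * L2_inner lborel h (indicator {u<..v})"
proof -
  obtain m c a b where ab: "\<And>k. k < (m::nat) \<Longrightarrow> a k \<le> b k"
    and h: "h = (\<lambda>x. \<Sum>k<m. c k * indicator {a k<..b k} x)"
    and W: "W = (\<lambda>\<omega>. \<Sum>k<m. c k * (B (b k) \<omega> - B (a k) \<omega>))"
    using assms(1) unfolding step_integral_def by blast
  let ?w = "\<lambda>x :: real \<Rightarrow> real. \<Sum>k<m. c k * (x (b k) - x (a k))"
  have "L2_inner lborel h (indicator {u<..v}) = (\<Sum>k<m. c k * (clip u v (b k) - clip u v (a k)))"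
    unfolding h using L2_indicator_Ioc ab assms(2)
    by (subst L2_inner_sum_left) (auto simp: L2_inner_indicator_Ioc intro!: sum.cong)
  then have "?w (\<lambda>t. brownian_path \<omega> t + s * clip_path u v t) = W \<omega> + s * L2_inner lborel h (indicator {u<..v})" for \<omega> s
    unfolding W by (simp add: brownian_path_def clip_path_def sum_distrib_left sum.distrib[symmetric] algebra_simps)
  moreover have "?w \<in> borel_measurable (PiM UNIV (\<lambda>_. borel))" by measurable
  ultimately show ?thesis by (intro bexI[of _ ?w]) auto
qed

text \<open>
  The polynomial is a measurable functional \<open>\<Psi>\<close> of the path alone, so that the Cameron--Martin formula
  applies to it; on the translated path its value is a polynomial in the size \<open>s\<close> of the translation.
\<close>
lemma chaos_path_functional:
  assumes step: "\<And>k. k < (m::nat) \<Longrightarrow> step_integral B (h k) (W k)" and "u \<le> v"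
  shows "\<exists>\<Psi> \<in> borel_measurable (PiM UNIV (\<lambda>_. borel)). \<forall>\<omega> s.
      \<Psi> (\<lambda>t. brownian_path \<omega> t + s * clip_path u v t)
      = fact q * (\<Sum>j\<le>q. s ^ j / fact j * chaos_coefficient q (indicator {u<..v}) j {..<m} c h W \<omega>)"
proof -
  let ?e = "indicator {u<..v} :: real \<Rightarrow> real"
  have "\<exists>w. k < m \<longrightarrow> w \<in> borel_measurable (PiM UNIV (\<lambda>_. borel)) \<and> (\<forall>\<omega> s.
      w (\<lambda>t. brownian_path \<omega> t + s * clip_path u v t) = W k \<omega> + s * L2_inner lborel (h k) ?e)" for k
    using step_integral_path_functional[OF step \<open>u \<le> v\<close>, of k] by blast
  then obtain w where w_meas: "\<And>k. k < m \<Longrightarrow> w k \<in> borel_measurable (PiM UNIV (\<lambda>_. borel))"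
    and w: "\<And>k \<omega> s. k < m \<Longrightarrow> w k (\<lambda>t. brownian_path \<omega> t + s * clip_path u v t) = W k \<omega> + s * L2_inner lborel (h k) ?e"
    by metis
  let ?\<Psi> = "\<lambda>x. fact q * (\<Sum>k<m. c k * scaled_hermite q (w k x) (L2_inner lborel (h k) (h k)))"
  have "?\<Psi> \<in> borel_measurable (PiM UNIV (\<lambda>_. borel))"
    using w_meas by (intro borel_measurable_times borel_measurable_const borel_measurable_sum borel_measurable_scaled_hermite) auto
  moreover have "?\<Psi> (\<lambda>t. brownian_path \<omega> t + s * clip_path u v t)
      = fact q * (\<Sum>j\<le>q. s ^ j / fact j * chaos_coefficient q ?e j {..<m} c h W \<omega>)" for \<omega> s
  proof -
    have "?\<Psi> (\<lambda>t. brownian_path \<omega> t + s * clip_path u v t)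
        = fact q * (\<Sum>k<m. \<Sum>j\<le>q. s ^ j / fact j * (c k * L2_inner lborel (h k) ?e ^ j
            * scaled_hermite (q - j) (W k \<omega>) (L2_inner lborel (h k) (h k))))"
      by (simp add: w scaled_hermite_shift sum_distrib_left power_mult_distrib mult_ac)
    also have "\<dots> = fact q * (\<Sum>j\<le>q. s ^ j / fact j * chaos_coefficient q ?e j {..<m} c h W \<omega>)"
      unfolding chaos_coefficient_def sum_distrib_left by (subst sum.swap) simp
    finally show ?thesis .
  qed
  ultimately show ?thesis by (intro bexI[of _ ?\<Psi>]) auto
qed

text \<open>
  The functionals \<open>\<Psi> k\<close> approximate \<open>X\<close> along the Brownian path and converge, simultaneously for all
  \<open>s\<close>, along the translated paths.  Approximations with kernels at distance \<open>2\<^bsup>-k\<^esup>\<close> are chosen, so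
  that the coefficients of the polynomials form a fast Cauchy sequence in \<open>L\<^sup>2\<close>.  The coefficient of
  \<open>s\<^sup>q\<close> is deterministic, since it is already the number \<open>\<langle>F, e \<otimes> \<dots> \<otimes> e\<rangle>\<close> for every approximating
  kernel \<open>F\<close>.  If \<open>L\<close> vanishes when its first variable lies in \<open>(u, v]\<close>, then its contractions with the
  indicator \<open>e\<close> are \<open>0\<close>, and so are all coefficients of positive degree.
\<close>
theorem multiple_integral_shift:
  assumes X: "multiple_wiener_integral M B q L X" and "u < v"
  defines "e \<equiv> indicator {u<..v} :: real \<Rightarrow> real"
  shows "\<exists>\<Psi> a. (\<forall>k. \<Psi> k \<in> borel_measurable (PiM UNIV (\<lambda>_. borel)))
     \<and> (\<forall>j. a j \<in> borel_measurable M)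
     \<and> (AE \<omega> in M. \<forall>s. (\<lambda>k::nat. \<Psi> k (\<lambda>t. brownian_path \<omega> t + s * clip_path u v t))
           \<longlonglongrightarrow> fact q * (\<Sum>j\<le>q. s ^ j / fact j * a j \<omega>))
     \<and> (AE \<omega> in M. fact q * a 0 \<omega> = X \<omega>)
     \<and> (AE \<omega> in M. a q \<omega> = L2_inner (leb q) L (tensor q (\<lambda>_. e)))
     \<and> ((\<forall>\<xi>. \<xi> 1 \<in> {u<..v} \<longrightarrow> L \<xi> = 0) \<longrightarrow> (AE \<omega> in M. \<forall>j\<in>{1..q}. a j \<omega> = 0))"
proof -
  have e: "e \<in> L2 lborel" "0 < L2_inner lborel e e"
    using \<open>u < v\<close> by (auto simp: e_def L2_indicator_Ioc L2_inner_indicator_Ioc clip_def)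
  have L: "L \<in> L2 (leb q)" using X by (simp add: multiple_wiener_integral_def L2_sym_def)
  have X_meas [measurable]: "X \<in> borel_measurable M"
    using X by (auto simp: multiple_wiener_integral_def L2_extension_def L2_tendsto_def L2_def)
  define approx where "approx = (\<lambda>k (m, c, h, W). (\<forall>i<m. step_integral B (h i) (W i))
      \<and> (\<integral>\<xi>. (chaos_kernel q {..<m} c h \<xi> - L \<xi>)\<^sup>2 \<partial>leb q) < (1/4)^k
      \<and> (\<integral>\<omega>. min 1 \<bar>fact q * chaos_coefficient q (\<lambda>_. 0) 0 {..<m::nat} c h W \<omega> - X \<omega>\<bar> \<partial>M) < (1/4)^k)"
  have "\<exists>x. approx k x" for k
    using multiple_integral_approximation[OF X, of "(1/4)^k"] unfolding approx_def by (auto simp: Bex_def)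
  then obtain x where x: "\<And>k. approx k (x k)" by metis
  define m c h W where "m = (\<lambda>k. fst (x k))" and "c = (\<lambda>k. fst (snd (x k)))"
    and "h = (\<lambda>k. fst (snd (snd (x k))))" and "W = (\<lambda>k. snd (snd (snd (x k))))"
  define F where "F = (\<lambda>k. chaos_kernel q {..<m k} (c k) (h k))"
  define A where "A = (\<lambda>j k. chaos_coefficient q e j {..<m k} (c k) (h k) (W k))"
  have step: "step_integral B (h k i) (W k i)" if "i < m k" for i k
    using x[of k] that by (auto simp: approx_def m_def h_def W_def split: prod.splits)
  have F_L: "(\<integral>\<xi>. (F k \<xi> - L \<xi>)\<^sup>2 \<partial>leb q) < (1/4)^k" for k
    using x[of k] by (simp add: approx_def m_def h_def c_def F_def split: prod.splits)
  have A_X: "(\<integral>\<omega>. min 1 \<bar>fact q * A 0 k \<omega> - X \<omega>\<bar> \<partial>M) < (1/4)^k" for k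
    using x[of k] by (simp add: approx_def m_def h_def c_def W_def A_def chaos_coefficient_def split: prod.splits)
  have A_meas [measurable]: "A j k \<in> borel_measurable M" for j k
    unfolding A_def using step by (intro chaos_coefficient_measurable) auto
  have F: "F k \<in> L2 (leb q)" for k unfolding F_def using step by (intro chaos_kernel_L2) auto
  have pow: "sqrt (C * (1/4)^k) = sqrt C * (1/2)^k" for C :: real and k
    by (simp add: real_sqrt_mult real_sqrt_power real_sqrt_divide)
  have summable_half: "summable (\<lambda>k. C * (1/2)^k)" for C :: real
    by (intro summable_mult summable_geometric) simp
  have D: "(\<lambda>\<omega>. A j (Suc k) \<omega> - A j k \<omega>) \<in> L2 M"
    and D_le: "(\<integral>\<omega>. (A j (Suc k) \<omega> - A j k \<omega>)\<^sup>2 \<partial>M) \<le> (4 * L2_inner lborel e e ^ j) * (1/4)^k" if "j \<le> q" for j k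
  proof -
    \<comment> \<open>The difference of two consecutive approximations is one combination over the disjoint sum of the index sets.\<close>
    let ?I = "{..<m (Suc k)} <+> {..<m k}"
    let ?c = "case_sum (c (Suc k)) (\<lambda>i. - c k i)" and ?h = "case_sum (h (Suc k)) (h k)" and ?W = "case_sum (W (Suc k)) (W k)"
    have split: "chaos_coefficient q e j ?I ?c ?h ?W \<omega> = A j (Suc k) \<omega> - A j k \<omega>" for \<omega>
      by (simp add: chaos_coefficient_def A_def sum.Plus sum_negf)
    have split': "chaos_kernel q ?I ?c ?h \<xi> = F (Suc k) \<xi> - F k \<xi>" for \<xi>
      by (simp add: chaos_kernel_def F_def sum.Plus sum_negf)
    have 0: "(\<lambda>_. 0) \<in> L2 (leb q)" by (simp add: L2_def)
    have "step_integral B (?h i) (?W i)" if "i \<in> ?I" for i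
      using that step by auto
    note bound = chaos_coefficient_bound[of ?I ?h ?W e j q "\<lambda>_. 0" ?c, OF this e that 0, unfolded split split']
    then show "(\<lambda>\<omega>. A j (Suc k) \<omega> - A j k \<omega>) \<in> L2 M" by (simp add: L2_def)
    have "(\<integral>\<xi>. (F (Suc k) \<xi> - F k \<xi>)\<^sup>2 \<partial>leb q) \<le> 2 * (\<integral>\<xi>. (F (Suc k) \<xi> - L \<xi>)\<^sup>2 \<partial>leb q) + 2 * (\<integral>\<xi>. (L \<xi> - F k \<xi>)\<^sup>2 \<partial>leb q)"
      by (intro L2_norm_triangle_le F L)
    also have "\<dots> \<le> 4 * (1/4)^k"
    proof -
      have "0 \<le> (1/4 :: real)^k" by simp
      then show ?thesis
        using F_L[of k] F_L[of "Suc k"] unfolding power2_commute[of "L _"] power_Suc by linarith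
    qed
    finally have "L2_inner lborel e e ^ j * (\<integral>\<xi>. (F (Suc k) \<xi> - F k \<xi>)\<^sup>2 \<partial>leb q)
        \<le> L2_inner lborel e e ^ j * (4 * (1/4)^k)"
      using e(2) by (intro mult_left_mono) auto
    then show "(\<integral>\<omega>. (A j (Suc k) \<omega> - A j k \<omega>)\<^sup>2 \<partial>M) \<le> (4 * L2_inner lborel e e ^ j) * (1/4)^k"
      using bound(2) by simp
  qed
  define a where "a = (\<lambda>j \<omega>. lim (\<lambda>k. A j k \<omega>))"
  have a_meas: "a j \<in> borel_measurable M" for j
    unfolding a_def by (intro borel_measurable_lim_metric) measurable
  have conv: "AE \<omega> in M. (\<lambda>k. A j k \<omega>) \<longlonglongrightarrow> a j \<omega>" if "j \<le> q" for j
  proof -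
    have "(\<integral>\<omega>. \<bar>A j (Suc k) \<omega> - A j k \<omega>\<bar> \<partial>M) \<le> sqrt (4 * L2_inner lborel e e ^ j) * (1/2)^k" for k
      using expectation_abs_le_sqrt(2)[OF D[OF that, of k]] real_sqrt_le_mono[OF D_le[OF that, of k]]
      unfolding pow by linarith
    then have "AE \<omega> in M. summable (\<lambda>k. \<bar>A j (Suc k) \<omega> - A j k \<omega>\<bar>)"
      by (rule AE_summable_of_summable_integrals[OF expectation_abs_le_sqrt(1)[OF D[OF that]] _ summable_half])
    then show ?thesis
    proof eventually_elim
      case (elim \<omega>)
      have "convergent (\<lambda>n. \<Sum>k<n. A j (Suc k) \<omega> - A j k \<omega>)"
        using summable_rabs_cancel[OF elim] by (simp add: summable_iff_convergent)
      moreover have "(\<Sum>k<n. A j (Suc k) \<omega> - A j k \<omega>) = A j n \<omega> - A j 0 \<omega>" for n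
        by (rule sum_lessThan_telescope)
      ultimately have "convergent (\<lambda>n. A j n \<omega> - A j 0 \<omega>)" by simp
      then have "convergent (\<lambda>n. A j n \<omega>)" by (simp add: convergent_diff_const_right_iff)
      then show ?case by (simp add: a_def convergent_LIMSEQ_iff)
    qed
  qed
  have conv_all: "AE \<omega> in M. \<forall>j\<in>{..q}. (\<lambda>k. A j k \<omega>) \<longlonglongrightarrow> a j \<omega>"
    using conv by (intro AE_finite_allI) auto
  have "\<exists>\<Psi>. \<Psi> \<in> borel_measurable (PiM UNIV (\<lambda>_. borel)) \<and> (\<forall>\<omega> s. \<Psi> (\<lambda>t. brownian_path \<omega> t + s * clip_path u v t)
      = fact q * (\<Sum>j\<le>q. s ^ j / fact j * A j k \<omega>))" for k
    using chaos_path_functional[of "m k" "h k" "W k" u v q "c k"] step \<open>u < v\<close> unfolding A_def e_def by auto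
  then obtain \<Psi> where \<Psi>_meas: "\<And>k. \<Psi> k \<in> borel_measurable (PiM UNIV (\<lambda>_. borel))"
    and \<Psi>: "\<And>k \<omega> s. \<Psi> k (\<lambda>t. brownian_path \<omega> t + s * clip_path u v t) = fact q * (\<Sum>j\<le>q. s ^ j / fact j * A j k \<omega>)"
    by metis
  have lim: "AE \<omega> in M. \<forall>s. (\<lambda>k. \<Psi> k (\<lambda>t. brownian_path \<omega> t + s * clip_path u v t))
           \<longlonglongrightarrow> fact q * (\<Sum>j\<le>q. s ^ j / fact j * a j \<omega>)"
    using conv_all
  proof eventually_elim
    case (elim \<omega>)
    then show ?case unfolding \<Psi> by (auto intro!: tendsto_intros)
  qed
  have a0: "AE \<omega> in M. fact q * a 0 \<omega> = X \<omega>"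
  proof -
    have "AE \<omega> in M. summable (\<lambda>k. \<bar>min 1 \<bar>fact q * A 0 k \<omega> - X \<omega>\<bar>\<bar>)"
    proof (rule AE_summable_of_summable_integrals)
      show "integrable M (\<lambda>\<omega>. min 1 \<bar>fact q * A 0 k \<omega> - X \<omega>\<bar>)" for k
        by (rule integrable_const_bound[where B = 1]) auto
      show "(\<integral>\<omega>. \<bar>min 1 \<bar>fact q * A 0 k \<omega> - X \<omega>\<bar>\<bar> \<partial>M) \<le> (1/4)^k" for k
        using A_X[of k] by (simp add: abs_of_nonneg)
      show "summable (\<lambda>k. (1/4)^k :: real)" by (intro summable_geometric) simp
    qed
    then show ?thesis
      using conv[of 0, simplified]
    proof eventually_elim
      case (elim \<omega>)
      have "(\<lambda>k. min 1 \<bar>fact q * A 0 k \<omega> - X \<omega>\<bar>) \<longlonglongrightarrow> 0"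
        using summable_LIMSEQ_zero[OF elim(1)] by (simp add: abs_of_nonneg)
      moreover have "(\<lambda>k. min 1 \<bar>fact q * A 0 k \<omega> - X \<omega>\<bar>) \<longlonglongrightarrow> min 1 \<bar>fact q * a 0 \<omega> - X \<omega>\<bar>"
        using elim(2) by (intro tendsto_intros)
      ultimately have "min 1 \<bar>fact q * a 0 \<omega> - X \<omega>\<bar> = 0" using LIMSEQ_unique by blast
      then show ?case by (auto simp: min_def split: if_splits)
    qed
  qed
  have aq: "AE \<omega> in M. a q \<omega> = L2_inner (leb q) L (tensor q (\<lambda>_. e))"
  proof -
    have T: "tensor q (\<lambda>_. e) \<in> L2 (leb q)" by (intro tensor_L2 e)
    have "L2_inner (leb q) (F k) (tensor q (\<lambda>_. e)) = A q k \<omega>" for k \<omega>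
    proof -
      have h: "h k i \<in> L2 lborel" if "i < m k" for i using step_integral_L2[OF step[OF that]] .
      then have "L2_inner (leb q) (F k) (tensor q (\<lambda>_. e)) = (\<Sum>i<m k. c k i * L2_inner (leb q) (tensor q (\<lambda>_. h k i)) (tensor q (\<lambda>_. e)))"
        unfolding F_def chaos_kernel_def[abs_def] by (intro L2_inner_sum_left T tensor_L2) auto
      also have "\<dots> = A q k \<omega>"
        unfolding A_def chaos_coefficient_def using h e by (intro sum.cong refl) (subst L2_inner_tensor, auto)
      finally show ?thesis .
    qed
    moreover have "L2_tendsto (leb q) F L"
      unfolding L2_tendsto_def
    proof (intro conjI allI F L)
      show "(\<lambda>k. \<integral>\<xi>. (F k \<xi> - L \<xi>)\<^sup>2 \<partial>leb q) \<longlonglongrightarrow> 0"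
      proof (rule LIMSEQ_zero_squeeze)
        show "(\<lambda>k. (1/4)^k :: real) \<longlonglongrightarrow> 0" by (intro LIMSEQ_power_zero) simp
        show "(\<integral>\<xi>. (F k \<xi> - L \<xi>)\<^sup>2 \<partial>leb q) \<le> (1/4)^k" for k using F_L[of k] by simp
      qed simp
    qed
    ultimately have "(\<lambda>k. A q k \<omega>) \<longlonglongrightarrow> L2_inner (leb q) L (tensor q (\<lambda>_. e))" for \<omega>
      using L2_inner_tendsto[of "leb q" F L, OF _ T] by simp
    then have "a q \<omega> = L2_inner (leb q) L (tensor q (\<lambda>_. e))" for \<omega>
      unfolding a_def by (rule limI)
    then show ?thesis by simp
  qed
  have zero: "AE \<omega> in M. \<forall>j\<in>{1..q}. a j \<omega> = 0" if L0: "\<forall>\<xi>. \<xi> 1 \<in> {u<..v} \<longrightarrow> L \<xi> = 0"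
  proof (rule AE_finite_allI)
    fix j assume j: "j \<in> {1..q}"
    have "(\<Prod>r\<in>{1..j}. e (\<xi> r)) = e (\<xi> 1) * (\<Prod>r\<in>{Suc 1..j}. e (\<xi> r))" for \<xi>
      using j by (intro prod.atLeast_Suc_atMost) auto
    then have L_e: "L \<xi> * (\<Prod>r\<in>{1..j}. e (\<xi> r)) = 0" for \<xi>
      using L0 by (cases "\<xi> 1 \<in> {u<..v}") (auto simp: e_def)
    have "j \<le> q" using j by simp
    note bound = chaos_coefficient_bound[OF _ e \<open>j \<le> q\<close> L L_e, of "{..<m k}" "h k" "W k" "c k" for k]
    have sq: "(\<integral>\<omega>. (A j k \<omega>)\<^sup>2 \<partial>M) \<le> L2_inner lborel e e ^ j * (1/4)^k" for k
    proof -
      have "(\<integral>\<omega>. (A j k \<omega>)\<^sup>2 \<partial>M) \<le> L2_inner lborel e e ^ j * (\<integral>\<xi>. (F k \<xi> - L \<xi>)\<^sup>2 \<partial>leb q)"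
        unfolding A_def F_def using step by (intro bound(2)) auto
      also have "\<dots> \<le> L2_inner lborel e e ^ j * (1/4)^k"
        using F_L[of k] e(2) by (intro mult_left_mono) auto
      finally show ?thesis .
    qed
    have A: "A j k \<in> L2 M" for k
      using bound(1)[of k] step A_meas[of j k] unfolding A_def by (auto simp: L2_def)
    have "(\<integral>\<omega>. \<bar>A j k \<omega>\<bar> \<partial>M) \<le> sqrt (L2_inner lborel e e ^ j) * (1/2)^k" for k
      using expectation_abs_le_sqrt(2)[OF A[of k]] real_sqrt_le_mono[OF sq[of k]] unfolding pow by linarith
    then have "AE \<omega> in M. summable (\<lambda>k. \<bar>A j k \<omega>\<bar>)"
      by (rule AE_summable_of_summable_integrals[OF expectation_abs_le_sqrt(1)[OF A] _ summable_half])
    then show "AE \<omega> in M. a j \<omega> = 0"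
    proof eventually_elim
      case (elim \<omega>)
      then have "(\<lambda>k. A j k \<omega>) \<longlonglongrightarrow> 0" using summable_LIMSEQ_zero[OF elim] by (simp add: tendsto_rabs_zero_iff)
      then show ?case unfolding a_def by (rule limI)
    qed
  qed simp
  show ?thesis
    using \<Psi>_meas a_meas lim a0 aq zero by blast
qed

end

section \<open>Preimages of null sets under polynomials\<close>

text \<open>
  By the change of variables formula the integral over \<open>S\<close> of the absolute value of the derivative is the
  measure of the image of \<open>S\<close>, a subset of \<open>N\<close>; and the derivative has no zero in \<open>S\<close>.
\<close>
lemma null_sets_vimage_poly_injective:
  fixes p :: "real poly"
  assumes N: "N \<in> null_sets lborel" and S: "S \<in> sets borel" "\<And>x. x \<in> S \<Longrightarrow> poly p x \<in> N"
    and der: "\<And>x. x \<in> S \<Longrightarrow> poly (pderiv p) x \<noteq> 0" and inj: "inj_on (poly p) S"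
  shows "S \<in> null_sets lborel"
proof -
  have S_leb: "S \<in> sets lebesgue" using S(1) by simp
  have "negligible N" using N by (simp add: negligible_iff_null_sets null_sets_completionI)
  then have neg: "negligible (poly p ` S)" by (rule negligible_subset) (use S in auto)
  have "(poly p has_field_derivative poly (pderiv p) x) (at x within S)" for x
    by (rule has_field_derivative_at_within[OF poly_DERIV])
  from has_absolute_integral_change_of_variables_1'[OF S_leb this inj, of "\<lambda>_. 1" 0]
  have "(\<lambda>x. \<bar>poly (pderiv p) x\<bar>) absolutely_integrable_on S \<and> integral S (\<lambda>x. \<bar>poly (pderiv p) x\<bar>) = 0"
    using neg by (simp add: absolutely_integrable_negligible integral_negligible)
  then have int: "integrable lebesgue (\<lambda>x. indicator S x * \<bar>poly (pderiv p) x\<bar>)"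
    and zero: "(\<integral>x. indicator S x * \<bar>poly (pderiv p) x\<bar> \<partial>lebesgue) = 0"
    using set_lebesgue_integral_eq_integral(2)[of S "\<lambda>x. \<bar>poly (pderiv p) x\<bar>"]
    by (auto simp: set_integrable_def set_lebesgue_integral_def)
  have "AE x in lebesgue. indicator S x * \<bar>poly (pderiv p) x\<bar> = 0"
    using integral_nonneg_eq_0_iff_AE[OF int] zero by simp
  then have "AE x in lebesgue. x \<notin> S"
    by eventually_elim (use der in \<open>auto simp: indicator_def split: if_splits\<close>)
  then have "S \<in> null_sets lebesgue" using S_leb by (simp add: AE_iff_null_sets)
  then show ?thesis using S(1) by (simp add: null_sets_completion_iff)
qed

text \<open>
  Outside the finitely many critical points the line is covered by countably many rational intervals
  on which the polynomial is injective by the mean value theorem.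
\<close>
lemma null_sets_vimage_poly:
  fixes p :: "real poly"
  assumes N: "N \<in> null_sets lborel" and p: "0 < degree p"
  shows "{s. poly p s \<in> N} \<in> null_sets lborel"
proof -
  define S where "S = {s. poly p s \<in> N}"
  have [measurable]: "N \<in> sets borel" using N by auto
  have S: "S \<in> sets borel"
  proof -
    have "poly p \<in> borel_measurable borel" by (intro borel_measurable_continuous_onI continuous_intros)
    from measurable_sets[OF this \<open>N \<in> sets borel\<close>] show ?thesis by (simp add: S_def vimage_def)
  qed
  define R where "R = {x. poly (pderiv p) x = 0}"
  have "pderiv p \<noteq> 0" using p by (simp add: pderiv_eq_0_iff)
  then have "finite R" unfolding R_def by (rule poly_roots_finite)
  define Q where "Q = {(a, b). a \<in> \<rat> \<and> b \<in> \<rat> \<and> {a<..<b} \<inter> R = {}}"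
  have "countable Q"
    unfolding Q_def by (rule countable_subset[of _ "\<rat> \<times> \<rat>"]) (auto intro: countable_rat)
  have null: "S \<inter> {a<..<b} \<in> null_sets lborel" if "(a, b) \<in> Q" for a b
  proof (rule null_sets_vimage_poly_injective[OF N, where p = p])
    have der: "poly (pderiv p) x \<noteq> 0" if "x \<in> {a<..<b}" for x
      using \<open>(a, b) \<in> Q\<close> that by (auto simp: Q_def R_def)
    show "S \<inter> {a<..<b} \<in> sets borel" using S by simp
    show "poly p x \<in> N" if "x \<in> S \<inter> {a<..<b}" for x using that by (simp add: S_def)
    show "poly (pderiv p) x \<noteq> 0" if "x \<in> S \<inter> {a<..<b}" for x using der that by auto
    have "poly p x \<noteq> poly p y" if "x < y" "a < x" "y < b" for x y
    proof
      assume "poly p x = poly p y"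
      moreover obtain z where "x < z" "z < y" "poly p y - poly p x = (y - x) * poly (pderiv p) z"
        using poly_MVT[OF \<open>x < y\<close>, of p] by auto
      ultimately show False using der[of z] that by auto
    qed
    then show "inj_on (poly p) (S \<inter> {a<..<b})"
      by (intro linorder_inj_onI) auto
  qed
  have "S \<subseteq> R \<union> (\<Union>(a, b)\<in>Q. S \<inter> {a<..<b})"
  proof
    fix x assume "x \<in> S"
    show "x \<in> R \<union> (\<Union>(a, b)\<in>Q. S \<inter> {a<..<b})"
    proof (cases "x \<in> R")
      case False
      have "open (- R)" using \<open>finite R\<close> by (simp add: finite_imp_closed open_Compl)
      then obtain d where d: "0 < d" "\<And>y. dist y x < d \<Longrightarrow> y \<notin> R"
        using False unfolding open_dist by blast
      obtain a where a: "a \<in> \<rat>" "x - d < a" "a < x" using Rats_dense_in_real[of "x - d" x] d(1) by auto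
      obtain b where b: "b \<in> \<rat>" "x < b" "b < x + d" using Rats_dense_in_real[of x "x + d"] d(1) by auto
      have "(a, b) \<in> Q" using a b d(2) by (auto simp: Q_def dist_real_def)
      moreover have "x \<in> S \<inter> {a<..<b}" using a b \<open>x \<in> S\<close> by simp
      ultimately show ?thesis by blast
    qed simp
  qed
  moreover have "R \<in> null_sets lborel" by (rule finite_imp_null_set_lborel[OF \<open>finite R\<close>])
  moreover have "(\<Union>(a, b)\<in>Q. S \<inter> {a<..<b}) \<in> null_sets lborel"
    by (rule null_sets_UN'[OF \<open>countable Q\<close>]) (use null in auto)
  ultimately have "S \<in> null_sets lborel"
    using S by (auto intro: null_sets_subset[OF null_sets.Un])
  then show ?thesis by (simp add: S_def)
qed

section \<open>The kernel of the Hermite process\<close>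

lemma integrable_powr_at_left_end:
  fixes \<alpha> x v :: real
  assumes "-1 < \<alpha>" "x \<le> v"
  shows "integrable lborel (\<lambda>s. indicator {x..v} s * (s - x) powr \<alpha>)"
proof -
  have "(\<lambda>y. y powr \<alpha>) integrable_on {0..v - x}"
    using assms by (intro integrable_on_powr_from_0) auto
  then have "(\<lambda>y. y powr \<alpha>) absolutely_integrable_on {0..v - x}"
    by (rule nonnegative_absolutely_integrable_1) auto
  then have "integrable lebesgue (\<lambda>y. indicator {0..v - x} y * y powr \<alpha>)"
    by (simp add: set_integrable_def)
  then have "integrable lborel (\<lambda>y. indicator {0..v - x} y * y powr \<alpha>)"
    by (subst (asm) integrable_completion) auto
  from lborel_integrable_real_affine[OF this, of 1 "- x"] show ?thesis
    by (rule back_subst[of "integrable lborel"]) (auto simp: fun_eq_iff indicator_def)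
qed

text \<open>
  The exponent of the kernel is above \<open>-1\<close>, so that its singularity is integrable, and negative, so
  that the factors away from their singularities are bounded by a constant.  The last two bounds are
  the positivity of the arguments of the Beta function in the normalising constant.
\<close>
lemma hermite_exponent_bounds:
  assumes "1 \<le> q" "1 / 2 < H" "H < 1"
  shows "-1 < hermite_H0 H q - 3 / 2" "hermite_H0 H q - 3 / 2 < 0"
    "0 < hermite_H0 H q - 1 / 2" "0 < 2 - 2 * hermite_H0 H q"
proof -
  have "(1 - H) / real q \<le> 1 - H" "0 < (1 - H) / real q"
    using assms by (auto simp: divide_le_eq mult_le_cancel_left1)
  moreover define x where "x = (H - 1) / real q"
  ultimately have "H - 1 \<le> x" "x < 0"
    by (simp_all add: diff_divide_distrib)
  then show "-1 < hermite_H0 H q - 3 / 2" "hermite_H0 H q - 3 / 2 < 0"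
    "0 < hermite_H0 H q - 1 / 2" "0 < 2 - 2 * hermite_H0 H q"
    using assms(2,3) unfolding hermite_H0_def x_def[symmetric] by (simp_all add: algebra_simps)
qed

lemma hermite_const_pos:
  assumes "1 \<le> q" "1 / 2 < H" "H < 1"
  shows "0 < hermite_const H q"
proof -
  have "0 < Beta (hermite_H0 H q - 1 / 2) (2 - 2 * hermite_H0 H q)"
    using hermite_exponent_bounds[OF assms]
    by (auto simp: Beta_altdef rGamma_inverse_Gamma intro!: mult_pos_pos Gamma_real_pos)
  then show ?thesis using assms by (auto simp: hermite_const_def intro!: divide_pos_pos mult_pos_pos)
qed

lemma pos_powr_nonneg: "0 \<le> pos_powr \<theta> \<alpha>"
  by (simp add: pos_powr_def)

lemma borel_measurable_pos_powr [measurable]: "(\<lambda>s. pos_powr s \<alpha>) \<in> borel_measurable borel"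
  unfolding pos_powr_def by measurable

text \<open>
  The process at time \<open>t\<close> depends only on the noise up to time \<open>t\<close>: at every \<open>s < t\<close> the factor with
  index \<open>j\<close> vanishes.
\<close>
lemma hermite_kernel_eq_0:
  assumes "0 \<le> t" "j \<in> {1..q}" "t \<le> \<xi> j"
  shows "hermite_kernel H q t \<xi> = 0"
proof -
  let ?f = "\<lambda>s. \<Prod>j\<in>{1..q}. pos_powr (s - \<xi> j) (hermite_H0 H q - 3 / 2)"
  have "(LBINT s=ereal 0..ereal t. ?f s) = (LBINT s=ereal 0..ereal t. 0)"
  proof (rule interval_integral_cong)
    fix s assume "s \<in> einterval (min (ereal 0) (ereal t)) (max (ereal 0) (ereal t))"
    then have "pos_powr (s - \<xi> j) (hermite_H0 H q - 3 / 2) = 0"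
      using assms by (auto simp: einterval_def pos_powr_def min_def max_def split: if_splits)
    then show "?f s = 0" using assms(2) by (auto intro: prod_zero)
  qed
  then show ?thesis unfolding hermite_kernel_def by simp
qed

lemma hermite_kernel_eq_set_integral:
  assumes "0 \<le> t"
  shows "hermite_kernel H q t \<xi> = hermite_const H q *
    (\<integral>s. indicator {0<..<t} s * (\<Prod>j\<in>{1..q}. pos_powr (s - \<xi> j) (hermite_H0 H q - 3 / 2)) \<partial>lborel)"
  using assms unfolding hermite_kernel_def
  by (subst interval_integral_Ioo) (auto simp: set_lebesgue_integral_def)

lemma hermite_kernel_nonneg:
  assumes "1 \<le> q" "1 / 2 < H" "H < 1" "0 \<le> t"
  shows "0 \<le> hermite_kernel H q t \<xi>"
  unfolding hermite_kernel_eq_set_integral[OF assms(4)]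
  using hermite_const_pos[OF assms(1-3)]
  by (intro mult_nonneg_nonneg Bochner_Integration.integral_nonneg prod_nonneg pos_powr_nonneg) auto

text \<open>
  The integral over \<open>s\<close> has the conventional value \<open>0\<close> when it diverges, so positivity of the integrand
  does not suffice.  The integrand vanishes for \<open>s \<le> \<xi> 1\<close>, and if \<open>\<xi> 1\<close> exceeds the other variables by
  \<open>\<delta>\<close>, then all factors but the first are bounded by \<open>\<delta> powr \<alpha>\<close> for \<open>s > \<xi> 1\<close>; what remains is one
  integrable singularity.
\<close>
lemma hermite_kernel_pos:
  assumes q: "1 \<le> q" and H: "1 / 2 < H" "H < 1"
    and \<xi>1: "0 \<le> \<xi> 1" "\<xi> 1 < t" and \<delta>: "0 < \<delta>" "\<And>j. j \<in> {2..q} \<Longrightarrow> \<xi> j + \<delta> \<le> \<xi> 1"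
  shows "0 < hermite_kernel H q t \<xi>"
proof -
  define \<alpha> where "\<alpha> = hermite_H0 H q - 3 / 2"
  have \<alpha>: "-1 < \<alpha>" "\<alpha> < 0" using hermite_exponent_bounds[OF q H] by (auto simp: \<alpha>_def)
  define f where "f = (\<lambda>s. indicator {0<..<t} s * (\<Prod>j\<in>{1..q}. pos_powr (s - \<xi> j) \<alpha>))"
  have split: "(\<Prod>j\<in>{1..q}. pos_powr (s - \<xi> j) \<alpha>) = pos_powr (s - \<xi> 1) \<alpha> * (\<Prod>j\<in>{2..q}. pos_powr (s - \<xi> j) \<alpha>)" for s
    using q by (simp add: prod.atLeast_Suc_atMost numeral_2_eq_2)
  have f_nonneg: "0 \<le> f s" for s
    unfolding f_def by (intro mult_nonneg_nonneg prod_nonneg pos_powr_nonneg) auto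
  have f_meas: "f \<in> borel_measurable lborel" unfolding f_def by measurable
  have "integrable lborel f"
  proof (rule Bochner_Integration.integrable_bound)
    show "integrable lborel (\<lambda>s. (\<delta> powr \<alpha>) ^ card {2..q} * (indicator {\<xi> 1..t} s * (s - \<xi> 1) powr \<alpha>))"
      using integrable_powr_at_left_end[of \<alpha> "\<xi> 1" t] \<alpha> \<xi>1 by simp
    show "AE s in lborel. norm (f s) \<le> norm ((\<delta> powr \<alpha>) ^ card {2..q} * (indicator {\<xi> 1..t} s * (s - \<xi> 1) powr \<alpha>))"
    proof (rule AE_I2)
      fix s
      show "norm (f s) \<le> norm ((\<delta> powr \<alpha>) ^ card {2..q} * (indicator {\<xi> 1..t} s * (s - \<xi> 1) powr \<alpha>))"
      proof (cases "s \<in> {\<xi> 1<..<t}")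
        case True
        have "(\<Prod>j\<in>{2..q}. pos_powr (s - \<xi> j) \<alpha>) \<le> (\<Prod>j\<in>{2..q}. \<delta> powr \<alpha>)"
        proof (rule prod_mono)
          fix j assume "j \<in> {2..q}"
          then have "\<delta> \<le> s - \<xi> j" using \<delta>(2)[of j] True by auto
          then show "0 \<le> pos_powr (s - \<xi> j) \<alpha> \<and> pos_powr (s - \<xi> j) \<alpha> \<le> \<delta> powr \<alpha>"
            using \<delta>(1) \<alpha> by (auto simp: pos_powr_def intro: powr_mono2')
        qed
        moreover have "0 \<le> (\<Prod>j\<in>{2..q}. pos_powr (s - \<xi> j) \<alpha>)" by (intro prod_nonneg pos_powr_nonneg)
        ultimately show ?thesis
          using True \<xi>1 unfolding f_def split
          by (simp add: pos_powr_def abs_mult mult.commute[of "(s - \<xi> 1) powr \<alpha>"] mult_right_mono del: prod_constant)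
             (simp add: mult_right_mono)
      next
        case False
        then have "f s = 0" unfolding f_def split by (auto simp: pos_powr_def indicator_def)
        then show ?thesis by simp
      qed
    qed
  qed (rule f_meas)
  moreover have "\<not> (AE s in lborel. f s = 0)"
  proof
    assume "AE s in lborel. f s = 0"
    moreover have "f s \<noteq> 0" if "s \<in> {\<xi> 1<..<t}" for s
    proof -
      have gap: "s - \<xi> j > 0" if "j \<in> {2..q}" for j using \<delta>(1) \<delta>(2)[OF that] \<open>s \<in> {\<xi> 1<..<t}\<close> by auto
      have "0 < pos_powr (s - \<xi> j) \<alpha>" if "j \<in> {2..q}" for j
        using gap[OF that] by (simp add: pos_powr_def)
      then have "0 < (\<Prod>j\<in>{2..q}. pos_powr (s - \<xi> j) \<alpha>)" by (rule prod_pos)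
      moreover have "0 < pos_powr (s - \<xi> 1) \<alpha>" using that by (simp add: pos_powr_def)
      ultimately have "0 < pos_powr (s - \<xi> 1) \<alpha> * (\<Prod>j\<in>{2..q}. pos_powr (s - \<xi> j) \<alpha>)"
        by (intro mult_pos_pos)
      moreover have "f s = pos_powr (s - \<xi> 1) \<alpha> * (\<Prod>j\<in>{2..q}. pos_powr (s - \<xi> j) \<alpha>)"
        using that \<xi>1 unfolding f_def split by simp
      ultimately show ?thesis by linarith
    qed
    ultimately have "AE s in lborel. s \<notin> {\<xi> 1<..<t}" by (auto elim!: eventually_mono)
    then have "{\<xi> 1<..<t} \<in> null_sets lborel" by (subst (asm) AE_iff_null_sets[symmetric]) auto
    then show False using \<xi>1 by (auto simp: null_sets_def)
  qed
  ultimately have "(\<integral>s. f s \<partial>lborel) \<noteq> 0"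
    using integral_nonneg_eq_0_iff_AE[of lborel f] f_nonneg by simp
  moreover have "0 \<le> (\<integral>s. f s \<partial>lborel)" using f_nonneg by simp
  ultimately have "0 < (\<integral>s. f s \<partial>lborel)" by simp
  then show ?thesis
    using hermite_const_pos[OF q H] \<xi>1
    by (subst hermite_kernel_eq_set_integral) (auto simp: f_def \<alpha>_def)
qed

text \<open>
  The integrand is nonnegative, and it is positive on a box in which the first variable is separated from
  the others.
\<close>
lemma hermite_kernel_inner_pos:
  assumes q: "1 \<le> q" and H: "1 / 2 < H" "H < 1" and uv: "0 \<le> u" "u < v"
    and L2: "hermite_kernel H q v \<in> L2 (leb q)"
  shows "L2_inner (leb q) (hermite_kernel H q v) (tensor q (\<lambda>_. indicator {u<..v})) \<noteq> 0"
proof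
  let ?T = "tensor q (\<lambda>_. indicator {u<..v})"
  assume "L2_inner (leb q) (hermite_kernel H q v) ?T = 0"
  moreover have "integrable (leb q) (\<lambda>\<xi>. hermite_kernel H q v \<xi> * ?T \<xi>)"
    by (intro L2_integrable_mult L2 tensor_L2 L2_indicator_Ioc)
  moreover have "0 \<le> hermite_kernel H q v \<xi> * ?T \<xi>" for \<xi>
    unfolding tensor_def using uv by (intro mult_nonneg_nonneg hermite_kernel_nonneg q H prod_nonneg) auto
  ultimately have AE: "AE \<xi> in leb q. hermite_kernel H q v \<xi> * ?T \<xi> = 0"
    using integral_nonneg_eq_0_iff_AE[of "leb q" "\<lambda>\<xi>. hermite_kernel H q v \<xi> * ?T \<xi>"] by (simp add: L2_inner_def)
  \<comment> \<open>The first variable ranges over the last third of \<open>(u, v)\<close>, the others over the first third, which leaves the gap \<open>\<delta>\<close>.\<close>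
  define \<delta> where "\<delta> = (v - u) / 3"
  define I where "I = (\<lambda>j::nat. if j = 1 then {u + 2 * \<delta><..<v} else {u<..<u + \<delta>})"
  have \<delta>: "0 < \<delta>" "u + 3 * \<delta> = v" using uv by (simp_all add: \<delta>_def field_simps)
  interpret product_sigma_finite "\<lambda>_::nat. lborel :: real measure" ..
  have "hermite_kernel H q v \<xi> * ?T \<xi> \<noteq> 0" if \<xi>: "\<xi> \<in> Pi\<^sub>E {1..q} I" for \<xi>
  proof -
    have mem: "\<xi> j \<in> I j" if "j \<in> {1..q}" for j using \<xi> that by (auto simp: PiE_def)
    have 1: "u + 2 * \<delta> < \<xi> 1" "\<xi> 1 < v" using mem[of 1] q by (auto simp: I_def)
    have other: "u < \<xi> j" "\<xi> j < u + \<delta>" if "j \<in> {2..q}" for j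
      using mem[of j] that by (auto simp: I_def)
    have "0 < hermite_kernel H q v \<xi>"
    proof (rule hermite_kernel_pos[OF q H _ _ \<delta>(1)])
      show "0 \<le> \<xi> 1" "\<xi> 1 < v" using 1 uv \<delta> by auto
      show "\<xi> j + \<delta> \<le> \<xi> 1" if "j \<in> {2..q}" for j using other[OF that] 1 by simp
    qed
    moreover have "\<xi> j \<in> {u<..v}" if "j \<in> {1..q}" for j
      using mem[OF that] \<delta> by (auto simp: I_def split: if_splits)
    then have "?T \<xi> = 1" unfolding tensor_def by (intro prod.neutral) auto
    ultimately show ?thesis by simp
  qed
  with AE have "AE \<xi> in leb q. \<xi> \<notin> Pi\<^sub>E {1..q} I" by (auto elim!: eventually_mono)
  moreover have "Pi\<^sub>E {1..q} I \<in> sets (leb q)" by (intro sets_PiM_I_finite) (auto simp: I_def)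
  ultimately have "Pi\<^sub>E {1..q} I \<in> null_sets (leb q)" by (subst AE_iff_null_sets)
  then have "emeasure (leb q) (Pi\<^sub>E {1..q} I) = 0" by auto
  moreover have "emeasure (leb q) (Pi\<^sub>E {1..q} I) = (\<Prod>j\<in>{1..q}. emeasure lborel (I j))"
    by (rule emeasure_PiM) (auto simp: I_def)
  moreover have "emeasure lborel (I j) \<noteq> 0" for j
    using \<delta> by (auto simp: I_def)
  ultimately show False by simp
qed

section \<open>Existence of a density\<close>

text \<open>
  Tonelli's theorem in the form used for vectors indexed by finite sets: a null set has null sections in
  the last coordinate.
\<close>
lemma AE_null_sections_insert:
  fixes I :: "'i set"
  assumes I: "finite I" "i \<notin> I" and N: "N \<in> null_sets (\<Pi>\<^sub>M i\<in>insert i I. lborel :: real measure)"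
  shows "AE x in (\<Pi>\<^sub>M i\<in>I. lborel). {y. x(i := y) \<in> N} \<in> null_sets lborel"
proof -
  interpret product_sigma_finite "\<lambda>_::'i. lborel :: real measure" ..
  have [measurable]: "N \<in> sets (\<Pi>\<^sub>M i\<in>insert i I. lborel :: real measure)" using N by auto
  have upd [measurable]: "(\<lambda>(x, y). x(i := y)) \<in> measurable ((\<Pi>\<^sub>M i\<in>I. lborel) \<Otimes>\<^sub>M lborel) (\<Pi>\<^sub>M i\<in>insert i I. lborel :: real measure)"
    using measurable_add_dim[of i I "\<lambda>_. lborel :: real measure"] by simp
  have "(\<integral>\<^sup>+x. (\<integral>\<^sup>+y. indicator N (x(i := y)) \<partial>lborel) \<partial>(\<Pi>\<^sub>M i\<in>I. lborel)) = 0"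
    using product_nn_integral_insert[OF I, of "indicator N"] N by (simp add: null_sets_def)
  moreover have "(\<lambda>x. \<integral>\<^sup>+y. indicator N (x(i := y)) \<partial>lborel) \<in> borel_measurable (\<Pi>\<^sub>M i\<in>I. lborel :: real measure)"
  proof -
    have "(\<lambda>(x, y). indicator N (x(i := y)) :: ennreal) \<in> borel_measurable ((\<Pi>\<^sub>M i\<in>I. lborel) \<Otimes>\<^sub>M lborel)"
      using measurable_compose[OF upd, of "indicator N" borel] by (simp add: case_prod_unfold)
    then show ?thesis by (rule lborel.borel_measurable_nn_integral)
  qed
  ultimately have "AE x in (\<Pi>\<^sub>M i\<in>I. lborel). (\<integral>\<^sup>+y. indicator N (x(i := y)) \<partial>lborel) = 0"
    by (simp add: nn_integral_0_iff_AE)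
  moreover have "AE x in (\<Pi>\<^sub>M i\<in>I. lborel :: real measure). x \<in> space (\<Pi>\<^sub>M i\<in>I. lborel :: real measure)" by (rule AE_space)
  ultimately show ?thesis
  proof eventually_elim
    case (elim x)
    have "(\<lambda>y. x(i := y)) \<in> measurable lborel (\<Pi>\<^sub>M i\<in>insert i I. lborel :: real measure)"
      using measurable_compose[OF measurable_Pair1'[OF elim(2)] upd] by simp
    then have "(\<lambda>y. x(i := y)) -` N \<inter> space lborel \<in> sets lborel"
      by (rule measurable_sets) measurable
    then have sets: "{y. x(i := y) \<in> N} \<in> sets lborel" by (simp add: vimage_def)
    have "(\<integral>\<^sup>+y. indicator N (x(i := y)) \<partial>lborel) = (\<integral>\<^sup>+y. indicator {y. x(i := y) \<in> N} y \<partial>lborel)"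
      by (intro nn_integral_cong) (simp add: indicator_def)
    also have "\<dots> = emeasure lborel {y. x(i := y) \<in> N}" by (rule nn_integral_indicator[OF sets])
    finally have "(\<integral>\<^sup>+y. indicator N (x(i := y)) \<partial>lborel) = emeasure lborel {y. x(i := y) \<in> N}" .
    with elim(1) sets show ?case by (simp add: null_sets_def)
  qed
qed

context brownian
begin

text \<open>
  The step of the induction, for a family of multiple integrals of the same order: \<open>Z i\<close> for \<open>i \<in> I\<close>
  does not feel the translation on \<open>(u, v]\<close>, whereas \<open>Z i0\<close> is turned into a polynomial whose
  leading coefficient is the nonzero number in hypothesis \<open>top\<close>.
\<close>
theorem absolutely_continuous_insert:
  fixes I :: "'i set" and Z :: "'i \<Rightarrow> 'a \<Rightarrow> real"
  assumes I: "finite I" "i0 \<notin> I" and q: "1 \<le> q" and uv: "u < v"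
    and Z: "\<And>i. i \<in> insert i0 I \<Longrightarrow> multiple_wiener_integral M B q (L i) (Z i)"
    and past: "\<And>i \<xi>. i \<in> I \<Longrightarrow> \<xi> 1 \<in> {u<..v} \<Longrightarrow> L i \<xi> = 0"
    and top: "L2_inner (leb q) (L i0) (tensor q (\<lambda>_. indicator {u<..v})) \<noteq> 0"
    and ac: "absolutely_continuous (\<Pi>\<^sub>M i\<in>I. lborel) (distr M (\<Pi>\<^sub>M i\<in>I. lborel) (\<lambda>\<omega>. \<lambda>i\<in>I. Z i \<omega>))"
  shows "absolutely_continuous (\<Pi>\<^sub>M i\<in>insert i0 I. lborel)
           (distr M (\<Pi>\<^sub>M i\<in>insert i0 I. lborel) (\<lambda>\<omega>. \<lambda>i\<in>insert i0 I. Z i \<omega>))"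
proof -
  let ?K = "insert i0 I"
  let ?paths = "PiM UNIV (\<lambda>_. borel) :: (real \<Rightarrow> real) measure"
  define c where "c = L2_inner (leb q) (L i0) (tensor q (\<lambda>_. indicator {u<..v}))"
  define shifted where "shifted = (\<lambda>s \<omega> t. brownian_path \<omega> t + s * clip_path u v t)"
  define poly_of where "poly_of = (\<lambda>(a :: nat \<Rightarrow> 'a \<Rightarrow> real) \<omega> (s::real). fact q * (\<Sum>j\<le>q. s ^ j / fact j * a j \<omega>))"
  define good where "good = (\<lambda>i (\<Psi>, a). (\<forall>k::nat. \<Psi> k \<in> borel_measurable ?paths)
     \<and> (\<forall>j. a j \<in> borel_measurable M)
     \<and> (AE \<omega> in M. \<forall>s. (\<lambda>k. \<Psi> k (shifted s \<omega>)) \<longlonglongrightarrow> poly_of a \<omega> s)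
     \<and> (AE \<omega> in M. fact q * a 0 \<omega> = Z i \<omega>)
     \<and> (i = i0 \<longrightarrow> (AE \<omega> in M. a q \<omega> = c))
     \<and> (i \<in> I \<longrightarrow> (AE \<omega> in M. \<forall>j\<in>{1..q}. a j \<omega> = 0)))"
  have "\<exists>\<Psi>a. i \<in> ?K \<longrightarrow> good i \<Psi>a" for i
  proof (cases "i \<in> ?K")
    case True
    from multiple_integral_shift[OF Z[OF True] uv] obtain \<Psi> a where
      *: "\<And>k::nat. \<Psi> k \<in> borel_measurable ?paths" "\<And>j. a j \<in> borel_measurable M"
      "AE \<omega> in M. \<forall>s. (\<lambda>k. \<Psi> k (\<lambda>t. brownian_path \<omega> t + s * clip_path u v t)) \<longlonglongrightarrow> fact q * (\<Sum>j\<le>q. s ^ j / fact j * a j \<omega>)"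
      "AE \<omega> in M. fact q * a 0 \<omega> = Z i \<omega>"
      "AE \<omega> in M. a q \<omega> = L2_inner (leb q) (L i) (tensor q (\<lambda>_. indicator {u<..v}))"
      "(\<forall>\<xi>. \<xi> 1 \<in> {u<..v} \<longrightarrow> L i \<xi> = 0) \<longrightarrow> (AE \<omega> in M. \<forall>j\<in>{1..q}. a j \<omega> = 0)"
      by blast
    have "good i (\<Psi>, a)"
      unfolding good_def shifted_def poly_of_def c_def using * past by auto
    then show ?thesis by blast
  qed simp
  then obtain \<Psi>a where \<Psi>a: "\<And>i. i \<in> ?K \<Longrightarrow> good i (\<Psi>a i)" by metis
  define \<Psi> a where "\<Psi> = (\<lambda>i. fst (\<Psi>a i))" and "a = (\<lambda>i. snd (\<Psi>a i))"
  have good: "good i (\<Psi> i, a i)" if "i \<in> ?K" for i using \<Psi>a[OF that] by (simp add: \<Psi>_def a_def)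
  have \<Psi>_meas: "\<Psi> i k \<in> borel_measurable ?paths" and a_meas: "a i j \<in> borel_measurable M" if "i \<in> ?K" for i j k
    using good[OF that] by (auto simp: good_def)
  have Z_meas: "Z i \<in> borel_measurable M" if "i \<in> ?K" for i
    using Z[OF that] by (auto simp: multiple_wiener_integral_def L2_extension_def L2_tendsto_def L2_def)
  define Z_at where "Z_at = (\<lambda>J \<omega>. \<lambda>i\<in>J. Z i \<omega>)"
  have Z_at_I: "Z_at I \<in> measurable M (\<Pi>\<^sub>M i\<in>I. lborel)" and Z_at_K: "Z_at ?K \<in> measurable M (\<Pi>\<^sub>M i\<in>?K. lborel)"
    unfolding Z_at_def using Z_meas by (auto intro!: measurable_restrict)
  \<comment> \<open>\<open>\<Lambda>\<close> recovers the vector from the path, translated or not, as a limit of the approximating functionals.\<close>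
  define \<Lambda> where "\<Lambda> = (\<lambda>x. \<lambda>i\<in>?K. lim (\<lambda>k. \<Psi> i k x))"
  have \<Lambda> [measurable]: "\<Lambda> \<in> measurable ?paths (\<Pi>\<^sub>M i\<in>?K. lborel)"
    unfolding \<Lambda>_def using \<Psi>_meas by (auto intro!: measurable_restrict borel_measurable_lim_metric)
  have shifted_meas [measurable]: "shifted s \<in> measurable M ?paths" for s
    unfolding shifted_def by (rule measurable_brownian_path_shift)
  \<comment> \<open>One almost sure event carries all limits, for all indices and all \<open>s\<close> at once.\<close>
  have limits: "AE \<omega> in M. \<forall>i\<in>?K. (\<forall>s. (\<lambda>k. \<Psi> i k (shifted s \<omega>)) \<longlonglongrightarrow> poly_of (a i) \<omega> s)
      \<and> fact q * a i 0 \<omega> = Z i \<omega> \<and> (i = i0 \<longrightarrow> a i q \<omega> = c) \<and> (i \<in> I \<longrightarrow> (\<forall>j\<in>{1..q}. a i j \<omega> = 0))"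
  proof (rule AE_finite_allI)
    fix i assume "i \<in> ?K"
    then show "AE \<omega> in M. (\<forall>s. (\<lambda>k. \<Psi> i k (shifted s \<omega>)) \<longlonglongrightarrow> poly_of (a i) \<omega> s)
      \<and> fact q * a i 0 \<omega> = Z i \<omega> \<and> (i = i0 \<longrightarrow> a i q \<omega> = c) \<and> (i \<in> I \<longrightarrow> (\<forall>j\<in>{1..q}. a i j \<omega> = 0))"
      using good[of i] by (auto simp: good_def)
  qed (use I in simp)
  have poly_split: "poly_of b \<omega> s = fact q * b 0 \<omega> + fact q * (\<Sum>j\<in>{1..q}. s ^ j / fact j * b j \<omega>)" for b \<omega> s
  proof -
    have "{..q} = insert 0 {1..q}" by auto
    then show ?thesis unfolding poly_of_def by (simp add: distrib_left)
  qed
  have \<Lambda>_shifted: "AE \<omega> in M. \<forall>s. \<Lambda> (shifted s \<omega>) = (Z_at I \<omega>)(i0 := poly_of (a i0) \<omega> s)"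
    using limits
  proof eventually_elim
    case (elim \<omega>)
    have "\<Lambda> (shifted s \<omega>) i = ((Z_at I \<omega>)(i0 := poly_of (a i0) \<omega> s)) i" for s i
    proof (cases "i \<in> ?K")
      case True
      have "lim (\<lambda>k. \<Psi> i k (shifted s \<omega>)) = poly_of (a i) \<omega> s"
        using elim True by (intro limI) auto
      moreover have "poly_of (a i) \<omega> s = Z i \<omega>" if "i \<in> I"
        using elim that by (simp add: poly_split)
      ultimately show ?thesis using True I by (auto simp: \<Lambda>_def Z_at_def)
    qed (auto simp: \<Lambda>_def Z_at_def)
    then show ?case by auto
  qed
  have \<Lambda>_path: "AE \<omega> in M. \<Lambda> (brownian_path \<omega>) = Z_at ?K \<omega>"
    using \<Lambda>_shifted limits
  proof eventually_elim
    case (elim \<omega>)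
    have "brownian_path \<omega> = shifted 0 \<omega>" by (simp add: shifted_def)
    then have "\<Lambda> (brownian_path \<omega>) = (Z_at I \<omega>)(i0 := poly_of (a i0) \<omega> 0)" using elim(1) by simp
    also have "poly_of (a i0) \<omega> 0 = Z i0 \<omega>" using elim(2) by (simp add: poly_split power_0_left)
    finally show ?case using I by (auto simp: Z_at_def fun_eq_iff)
  qed
  have "null_sets (\<Pi>\<^sub>M i\<in>?K. lborel) \<subseteq> null_sets (distr M (\<Pi>\<^sub>M i\<in>?K. lborel) (Z_at ?K))"
  proof
    fix N assume N: "N \<in> null_sets (\<Pi>\<^sub>M i\<in>?K. lborel :: real measure)"
    then have [measurable]: "N \<in> sets (\<Pi>\<^sub>M i\<in>?K. lborel :: real measure)" by auto
    define S where "S = {x \<in> space (\<Pi>\<^sub>M i\<in>I. lborel). {y. x(i0 := y) \<in> N} \<notin> null_sets lborel}"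
    \<comment> \<open>The set \<open>S\<close> of points with a bad section need not be measurable, so it is enclosed in a null set.\<close>
    obtain S' where S': "S \<subseteq> S'" "S' \<in> null_sets (\<Pi>\<^sub>M i\<in>I. lborel)"
      using AE_null_sections_insert[OF I N] unfolding S_def eventually_ae_filter by blast
    have "S' \<in> null_sets (distr M (\<Pi>\<^sub>M i\<in>I. lborel) (Z_at I))"
      using ac S'(2) unfolding absolutely_continuous_def Z_at_def by auto
    then have "AE x in distr M (\<Pi>\<^sub>M i\<in>I. lborel) (Z_at I). x \<notin> S'" by (rule AE_not_in)
    then have "AE \<omega> in M. Z_at I \<omega> \<notin> S'"
      using S'(2) Z_at_I by (subst (asm) AE_distr_iff) auto
    then have sections: "AE \<omega> in M. {y. (Z_at I \<omega>)(i0 := y) \<in> N} \<in> null_sets lborel"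
      using AE_space
    proof eventually_elim
      case (elim \<omega>)
      with S' measurable_space[OF Z_at_I] show ?case by (auto simp: S_def)
    qed
    have AE_AE: "AE \<omega> in M. AE s in lborel. (Z_at I \<omega>)(i0 := poly_of (a i0) \<omega> s) \<notin> N"
      using sections limits
    proof eventually_elim
      case (elim \<omega>)
      \<comment> \<open>For fixed \<open>\<omega>\<close> the translated last coordinate is a polynomial in \<open>s\<close> with leading coefficient \<open>c \<noteq> 0\<close>.\<close>
      define p where "p = (\<Sum>j\<le>q. monom (fact q / fact j * a i0 j \<omega>) j)"
      have "poly p s = poly_of (a i0) \<omega> s" for s
        by (simp add: p_def poly_sum poly_monom poly_of_def sum_distrib_left mult_ac)
      moreover have "coeff p q = c" using elim(2) by (simp add: p_def coeff_sum)
      then have "0 < degree p" using top q le_degree[of p q] by (simp add: c_def)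
      then have "{s. poly p s \<in> {y. (Z_at I \<omega>)(i0 := y) \<in> N}} \<in> null_sets lborel"
        by (rule null_sets_vimage_poly[OF elim(1)])
      ultimately have "{s. (Z_at I \<omega>)(i0 := poly_of (a i0) \<omega> s) \<in> N} \<in> null_sets lborel" by simp
      from AE_not_in[OF this] show ?case by simp
    qed
    have joint: "(\<lambda>(\<omega>, s). (Z_at I \<omega>)(i0 := poly_of (a i0) \<omega> s)) \<in> measurable (M \<Otimes>\<^sub>M lborel) (\<Pi>\<^sub>M i\<in>?K. lborel)"
    proof -
      have "(\<lambda>(\<omega>, s). poly_of (a i0) \<omega> s) \<in> measurable (M \<Otimes>\<^sub>M lborel) lborel"
        unfolding poly_of_def case_prod_unfold using a_meas[of i0] by measurable
      then have "(\<lambda>z. (Z_at I (fst z), poly_of (a i0) (fst z) (snd z))) \<in> measurable (M \<Otimes>\<^sub>M lborel) ((\<Pi>\<^sub>M i\<in>I. lborel) \<Otimes>\<^sub>M lborel)"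
        using Z_at_I by (intro measurable_Pair measurable_compose[OF measurable_fst]) (auto simp: case_prod_unfold)
      from measurable_compose[OF this measurable_add_dim[of i0 I "\<lambda>_. lborel"]] show ?thesis
        by (simp add: case_prod_unfold)
    qed
    interpret P: pair_sigma_finite M "lborel :: real measure" ..
    have "AE s in lborel. AE \<omega> in M. (Z_at I \<omega>)(i0 := poly_of (a i0) \<omega> s) \<notin> N"
    proof (subst P.AE_commute[symmetric])
      have "(\<lambda>(\<omega>, s). (Z_at I \<omega>)(i0 := poly_of (a i0) \<omega> s)) -` (space (\<Pi>\<^sub>M i\<in>?K. lborel :: real measure) - N)
          \<inter> space (M \<Otimes>\<^sub>M lborel) \<in> sets (M \<Otimes>\<^sub>M lborel)"
        by (rule measurable_sets[OF joint]) measurable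
      also have "(\<lambda>(\<omega>, s). (Z_at I \<omega>)(i0 := poly_of (a i0) \<omega> s)) -` (space (\<Pi>\<^sub>M i\<in>?K. lborel :: real measure) - N)
          \<inter> space (M \<Otimes>\<^sub>M lborel) = {x \<in> space (M \<Otimes>\<^sub>M lborel). (Z_at I (fst x))(i0 := poly_of (a i0) (fst x) (snd x)) \<notin> N}"
        using measurable_space[OF joint] by (auto simp: case_prod_unfold)
      finally show "{x \<in> space (M \<Otimes>\<^sub>M lborel). (Z_at I (fst x))(i0 := poly_of (a i0) (fst x) (snd x)) \<notin> N} \<in> sets (M \<Otimes>\<^sub>M lborel)" .
    qed (rule AE_AE)
    then obtain s where s: "AE \<omega> in M. (Z_at I \<omega>)(i0 := poly_of (a i0) \<omega> s) \<notin> N"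
    proof -
      have "\<exists>s. AE \<omega> in M. (Z_at I \<omega>)(i0 := poly_of (a i0) \<omega> s) \<notin> N"
      proof (rule ccontr)
        assume "\<not> ?thesis"
        with \<open>AE s in lborel. AE \<omega> in M. (Z_at I \<omega>)(i0 := poly_of (a i0) \<omega> s) \<notin> N\<close>
        have "AE s in (lborel :: real measure). False" by simp
        then show False by (simp add: AE_iff_null null_sets_def)
      qed
      with that show thesis by blast
    qed
    have pred: "{x \<in> space ?paths. \<Lambda> x \<notin> N} \<in> sets ?paths" by measurable
    \<comment> \<open>A single \<open>s\<close> suffices: the Cameron--Martin density is positive, so null events carry over from the translated path.\<close>
    have "AE \<omega> in M. \<Lambda> (shifted s \<omega>) \<notin> N"
      using s \<Lambda>_shifted by eventually_elim simp
    then have "AE x in distr M ?paths (shifted s). \<Lambda> x \<notin> N"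
      using pred by (subst AE_distr_iff) auto
    then have "AE x in distr (density M (\<lambda>\<omega>. ennreal (cameron_martin_density u v s \<omega>))) ?paths brownian_path. \<Lambda> x \<notin> N"
      unfolding cameron_martin[OF uv] shifted_def .
    then have "AE \<omega> in density M (\<lambda>\<omega>. ennreal (cameron_martin_density u v s \<omega>)). \<Lambda> (brownian_path \<omega>) \<notin> N"
      using pred by (subst (asm) AE_distr_iff) auto
    then have "AE \<omega> in M. \<Lambda> (brownian_path \<omega>) \<notin> N"
      by (subst (asm) AE_density) (auto simp: cameron_martin_density_def)
    with \<Lambda>_path have "AE \<omega> in M. Z_at ?K \<omega> \<notin> N" by eventually_elim simp
    then have "AE x in distr M (\<Pi>\<^sub>M i\<in>?K. lborel) (Z_at ?K). x \<notin> N"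
      using Z_at_K by (subst AE_distr_iff) auto
    then show "N \<in> null_sets (distr M (\<Pi>\<^sub>M i\<in>?K. lborel) (Z_at ?K))"
      by (subst AE_iff_null_sets) auto
  qed
  then show ?thesis by (simp add: absolutely_continuous_def Z_at_def)
qed

end

text \<open>
  The times are added in increasing order, each together with the translation on the interval
  between its predecessor (\<open>0\<close> for the first time) and itself.
\<close>
lemma hermite_vector_absolutely_continuous:
  assumes "prob_space M" "two_sided_brownian_motion M B"
    and q: "1 \<le> q" and H: "1 / 2 < H" "H < 1"
    and Z: "hermite_process M B H q Z"
    and t: "0 < t 1" "strict_mono_on {1..n} t"
  shows "absolutely_continuous (leb n) (distr M (leb n) (\<lambda>\<omega>. \<lambda>i\<in>{1..n}. Z (t i) \<omega>))"
  using t(2)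
proof (induction n)
  case 0
  have "null_sets (leb 0) = {{}}" by (simp add: PiM_empty null_sets_count_space)
  then show ?case by (simp add: absolutely_continuous_def)
next
  case (Suc n)
  interpret brownian M B using assms(1,2) by (simp add: brownian_def brownian_axioms_def)
  have mono: "t i < t j" if "i < j" "i \<in> {1..Suc n}" "j \<in> {1..Suc n}" for i j
    using Suc.prems that by (auto simp: strict_mono_on_def)
  have pos: "0 < t i" if "i \<in> {1..Suc n}" for i
    using mono[of 1 i] t(1) that by (cases "i = 1") auto
  define u where "u = (if n = 0 then 0 else t n)"
  have u: "0 \<le> u" "u < t (Suc n)"
    using pos[of "Suc n"] pos[of n] mono[of n "Suc n"] by (auto simp: u_def)
  have past: "t i \<le> u" if "i \<in> {1..n}" for i
    using mono[of i n] that by (cases "i = n") (auto simp: u_def)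
  have mwi: "multiple_wiener_integral M B q (hermite_kernel H q (t i)) (Z (t i))" for i
    using Z by (simp add: hermite_process_def)
  have "absolutely_continuous (\<Pi>\<^sub>M i\<in>insert (Suc n) {1..n}. lborel)
     (distr M (\<Pi>\<^sub>M i\<in>insert (Suc n) {1..n}. lborel) (\<lambda>\<omega>. \<lambda>i\<in>insert (Suc n) {1..n}. Z (t i) \<omega>))"
  proof (rule absolutely_continuous_insert[where L = "\<lambda>i. hermite_kernel H q (t i)", OF _ _ q u(2) mwi])
    fix i \<xi> assume i: "i \<in> {1..n}" and "\<xi> (1::nat) \<in> {u<..t (Suc n)}"
    then show "hermite_kernel H q (t i) \<xi> = 0"
      using past[OF i] pos[of i] q by (intro hermite_kernel_eq_0[of _ 1]) auto
  next
    show "L2_inner (leb q) (hermite_kernel H q (t (Suc n))) (tensor q (\<lambda>_. indicator {u<..t (Suc n)})) \<noteq> 0"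
      using mwi[of "Suc n"] by (intro hermite_kernel_inner_pos q H u) (simp add: multiple_wiener_integral_def L2_sym_def)
    show "absolutely_continuous (leb n) (distr M (leb n) (\<lambda>\<omega>. \<lambda>i\<in>{1..n}. Z (t i) \<omega>))"
      using Suc.prems by (intro Suc.IH) (auto simp: strict_mono_on_def)
  qed auto
  moreover have "insert (Suc n) {1..n} = {1..Suc n}" by auto
  ultimately show ?case by (simp only:)
qed

theorem theorem1p1:
  fixes M :: "'a measure" and B Z :: "real \<Rightarrow> 'a \<Rightarrow> real"
    and H :: real and q n :: nat and t :: "nat \<Rightarrow> real"
  assumes "prob_space M" and "complete_measure M"
    and "two_sided_brownian_motion M B"
    and "q \<ge> 1" and "1 / 2 < H" and "H < 1"
    and "hermite_process M B H q Z"
    and "n \<ge> 2" and "0 < t 1" and "strict_mono_on {1..n} t"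
  shows "\<exists>f. distributed M (leb n) (\<lambda>\<omega>. \<lambda>i\<in>{1..n}. Z (t i) \<omega>) f"
proof -
  interpret product_sigma_finite "\<lambda>_::nat. lborel :: real measure" ..
  interpret leb: sigma_finite_measure "leb n" by (rule sigma_finite) simp
  let ?X = "\<lambda>\<omega>. \<lambda>i\<in>{1..n}. Z (t i) \<omega>"
  have "Z s \<in> borel_measurable M" for s
    using assms(7)
    by (auto simp: hermite_process_def multiple_wiener_integral_def L2_extension_def L2_tendsto_def L2_def)
  then have X: "?X \<in> measurable M (leb n)" by (intro measurable_restrict) simp
  have "absolutely_continuous (leb n) (distr M (leb n) ?X)"
    using assms by (intro hermite_vector_absolutely_continuous)
  then obtain f where "f \<in> borel_measurable (leb n)" "density (leb n) f = distr M (leb n) ?X"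
    using leb.Radon_Nikodym[of "distr M (leb n) ?X"] by auto
  with X have "distributed M (leb n) ?X f" by (simp add: distributed_def)
  then show ?thesis by blast
qed

end
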